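(* Let $0<q<1$, let $f:[0,\infty)\times\mathbb{R}^d\times\mathbb{R}^d\to\mathbb{R}^d$ and $g:[0,\infty)\times\mathbb{R}^d\times\mathbb{R}^d\to\mathbb{R}^{d\times m}$ satisfy $f(t,0,0)=0$ and $g(t,0,0)=0$ for all $t\ge 0$, and consider the stochastic pantograph differential equation $$dx(t)=f(t,x(t),x(qt))\,dt+g(t,x(t),x(qt))\,dB(t),\quad t\ge 0,\qquad x(0)=x_0,\quad E|x_0|^2<\infty .$$ Suppose there are real numbers $a$ and $b>0$, $c>0$, $d_0>0$ such that for all $t\ge 0$ and all $x,y,x_1,x_2,y_1,y_2\in\mathbb{R}^d$: $$\langle x_1-x_2,\,f(t,x_1,y)-f(t,x_2,y)\rangle\le a|x_1-x_2|^2,\qquad |f(t,x,y_1)-f(t,x,y_2)|\le b|y_1-y_2|,$$ $$|g(t,x_1,y)-g(t,x_2,y)|\le c|x_1-x_2|,\qquad |g(t,x,y_1)-g(t,x,y_2)|\le d_0|y_1-y_2| .$$ If $2a+b+2c^2+(b+2d_0^2)/q<0$, then the zero solution of the equation is almost surely polynomially stable; that is, there exists a constant $\alpha<0$ such that for every initial value $x_0$ with $E|x_0|^2<\infty$, the solution $x(t)$ with $x(0)=x_0$ satisfies $$\limsup_{t\to\infty}\frac{\log |x(t)|}{\log t}\le\alpha\quad\text{almost surely}.$$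
   Context: $(\Omega,\mathcal{F},P)$ is a complete probability space with a filtration $\{\mathcal{F}_t\}_{t\ge0}$ satisfying the usual conditions, and $B$ is an $m$-dimensional Brownian motion with respect to this filtration. $|\cdot|$ is the Euclidean norm on vectors and the trace norm $|A|=\sqrt{\operatorname{trace}(A^TA)}$ on matrices; $\langle x,y\rangle=x^Ty$. A solution is a continuous $\{\mathcal{F}_t\}$-adapted $\mathbb{R}^d$-valued process $x$ (so $x_0$ is $\mathcal{F}_0$-measurable) satisfying, almost surely for all $t\ge 0$, $x(t)=x_0+\int_0^t f(s,x(s),x(qs))\,ds+\int_0^t g(s,x(s),x(qs))\,dB(s)$, with these (Itô) integrals well defined. Convention: $\log 0=-\infty$. *)

theory Defs
  imports "HOL-Probability.Probability"
begin

definition trace_norm :: "real^'m^'d \<Rightarrow> real" where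
  "trace_norm A = sqrt (trace (transpose A ** A))"

(* The library norm on matrices is this norm; it is the one used in the definition of the
   Ito integral below. *)
lemma trace_norm_eq_norm: "trace_norm A = norm A"
proof -
  have "trace (transpose A ** A) = (\<Sum>j\<in>UNIV. \<Sum>i\<in>UNIV. (A $ i $ j)\<^sup>2)"
    by (simp add: trace_def transpose_def matrix_matrix_mult_def power2_eq_square)
  also have "\<dots> = (\<Sum>i\<in>UNIV. \<Sum>j\<in>UNIV. (A $ i $ j)\<^sup>2)"
    by (rule sum.swap)
  also have "\<dots> = (norm A)\<^sup>2"
    by (simp add: norm_vec_def L2_set_def sum_nonneg)
  finally show ?thesis
    by (simp add: trace_norm_def)
qed

(* Time is modelled by real; only indices t with 0 \<le> t are ever constrained or used. *)
definition usual_filtration :: "'a measure \<Rightarrow> (real \<Rightarrow> 'a measure) \<Rightarrow> bool" where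
  "usual_filtration M F \<longleftrightarrow>
     (\<forall>t\<ge>0. subalgebra M (F t)) \<and>
     (\<forall>s t. 0 \<le> s \<and> s \<le> t \<longrightarrow> sets (F s) \<subseteq> sets (F t)) \<and>
     (\<forall>t\<ge>0. sets (F t) = (\<Inter>u\<in>{t<..}. sets (F u))) \<and>
     null_sets M \<subseteq> sets (F 0)"

definition adapted :: "(real \<Rightarrow> 'a measure) \<Rightarrow> (real \<Rightarrow> 'a \<Rightarrow> 'b::topological_space) \<Rightarrow> bool" where
  "adapted F X \<longleftrightarrow> (\<forall>t\<ge>0. X t \<in> borel_measurable (F t))"

definition measurable_process :: "'a measure \<Rightarrow> (real \<Rightarrow> 'a \<Rightarrow> 'b::topological_space) \<Rightarrow> bool" where
  "measurable_process M X \<longleftrightarrow>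
     (\<lambda>(t, \<omega>). X t \<omega>) \<in> borel_measurable (restrict_space borel {0..} \<Otimes>\<^sub>M M)"

definition continuous_process :: "'a measure \<Rightarrow> (real \<Rightarrow> 'a \<Rightarrow> 'b::topological_space) \<Rightarrow> bool" where
  "continuous_process M X \<longleftrightarrow> (AE \<omega> in M. continuous_on {0..} (\<lambda>t. X t \<omega>))"

(* The increment over {s..t} is independent of F s and is N(0, (t - s) I)-distributed, i.e. its
   law has as density the product of the centred one-dimensional densities of variance t - s
   (the second argument of normal_density is the standard deviation). *)
definition brownian_motion ::
  "'a measure \<Rightarrow> (real \<Rightarrow> 'a measure) \<Rightarrow> (real \<Rightarrow> 'a \<Rightarrow> real^'m) \<Rightarrow> bool" where
  "brownian_motion M F B \<longleftrightarrow>
     adapted F B \<and> continuous_process M B \<and> (AE \<omega> in M. B 0 \<omega> = 0) \<and>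
     (\<forall>s t. 0 \<le> s \<and> s < t \<longrightarrow>
        prob_space.indep_set M (sets (F s))
          (sets (vimage_algebra (space M) (\<lambda>\<omega>. B t \<omega> - B s \<omega>) borel)) \<and>
        distributed M lborel (\<lambda>\<omega>. B t \<omega> - B s \<omega>)
          (\<lambda>z. ennreal (\<Prod>i\<in>UNIV. normal_density 0 (sqrt (t - s)) (z $ i))))"

(* A simple integrand is the step process taking, for i < n, the matrix value \<xi> i on the
   time interval {p i<..p (Suc i)}, where \<xi> i is bounded and F (p i)-measurable. *)
definition simple_integrand ::
  "'a measure \<Rightarrow> (real \<Rightarrow> 'a measure) \<Rightarrow> nat \<Rightarrow> (nat \<Rightarrow> real) \<Rightarrow>
   (nat \<Rightarrow> 'a \<Rightarrow> real^'m^'d) \<Rightarrow> bool" where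
  "simple_integrand M F n p \<xi> \<longleftrightarrow>
     0 \<le> p 0 \<and> (\<forall>i<n. p i < p (Suc i)) \<and>
     (\<forall>i<n. \<xi> i \<in> borel_measurable (F (p i)) \<and> (\<exists>K. \<forall>\<omega>\<in>space M. norm (\<xi> i \<omega>) \<le> K))"

definition simple_process ::
  "nat \<Rightarrow> (nat \<Rightarrow> real) \<Rightarrow> (nat \<Rightarrow> 'a \<Rightarrow> real^'m^'d) \<Rightarrow> real \<Rightarrow> 'a \<Rightarrow> real^'m^'d" where
  "simple_process n p \<xi> t \<omega> = (\<Sum>i<n. indicator {p i<..p (Suc i)} t *\<^sub>R \<xi> i \<omega>)"

definition simple_ito_integral ::
  "(real \<Rightarrow> 'a \<Rightarrow> real^'m) \<Rightarrow> nat \<Rightarrow> (nat \<Rightarrow> real) \<Rightarrow> (nat \<Rightarrow> 'a \<Rightarrow> real^'m^'d) \<Rightarrow>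
   real \<Rightarrow> 'a \<Rightarrow> real^'d" where
  "simple_ito_integral B n p \<xi> t \<omega> =
     (\<Sum>i<n. \<xi> i \<omega> *v (B (min (p (Suc i)) t) \<omega> - B (min (p i) t) \<omega>))"

(* The Ito integral of a measurable adapted integrand H with locally square integrable paths:
   the continuous adapted process I to which the elementary integrals of simple integrands
   converge, uniformly on compact time intervals in probability, when the simple integrands
   converge to H in L2 of {0..T} in probability for every T. It is determined by H up to
   indistinguishability. The deviation event in the last clause, an uncountable union over t,
   is an event because M is complete and paths are almost surely continuous. *)
definition has_ito_integral ::
  "'a measure \<Rightarrow> (real \<Rightarrow> 'a measure) \<Rightarrow> (real \<Rightarrow> 'a \<Rightarrow> real^'m) \<Rightarrow>
   (real \<Rightarrow> 'a \<Rightarrow> real^'m^'d) \<Rightarrow> (real \<Rightarrow> 'a \<Rightarrow> real^'d) \<Rightarrow> bool" where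
  "has_ito_integral M F B H I \<longleftrightarrow>
     adapted F H \<and> measurable_process M H \<and>
     (AE \<omega> in M. \<forall>t\<ge>0. set_integrable lborel {0..t} (\<lambda>s. (norm (H s \<omega>))\<^sup>2)) \<and>
     adapted F I \<and> continuous_process M I \<and>
     (\<exists>n p \<xi>.
        (\<forall>k. simple_integrand M F (n k) (p k) (\<xi> k)) \<and>
        (\<forall>T\<ge>0. \<forall>\<epsilon>>0.
           (\<lambda>k. measure M {\<omega> \<in> space M.
              ennreal \<epsilon> < (\<integral>\<^sup>+s\<in>{0..T}.
                 ennreal ((norm (simple_process (n k) (p k) (\<xi> k) s \<omega> - H s \<omega>))\<^sup>2) \<partial>lborel)})
           \<longlonglongrightarrow> 0) \<and>
        (\<forall>T\<ge>0. \<forall>\<epsilon>>0.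
           (\<lambda>k. measure M {\<omega> \<in> space M. \<exists>t\<in>{0..T}.
              \<epsilon> < norm (simple_ito_integral B (n k) (p k) (\<xi> k) t \<omega> - I t \<omega>)})
           \<longlonglongrightarrow> 0))"

(* x solves dx(t) = f(t, x(t), x(qt)) dt + g(t, x(t), x(qt)) dB(t), x(0) = x0. *)
definition pantograph_solution ::
  "'a measure \<Rightarrow> (real \<Rightarrow> 'a measure) \<Rightarrow> (real \<Rightarrow> 'a \<Rightarrow> real^'m) \<Rightarrow> real \<Rightarrow>
   (real \<Rightarrow> real^'d \<Rightarrow> real^'d \<Rightarrow> real^'d) \<Rightarrow> (real \<Rightarrow> real^'d \<Rightarrow> real^'d \<Rightarrow> real^'m^'d) \<Rightarrow>
   ('a \<Rightarrow> real^'d) \<Rightarrow> (real \<Rightarrow> 'a \<Rightarrow> real^'d) \<Rightarrow> bool" where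
  "pantograph_solution M F B q f g x0 x \<longleftrightarrow>
     adapted F x \<and> continuous_process M x \<and> (AE \<omega> in M. x 0 \<omega> = x0 \<omega>) \<and>
     adapted F (\<lambda>s \<omega>. f s (x s \<omega>) (x (q * s) \<omega>)) \<and>
     measurable_process M (\<lambda>s \<omega>. f s (x s \<omega>) (x (q * s) \<omega>)) \<and>
     (AE \<omega> in M. \<forall>t\<ge>0. set_integrable lborel {0..t} (\<lambda>s. f s (x s \<omega>) (x (q * s) \<omega>))) \<and>
     (\<exists>I. has_ito_integral M F B (\<lambda>s \<omega>. g s (x s \<omega>) (x (q * s) \<omega>)) I \<and>
        (AE \<omega> in M. \<forall>t\<ge>0.
           x t \<omega> = x0 \<omega> + (LINT s:{0..t}|lborel. f s (x s \<omega>) (x (q * s) \<omega>)) + I t \<omega>))"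

(* Real logarithm on {0..} with log 0 = -\<infinity>. *)
definition log_ext :: "real \<Rightarrow> ereal" where
  "log_ext r = (if r = 0 then - \<infinity> else ereal (ln r))"

end

theory Submission
  imports Defs
begin

text \<open>
  Put \<open>w t = (1 + t) powr \<epsilon>\<close> with \<open>\<epsilon> > 0\<close> so small that
  \<open>\<epsilon> + l1 + l2 * q powr (-1 - \<epsilon>) \<le> 0\<close>, where \<open>l1 = 2 * a + b + 2 * c\<^sup>2\<close> and \<open>l2 = b + 2 * d0\<^sup>2\<close>.
  The drift of \<open>w t * |x t|\<^sup>2\<close> then has a nonpositive time integral, because the substitution
  \<open>r = q * s\<close> turns the delayed term into an undelayed one at the cost of the factor
  \<open>q powr (-1 - \<epsilon>)\<close>. So \<open>w t * |x t|\<^sup>2\<close> is dominated by \<open>|x0|\<^sup>2\<close> plus a local martingale, which gives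
  the maximal inequality \<open>R\<^sup>2 * P (sup w |x|\<^sup>2 > R\<^sup>2) \<le> E |x0|\<^sup>2\<close>. Hence \<open>w |x|\<^sup>2\<close> is almost surely
  bounded, and the decay exponent is \<open>- \<epsilon> / 2\<close>.

  The Ito formula is replaced by a discretisation. On a grid refining the partition of an
  approximating simple integrand \<open>\<eta>\<close>, the approximation \<open>y\<close> of \<open>x\<close> has increments
  \<open>A + e\<close> with \<open>A\<close> an increment of the drift integral and \<open>e = \<eta> (B t - B s)\<close>. The terms
  \<open>w * (2 * (y \<bullet> e) + |e|\<^sup>2 - |\<eta>|\<^sup>2 * (t - s))\<close> are martingale differences, and the remaining part of the
  increments of \<open>w |y|\<^sup>2\<close> is asymptotically nonpositive for almost every path. The martingale is
  stopped when \<open>w |y|\<^sup>2\<close> exceeds \<open>R\<^sup>2\<close> or the accumulated \<open>|\<eta>|\<^sup>2\<close> exceeds a constant; this makes it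
  bounded in \<open>L\<^sup>2\<close>, and Fatou's lemma passes to the limit.
\<close>

section \<open>Gaussian increments\<close>

text \<open>Two obstacles shape the proof. First, \<open>f\<close> is only one-sided Lipschitz in
  its first argument, so along a path the drift is merely integrable in time, and only its pairing
  with the solution can be estimated. Second, the Ito integral is given only as a limit in
  probability of elementary integrals. Stopping and second moments are therefore handled on the
  discrete level, where each step is a coefficient known at its left end times a Gaussian increment.

  The work is split accordingly. The analytic lemmas concern a single path; their threshold for a
  fine enough grid may depend on that path. The moment bounds hold on every grid, with constants
  depending only on the horizon, the level and the coefficients. The two sides meet in one Fatou
  argument, which asks only for asymptotic lower bounds path by path. Since only lower bounds enter,
  the jump of the discrete process over the level at the stopping index may be arbitrarily
  large.\<close>

lemma has_bochner_integral_lborel_vec_prod: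
  fixes h :: "'m::finite \<Rightarrow> real \<Rightarrow> real"
  assumes "\<And>i. has_bochner_integral lborel (h i) (c i)"
  shows "has_bochner_integral lborel (\<lambda>z::real^'m. \<Prod>i\<in>UNIV. h i (z $ i)) (\<Prod>i\<in>UNIV. c i)"
proof -
  interpret P: product_sigma_finite "\<lambda>_::real^'m. lborel :: real measure"
    by standard
  let ?V = "\<lambda>x. \<Sum>b\<in>Basis. x b *\<^sub>R (b :: real^'m)"
  let ?f = "\<lambda>b :: real^'m. h (axis_index b)"
  have int: "integrable lborel (?f b)" for b
    using assms has_bochner_integral_iff by blast
  have reindex: "(\<Prod>b\<in>Basis. k b) = (\<Prod>i\<in>UNIV. k (axis i 1))" for k :: "real^'m \<Rightarrow> real"
  proof -
    have B: "Basis = range (\<lambda>i::'m. axis i (1::real))"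
      by (auto simp: Basis_vec_def)
    show ?thesis
      unfolding B by (subst prod.reindex) (auto simp: inj_on_def axis_eq_axis)
  qed
  have comp: "?V x $ i = x (axis i 1)" for x i
  proof -
    have "?V x $ i = ?V x \<bullet> axis i 1"
      by (simp add: inner_axis)
    also have "\<dots> = x (axis i 1)"
      by (subst inner_sum_left_Basis) (auto simp: Basis_vec_def)
    finally show ?thesis .
  qed
  have eq: "(\<Prod>i\<in>UNIV. h i (?V x $ i)) = (\<Prod>b\<in>Basis. ?f b (x b))" for x
    unfolding comp reindex by (simp add: axis_index_axis)
  have [measurable]: "h i \<in> borel_measurable borel" for i
    using int[of "axis i 1"] by (auto simp: axis_index_axis dest: borel_measurable_integrable)
  have m: "(\<lambda>z::real^'m. \<Prod>i\<in>UNIV. h i (z $ i)) \<in> borel_measurable borel"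
    by measurable
  have Vm: "?V \<in> (\<Pi>\<^sub>M b\<in>Basis. lborel) \<rightarrow>\<^sub>M borel"
    by measurable
  have "integrable lborel (\<lambda>z::real^'m. \<Prod>i\<in>UNIV. h i (z $ i))"
    \<comment> \<open>\<open>lborel_eq\<close> presents Lebesgue measure as the image of a product
      measure indexed by \<open>Basis\<close>. Under this map the coordinate \<open>i\<close>
      becomes the factor at \<open>axis i 1\<close>, so the integrand is a product of
      one-dimensional functions.\<close>
    apply (subst lborel_eq)
    apply (subst integrable_distr_eq[OF Vm m])
    apply (subst eq)
    apply (rule P.product_integrable_prod[OF finite_Basis int])
    done
  moreover have "(LBINT z::real^'m. (\<Prod>i\<in>UNIV. h i (z $ i))) = (\<Prod>i\<in>UNIV. c i)"
    apply (subst lborel_eq)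
    apply (subst integral_distr[OF Vm m])
    apply (subst eq)
    apply (subst P.product_integral_prod[OF finite_Basis int])
    apply (simp add: reindex axis_index_axis has_bochner_integral_integral_eq[OF assms])
    done
  ultimately show ?thesis
    by (simp add: has_bochner_integral_iff)
qed

context prob_space
begin

text \<open>The density factorises over the coordinates, hence so does the expectation of a product
  of coordinate functions. All Gaussian moments below come from choosing most of the
  \<open>h i\<close> equal to 1.\<close>

lemma normal_vec_prod_expectation:
  fixes D :: "'a \<Rightarrow> real^'m" and h :: "'m \<Rightarrow> real \<Rightarrow> real"
  assumes D: "distributed M lborel D (\<lambda>z. ennreal (\<Prod>i\<in>UNIV. normal_density 0 \<sigma> (z $ i)))"
    and [measurable]: "\<And>i. h i \<in> borel_measurable borel"
    and h: "\<And>i. has_bochner_integral lborel (\<lambda>x. normal_density 0 \<sigma> x * h i x) (c i)"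
  shows "has_bochner_integral M (\<lambda>\<omega>. \<Prod>i\<in>UNIV. h i (D \<omega> $ i)) (\<Prod>i\<in>UNIV. c i)"
proof -
  let ?g = "\<lambda>z::real^'m. \<Prod>i\<in>UNIV. h i (z $ i)"
  let ?f = "\<lambda>z::real^'m. \<Prod>i\<in>UNIV. normal_density 0 \<sigma> (z $ i)"
  have g: "?g \<in> borel_measurable lborel" by measurable
  have f: "0 \<le> ?f z" for z by (simp add: prod_nonneg)
  have "has_bochner_integral lborel (\<lambda>z. ?f z * ?g z) (\<Prod>i\<in>UNIV. c i)"
    using has_bochner_integral_lborel_vec_prod[OF h] by (simp add: prod.distrib)
  then show ?thesis
    using distributed_integral[OF D g f] distributed_integrable[OF D g f]
    by (simp add: has_bochner_integral_iff)
qed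

lemma normal_vec_component_power:
  fixes D :: "'a \<Rightarrow> real^'m"
  assumes D: "distributed M lborel D (\<lambda>z. ennreal (\<Prod>i\<in>UNIV. normal_density 0 \<sigma> (z $ i)))"
    and \<sigma>: "\<sigma> > 0"
    and k: "has_bochner_integral lborel (\<lambda>x. normal_density 0 \<sigma> x * x ^ k) c"
  shows "has_bochner_integral M (\<lambda>\<omega>. (D \<omega> $ a) ^ k) c"
proof -
  have 1: "has_bochner_integral lborel (\<lambda>x. normal_density 0 \<sigma> x * 1) 1"
    using normal_moment_even[OF \<sigma>, of 0 0] by simp
  have "has_bochner_integral M (\<lambda>\<omega>. \<Prod>i\<in>UNIV. (if i = a then D \<omega> $ i ^ k else 1))
      (\<Prod>i\<in>UNIV. if i = a then c else 1)"
    using normal_vec_prod_expectation[OF D, of "\<lambda>i x. if i = a then x ^ k else 1" "\<lambda>i. if i = a then c else 1"]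
      1 k by (auto split: if_splits)
  then show ?thesis by simp
qed

text \<open>Mean and covariance make the compensated increments centred; the fourth moment bounds
  the variance of their quadratic part.\<close>

lemma normal_vec_moments:
  fixes D :: "'a \<Rightarrow> real^'m"
  assumes D: "distributed M lborel D (\<lambda>z. ennreal (\<Prod>i\<in>UNIV. normal_density 0 \<sigma> (z $ i)))"
    and \<sigma>: "\<sigma> > 0"
  shows normal_vec_mean: "has_bochner_integral M (\<lambda>\<omega>. D \<omega> $ a) 0"
    and normal_vec_covariance:
      "has_bochner_integral M (\<lambda>\<omega>. D \<omega> $ a * D \<omega> $ b) (if a = b then \<sigma>\<^sup>2 else 0)"
    and normal_vec_fourth_moment: "has_bochner_integral M (\<lambda>\<omega>. (D \<omega> $ a) ^ 4) (3 * \<sigma> ^ 4)"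
proof -
  have 0: "has_bochner_integral lborel (\<lambda>x. normal_density 0 \<sigma> x * 1) 1"
    using normal_moment_even[OF \<sigma>, of 0 0] by simp
  have 1: "has_bochner_integral lborel (\<lambda>x. normal_density 0 \<sigma> x * x ^ 1) 0"
    using normal_moment_odd[OF \<sigma>, of 0 0] by simp
  have 2: "has_bochner_integral lborel (\<lambda>x. normal_density 0 \<sigma> x * x ^ 2) (\<sigma>\<^sup>2)"
    using normal_moment_even[OF \<sigma>, of 0 1] by simp
  have "fact (2 * 2) / ((2 / \<sigma>\<^sup>2) ^ 2 * fact 2) = 3 * \<sigma> ^ 4"
    using \<sigma> by (simp add: fact_numeral field_simps)
  then have 4: "has_bochner_integral lborel (\<lambda>x. normal_density 0 \<sigma> x * x ^ 4) (3 * \<sigma> ^ 4)"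
    using normal_moment_even[OF \<sigma>, of 0 2] by simp
  show "has_bochner_integral M (\<lambda>\<omega>. D \<omega> $ a) 0"
    using normal_vec_component_power[OF D \<sigma> 1, of a] by simp
  show "has_bochner_integral M (\<lambda>\<omega>. (D \<omega> $ a) ^ 4) (3 * \<sigma> ^ 4)"
    using normal_vec_component_power[OF D \<sigma> 4, of a] by simp
  show "has_bochner_integral M (\<lambda>\<omega>. D \<omega> $ a * D \<omega> $ b) (if a = b then \<sigma>\<^sup>2 else 0)"
  proof (cases "a = b")
    case True
    then show ?thesis
      using normal_vec_component_power[OF D \<sigma> 2, of a] by (simp add: power2_eq_square)
  next
    case False
    \<comment> \<open>Writing the selector as a product of two conditionals lets
      \<open>prod.distrib\<close> collapse it to the two factors at \<open>a\<close> and
      \<open>b\<close>, each of which has mean zero.\<close>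
    let ?h = "\<lambda>i x::real. (if i = a then x else 1) * (if i = b then x else 1)"
    let ?c = "\<lambda>i. if i = a \<or> i = b then 0 else (1::real)"
    have "has_bochner_integral M (\<lambda>\<omega>. \<Prod>i\<in>UNIV. ?h i (D \<omega> $ i)) (\<Prod>i\<in>UNIV. ?c i)"
      using normal_vec_prod_expectation[OF D, of ?h ?c] 0 1 False
      by (auto split: if_splits)
    moreover have "(\<Prod>i\<in>UNIV. ?c i) = 0"
      by (rule prod_zero) auto
    moreover have "(\<Prod>i\<in>UNIV. ?h i (D \<omega> $ i)) = D \<omega> $ a * D \<omega> $ b" for \<omega>
      by (simp add: prod.distrib)
    ultimately show ?thesis
      using False by simp
  qed
qed

lemma indep_set_mono:
  "indep_set \<A> \<B> \<Longrightarrow> \<A>' \<subseteq> \<A> \<Longrightarrow> \<B>' \<subseteq> \<B> \<Longrightarrow> indep_set \<A>' \<B>'"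
  unfolding indep_sets2_eq by blast

text \<open>\<open>brownian_motion\<close> states independence for sigma-algebras. It passes to the
  smaller ones generated by \<open>X\<close> and by \<open>h\<close> after \<open>D\<close>, which
  is independence of two random variables; their product is then integrable with the product
  expectation.\<close>

lemma indep_set_expectation_mult:
  fixes X :: "'a \<Rightarrow> real" and D :: "'a \<Rightarrow> 'b::topological_space"
  assumes G: "subalgebra M G" and D: "D \<in> borel_measurable M"
    and indep: "indep_set (sets G) (sets (vimage_algebra (space M) D borel))"
    and X: "X \<in> borel_measurable G" "integrable M X"
    and h: "h \<in> borel_measurable borel" "integrable M (\<lambda>\<omega>. h (D \<omega>))"
  shows "has_bochner_integral M (\<lambda>\<omega>. X \<omega> * h (D \<omega>)) (expectation X * expectation (\<lambda>\<omega>. h (D \<omega>)))"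
proof -
  have sp: "space G = space M" using G by (simp add: subalgebra_def)
  have Xm: "X \<in> borel_measurable M" using X by auto
  have 1: "sigma_sets (space M) {X -` A \<inter> space M |A. A \<in> sets borel} \<subseteq> sets G"
    unfolding sp[symmetric] by (rule sets.sigma_sets_subset) (use X(1) measurable_sets in auto)
  have 2: "sigma_sets (space M) {(\<lambda>\<omega>. h (D \<omega>)) -` A \<inter> space M |A. A \<in> sets borel}
      \<subseteq> sets (vimage_algebra (space M) D borel)"
  proof -
    have "\<exists>A'. (\<lambda>\<omega>. h (D \<omega>)) -` A \<inter> space M = D -` A' \<inter> space M \<and> A' \<in> sets borel"
      if "A \<in> sets borel" for A
      using measurable_sets[OF h(1) that] by (intro exI[of _ "h -` A"]) auto
    then show ?thesis
      unfolding sets_vimage_algebra by (intro sigma_sets_subseteq) blast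
  qed
  have "indep_set (sigma_sets (space M) {X -` A \<inter> space M |A. A \<in> sets borel})
     (sigma_sets (space M) {(\<lambda>\<omega>. h (D \<omega>)) -` A \<inter> space M |A. A \<in> sets borel})"
    by (rule indep_set_mono[OF indep 1 2])
  then have iv: "indep_var borel X borel (\<lambda>\<omega>. h (D \<omega>))"
    unfolding indep_var_eq using Xm D h(1) by simp
  show ?thesis
    using indep_var_lebesgue_integral[OF iv X(2) h(2)] indep_var_integrable[OF iv X(2) h(2)]
    by (simp add: has_bochner_integral_iff)
qed

end

section \<open>Norm and measurability of matrix-vector products\<close>

lemma norm_matrix_vector_mult_le:
  fixes v :: "real^'m^'d" and D :: "real^'m"
  shows "norm (v *v D) \<le> norm v * norm D"
proof -
  have "(norm (v *v D))\<^sup>2 = (\<Sum>i\<in>UNIV. ((v *v D) $ i)\<^sup>2)"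
    unfolding power2_norm_eq_inner inner_vec_def by (simp add: power2_eq_square)
  also have "\<dots> = (\<Sum>i\<in>UNIV. (v $ i \<bullet> D)\<^sup>2)"
    by (simp add: matrix_vector_mul_component)
  also have "\<dots> \<le> (\<Sum>i\<in>UNIV. (norm (v $ i))\<^sup>2 * (norm D)\<^sup>2)"
    by (intro sum_mono) (simp add: power2_norm_eq_inner Cauchy_Schwarz_ineq)
  also have "\<dots> = (norm v * norm D)\<^sup>2"
    by (simp add: power_mult_distrib sum_distrib_right[symmetric] power2_norm_eq_inner inner_vec_def)
  finally show ?thesis
    by (rule power2_le_imp_le) simp
qed

lemma borel_measurable_vec_nth_comp [measurable (raw)]:
  fixes f :: "'a \<Rightarrow> 'b::real_normed_vector^'n"
  assumes "f \<in> borel_measurable M"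
  shows "(\<lambda>x. f x $ i) \<in> borel_measurable M"
  using assms by (rule measurable_compose)
    (intro borel_measurable_continuous_onI continuous_intros)

lemma borel_measurable_vec_lambda:
  fixes f :: "'a \<Rightarrow> real^'n"
  assumes "\<And>i. (\<lambda>x. f x $ i) \<in> borel_measurable M"
  shows "f \<in> borel_measurable M"
  unfolding borel_measurable_euclidean_space[of f]
  using assms by (auto simp: Basis_vec_def inner_axis)

lemma borel_measurable_matrix_vector_mult:
  fixes v :: "'a \<Rightarrow> real^'m^'d" and D :: "'a \<Rightarrow> real^'m"
  assumes [measurable]: "v \<in> borel_measurable M" "D \<in> borel_measurable M"
  shows "(\<lambda>\<omega>. v \<omega> *v D \<omega>) \<in> borel_measurable M"
  by (rule borel_measurable_vec_lambda) (simp add: matrix_vector_mult_def)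

section \<open>The filtered space and a single Brownian increment\<close>

locale brownian_space = prob_space M for M :: "'a measure" +
  fixes F :: "real \<Rightarrow> 'a measure" and B :: "real \<Rightarrow> 'a \<Rightarrow> real^'m"
  assumes filtration: "usual_filtration M F" and brownian: "brownian_motion M F B"
begin

lemma subalg: "0 \<le> t \<Longrightarrow> subalgebra M (F t)"
  using filtration unfolding usual_filtration_def by blast

lemma space_F: "0 \<le> t \<Longrightarrow> space (F t) = space M"
  using subalg by (simp add: subalgebra_def)

lemma subalg_mono: "0 \<le> s \<Longrightarrow> s \<le> t \<Longrightarrow> subalgebra (F t) (F s)"
proof -
  assume st: "0 \<le> s" "s \<le> t"
  then have "sets (F s) \<subseteq> sets (F t)"
    using filtration unfolding usual_filtration_def by blast
  then show ?thesis
    using space_F[of s] space_F[of t] st by (simp add: subalgebra_def)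
qed

lemma measurable_F_M: "X \<in> borel_measurable (F t) \<Longrightarrow> 0 \<le> t \<Longrightarrow> X \<in> borel_measurable M"
  by (rule measurable_from_subalg[OF subalg])

lemma measurable_F_mono:
  "X \<in> borel_measurable (F s) \<Longrightarrow> 0 \<le> s \<Longrightarrow> s \<le> t \<Longrightarrow> X \<in> borel_measurable (F t)"
  by (rule measurable_from_subalg[OF subalg_mono])

lemma B_adapted: "0 \<le> t \<Longrightarrow> B t \<in> borel_measurable (F t)"
  using brownian by (simp add: brownian_motion_def adapted_def)

lemma B_measurable: "0 \<le> t \<Longrightarrow> B t \<in> borel_measurable M"
  by (rule measurable_F_M[OF B_adapted])

end

locale brownian_increment = brownian_space M F B
  for M :: "'a measure" and F and B :: "real \<Rightarrow> 'a \<Rightarrow> real^'m" +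
  fixes s t :: real
  assumes s: "0 \<le> s" and st: "s < t"
begin

definition D where "D \<omega> = B t \<omega> - B s \<omega>"

lemma D_measurable: "D \<in> borel_measurable M"
  unfolding D_def[abs_def] using s st by (intro borel_measurable_diff B_measurable) auto

lemma D_distributed:
  "distributed M lborel D (\<lambda>z. ennreal (\<Prod>i\<in>UNIV. normal_density 0 (sqrt (t - s)) (z $ i)))"
  using brownian s st unfolding D_def[abs_def] brownian_motion_def by blast

lemma expectation_mult:
  fixes X :: "'a \<Rightarrow> real" and h :: "real^'m \<Rightarrow> real"
  assumes "X \<in> borel_measurable (F s)" "integrable M X"
    and "h \<in> borel_measurable borel" "integrable M (\<lambda>\<omega>. h (D \<omega>))"
  shows "has_bochner_integral M (\<lambda>\<omega>. X \<omega> * h (D \<omega>)) (expectation X * expectation (\<lambda>\<omega>. h (D \<omega>)))"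
proof (rule indep_set_expectation_mult[OF subalg[OF s] D_measurable])
  show "indep_set (sets (F s)) (sets (vimage_algebra (space M) D borel))"
    using brownian s st unfolding D_def[abs_def] brownian_motion_def by blast
qed (fact assms)+

lemma \<sigma>: "sqrt (t - s) > 0" "(sqrt (t - s))\<^sup>2 = t - s" "sqrt (t - s) ^ 4 = (t - s)\<^sup>2"
proof -
  show "sqrt (t - s) > 0" and 2: "(sqrt (t - s))\<^sup>2 = t - s" using st by auto
  have "sqrt (t - s) ^ 4 = ((sqrt (t - s))\<^sup>2)\<^sup>2" by simp
  with 2 show "sqrt (t - s) ^ 4 = (t - s)\<^sup>2" by simp
qed

lemma D_moments:
  shows D_mean: "has_bochner_integral M (\<lambda>\<omega>. D \<omega> $ a) 0"
    and D_covariance: "has_bochner_integral M (\<lambda>\<omega>. D \<omega> $ a * D \<omega> $ b) (if a = b then t - s else 0)"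
    and D_fourth_moment: "has_bochner_integral M (\<lambda>\<omega>. (D \<omega> $ a) ^ 4) (3 * (t - s)\<^sup>2)"
  using normal_vec_moments[OF D_distributed \<sigma>(1)] by (simp_all only: \<sigma>)

lemma norm_D_square: "has_bochner_integral M (\<lambda>\<omega>. (norm (D \<omega>))\<^sup>2) (CARD('m) * (t - s))"
proof -
  have "has_bochner_integral M (\<lambda>\<omega>. \<Sum>a\<in>UNIV. D \<omega> $ a * D \<omega> $ a) (\<Sum>a\<in>(UNIV::'m set). t - s)"
    using D_covariance[of a a for a] by (intro has_bochner_integral_sum) simp
  then show ?thesis
    by (simp add: power2_norm_eq_inner inner_vec_def)
qed

text \<open>Cauchy-Schwarz bounds the squared sum of the squared coordinates by the dimension times
  the sum of their fourth powers, each of mean \<open>3 * (t - s)\<^sup>2\<close>; this gives the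
  factor \<open>3 * CARD('m)\<^sup>2\<close>.\<close>

lemma norm_D_fourth:
  shows "integrable M (\<lambda>\<omega>. norm (D \<omega>) ^ 4)"
    and "expectation (\<lambda>\<omega>. norm (D \<omega>) ^ 4) \<le> 3 * (CARD('m))\<^sup>2 * (t - s)\<^sup>2"
proof -
  let ?S = "\<lambda>\<omega>. CARD('m) * (\<Sum>a\<in>UNIV. (D \<omega> $ a) ^ 4)"
  have S: "has_bochner_integral M ?S (CARD('m) * (\<Sum>a\<in>(UNIV::'m set). 3 * (t - s)\<^sup>2))"
    by (intro has_bochner_integral_sum has_bochner_integral_mult_right D_fourth_moment)
  have le: "norm (D \<omega>) ^ 4 \<le> ?S \<omega>" for \<omega>
  proof -
    have "norm (D \<omega>) ^ 4 = ((norm (D \<omega>))\<^sup>2)\<^sup>2" by simp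
    also have "\<dots> = (\<Sum>a\<in>UNIV. (D \<omega> $ a)\<^sup>2)\<^sup>2"
      unfolding power2_norm_eq_inner inner_vec_def by (simp add: power2_eq_square)
    also have "\<dots> \<le> (\<Sum>a\<in>UNIV. ((D \<omega> $ a)\<^sup>2)\<^sup>2) * CARD('m)"
      by (rule sum_squared_le_sum_of_squares)
    finally show ?thesis by (simp add: mult.commute)
  qed
  have m: "(\<lambda>\<omega>. norm (D \<omega>) ^ 4) \<in> borel_measurable M"
    using D_measurable by measurable
  show i: "integrable M (\<lambda>\<omega>. norm (D \<omega>) ^ 4)"
    by (rule Bochner_Integration.integrable_bound[OF _ m, of ?S])
       (use S le in \<open>auto simp: has_bochner_integral_iff intro!: AE_I2 order.trans[OF _ abs_ge_self]\<close>)
  have "expectation (\<lambda>\<omega>. norm (D \<omega>) ^ 4) \<le> expectation ?S"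
    using i S le by (intro integral_mono) (auto simp: has_bochner_integral_iff)
  also have "\<dots> = 3 * (CARD('m))\<^sup>2 * (t - s)\<^sup>2"
    using S by (simp add: has_bochner_integral_iff power2_eq_square)
  finally show "expectation (\<lambda>\<omega>. norm (D \<omega>) ^ 4) \<le> 3 * (CARD('m))\<^sup>2 * (t - s)\<^sup>2" by simp
qed

context
  fixes u :: "'a \<Rightarrow> real^'m" and v :: "'a \<Rightarrow> real^'m^'d" and K :: real
  assumes u: "u \<in> borel_measurable (F s)" "\<And>\<omega>. \<omega> \<in> space M \<Longrightarrow> norm (u \<omega>) \<le> K"
    and v: "v \<in> borel_measurable (F s)" "\<And>\<omega>. \<omega> \<in> space M \<Longrightarrow> norm (v \<omega>) \<le> K"
begin

text \<open>In coordinates the bracket is a sum of coefficients known at time \<open>s\<close>,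
  multiplied by a component of \<open>D\<close> or by a product of two components minus its mean.
  Independence makes every term centred. The factor \<open>X\<close> allows two uses:
  \<open>X = 1\<close> gives mean zero, and \<open>X\<close> a sum of earlier increments gives
  orthogonality.\<close>

lemma increment_mean_zero:
  assumes X: "X \<in> borel_measurable (F s)" "integrable M X"
  shows "has_bochner_integral M
    (\<lambda>\<omega>. X \<omega> * (u \<omega> \<bullet> D \<omega> + ((norm (v \<omega> *v D \<omega>))\<^sup>2 - (norm (v \<omega>))\<^sup>2 * (t - s)))) 0"
proof -
  have bdd: "integrable M (\<lambda>\<omega>. X \<omega> * Y \<omega>)" "(\<lambda>\<omega>. X \<omega> * Y \<omega>) \<in> borel_measurable (F s)"
    if Y: "Y \<in> borel_measurable (F s)" "\<And>\<omega>. \<omega> \<in> space M \<Longrightarrow> \<bar>Y \<omega>\<bar> \<le> L" for Y L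
  proof -
    show "(\<lambda>\<omega>. X \<omega> * Y \<omega>) \<in> borel_measurable (F s)" using X(1) Y(1) by measurable
    have m: "(\<lambda>\<omega>. X \<omega> * Y \<omega>) \<in> borel_measurable M"
      using measurable_F_M[OF X(1) s] measurable_F_M[OF Y(1) s] by measurable
    show "integrable M (\<lambda>\<omega>. X \<omega> * Y \<omega>)"
    proof (rule Bochner_Integration.integrable_bound[OF _ m, of "\<lambda>\<omega>. L * X \<omega>"])
      show "AE \<omega> in M. norm (X \<omega> * Y \<omega>) \<le> norm (L * X \<omega>)"
      proof (rule AE_I2)
        fix \<omega> assume "\<omega> \<in> space M"
        then have "\<bar>Y \<omega>\<bar> \<le> \<bar>L\<bar>" using Y(2) by fastforce
        then show "norm (X \<omega> * Y \<omega>) \<le> norm (L * X \<omega>)"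
          unfolding real_norm_def abs_mult mult.commute[of "\<bar>X \<omega>\<bar>"] by (rule mult_right_mono) simp
      qed
    qed (use X in simp)
  qed
  have uc: "(\<lambda>\<omega>. u \<omega> $ a) \<in> borel_measurable (F s)" for a
    using u(1) by measurable
  have vc: "(\<lambda>\<omega>. v \<omega> $ i $ a) \<in> borel_measurable (F s)" for i a
    using v(1) by measurable
  have ub: "\<bar>u \<omega> $ a\<bar> \<le> K" if "\<omega> \<in> space M" for \<omega> a
    using u(2)[OF that] component_le_norm_cart[of "u \<omega>" a] by simp
  have vb: "\<bar>v \<omega> $ i $ a\<bar> \<le> K" if "\<omega> \<in> space M" for \<omega> i a
    using v(2)[OF that] Finite_Cartesian_Product.norm_nth_le[of "v \<omega>" i] component_le_norm_cart[of "v \<omega> $ i" a] by simp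
  have 1: "has_bochner_integral M (\<lambda>\<omega>. (X \<omega> * u \<omega> $ a) * D \<omega> $ a) 0" for a
    using expectation_mult[OF bdd(2,1)[OF uc ub], of "\<lambda>z. z $ a"] D_mean[of a]
    by (simp add: has_bochner_integral_iff)
  have 2: "has_bochner_integral M (\<lambda>\<omega>. (X \<omega> * (v \<omega> $ i $ a * v \<omega> $ i $ b)) *
      (D \<omega> $ a * D \<omega> $ b - (if a = b then t - s else 0))) 0" for i a b
  proof -
    have w: "(\<lambda>\<omega>. v \<omega> $ i $ a * v \<omega> $ i $ b) \<in> borel_measurable (F s)"
      using vc by measurable
    have wb: "\<bar>v \<omega> $ i $ a * v \<omega> $ i $ b\<bar> \<le> K * K" if "\<omega> \<in> space M" for \<omega>
      using vb[OF that] unfolding abs_mult by (intro mult_mono) (auto intro: order.trans[OF abs_ge_zero])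
    have "has_bochner_integral M (\<lambda>\<omega>. D \<omega> $ a * D \<omega> $ b - (if a = b then t - s else 0))
        ((if a = b then t - s else 0) - (if a = b then t - s else 0))"
      by (intro has_bochner_integral_diff D_covariance)
         (simp_all add: has_bochner_integral_iff prob_space)
    then show ?thesis
      using expectation_mult[OF bdd(2,1)[OF w wb], of "\<lambda>z. z $ a * z $ b - (if a = b then t - s else 0)"]
      by (simp add: has_bochner_integral_iff)
  qed
  have "has_bochner_integral M (\<lambda>\<omega>. (\<Sum>a\<in>UNIV. (X \<omega> * u \<omega> $ a) * D \<omega> $ a) +
      (\<Sum>i\<in>UNIV. \<Sum>a\<in>UNIV. \<Sum>b\<in>UNIV. (X \<omega> * (v \<omega> $ i $ a * v \<omega> $ i $ b)) *
      (D \<omega> $ a * D \<omega> $ b - (if a = b then t - s else 0))))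
      ((\<Sum>a\<in>(UNIV::'m set). 0) + (\<Sum>i\<in>(UNIV::'d set). \<Sum>a\<in>(UNIV::'m set). \<Sum>b\<in>(UNIV::'m set). 0))"
    by (intro has_bochner_integral_add has_bochner_integral_sum 1 2)
  moreover have "(\<Sum>a\<in>UNIV. (X \<omega> * u \<omega> $ a) * D \<omega> $ a) +
      (\<Sum>i\<in>UNIV. \<Sum>a\<in>UNIV. \<Sum>b\<in>UNIV. (X \<omega> * (v \<omega> $ i $ a * v \<omega> $ i $ b)) *
      (D \<omega> $ a * D \<omega> $ b - (if a = b then t - s else 0))) =
      X \<omega> * (u \<omega> \<bullet> D \<omega> + ((norm (v \<omega> *v D \<omega>))\<^sup>2 - (norm (v \<omega>))\<^sup>2 * (t - s)))" for \<omega>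
  proof -
    have n1: "(norm (v \<omega> *v D \<omega>))\<^sup>2 =
        (\<Sum>i\<in>UNIV. \<Sum>a\<in>UNIV. \<Sum>b\<in>UNIV. v \<omega> $ i $ a * v \<omega> $ i $ b * (D \<omega> $ a * D \<omega> $ b))"
      by (simp add: power2_norm_eq_inner inner_vec_def matrix_vector_mult_def sum_product ac_simps)
    have n2: "(norm (v \<omega>))\<^sup>2 * (t - s) = (\<Sum>i\<in>UNIV. \<Sum>a\<in>UNIV. \<Sum>b\<in>UNIV.
        v \<omega> $ i $ a * v \<omega> $ i $ b * (if a = b then t - s else 0))"
      by (simp add: power2_norm_eq_inner inner_vec_def sum_distrib_right if_distrib cong: if_cong)
    have n3: "u \<omega> \<bullet> D \<omega> = (\<Sum>a\<in>UNIV. u \<omega> $ a * D \<omega> $ a)"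
      by (simp add: inner_vec_def)
    show ?thesis
      unfolding n1 n2 n3 sum_subtractf[symmetric] right_diff_distrib[symmetric] distrib_left sum_distrib_left
      by (simp add: ac_simps)
  qed
  ultimately show ?thesis by simp
qed

text \<open>With \<open>p\<close>, \<open>q\<close>, \<open>r\<close> the three terms of
  \<open>m\<close>, the bound is \<open>2 * p\<^sup>2 + 4 * q\<^sup>2 + 4 * r\<^sup>2\<close>. In
  \<open>k\<close> the part \<open>12 * CARD('m)\<^sup>2\<close> pays for \<open>q\<close> through
  the fourth moment, the 4 pays for \<open>r\<close>, and the sum exceeds the factor
  \<open>2 * CARD('m)\<close> of \<open>p\<close>. The right-hand side stays an expectation so that
  a stopping rule can later bound its integrand pointwise.\<close>

lemma increment_second_moment:
  defines "m \<equiv> \<lambda>\<omega>. u \<omega> \<bullet> D \<omega> + ((norm (v \<omega> *v D \<omega>))\<^sup>2 - (norm (v \<omega>))\<^sup>2 * (t - s))"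
  defines "k \<equiv> 4 * (3 * (real CARD('m))\<^sup>2 + 1)"
  shows "integrable M (\<lambda>\<omega>. (m \<omega>)\<^sup>2)"
    and "expectation (\<lambda>\<omega>. (m \<omega>)\<^sup>2) \<le>
      expectation (\<lambda>\<omega>. k * ((norm (u \<omega>))\<^sup>2 * (t - s) + ((norm (v \<omega>))\<^sup>2 * (t - s))\<^sup>2))"
proof -
  have [measurable]: "u \<in> borel_measurable M" "v \<in> borel_measurable M" "D \<in> borel_measurable M"
    using measurable_F_M[OF u(1) s] measurable_F_M[OF v(1) s] D_measurable by auto
  note borel_measurable_matrix_vector_mult[measurable]
  have m: "(\<lambda>\<omega>. (m \<omega>)\<^sup>2) \<in> borel_measurable M"
    unfolding m_def by measurable
  let ?T = "\<lambda>\<omega>. 2 * ((norm (u \<omega>))\<^sup>2 * (norm (D \<omega>))\<^sup>2) + 4 * (norm (v \<omega>) ^ 4 * norm (D \<omega>) ^ 4)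
     + 4 * (t - s)\<^sup>2 * norm (v \<omega>) ^ 4"
  have pw: "(m \<omega>)\<^sup>2 \<le> ?T \<omega>" for \<omega>
  proof -
    let ?p = "u \<omega> \<bullet> D \<omega>" and ?q = "(norm (v \<omega> *v D \<omega>))\<^sup>2" and ?r = "(norm (v \<omega>))\<^sup>2 * (t - s)"
    have "(m \<omega>)\<^sup>2 \<le> 2 * ?p\<^sup>2 + 4 * ?q\<^sup>2 + 4 * ?r\<^sup>2"
    proof -
      \<comment> \<open>The first square gives
        \<open>(p + z)\<^sup>2 \<le> 2 * p\<^sup>2 + 2 * z\<^sup>2\<close> for
        \<open>z = q - r\<close>, the second gives
        \<open>z\<^sup>2 \<le> 2 * q\<^sup>2 + 2 * r\<^sup>2\<close>.\<close>
      have "0 \<le> (?p - (?q - ?r))\<^sup>2" "0 \<le> (?q + ?r)\<^sup>2" by simp_all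
      then show ?thesis unfolding m_def power2_eq_square by (simp add: algebra_simps)
    qed
    moreover have "?p\<^sup>2 \<le> (norm (u \<omega>))\<^sup>2 * (norm (D \<omega>))\<^sup>2"
      by (simp add: power2_norm_eq_inner Cauchy_Schwarz_ineq)
    moreover have "?q\<^sup>2 \<le> norm (v \<omega>) ^ 4 * norm (D \<omega>) ^ 4"
    proof -
      have "norm (v \<omega> *v D \<omega>) ^ 4 \<le> (norm (v \<omega>) * norm (D \<omega>)) ^ 4"
        by (intro power_mono norm_matrix_vector_mult_le) simp
      then show ?thesis by (simp add: power_mult_distrib)
    qed
    moreover have "?r\<^sup>2 = (t - s)\<^sup>2 * norm (v \<omega>) ^ 4"
      by (simp add: power_mult_distrib)
    ultimately show ?thesis by simp
  qed
  have bdd: "integrable M Y" if "Y \<in> borel_measurable (F s)" "\<And>\<omega>. \<omega> \<in> space M \<Longrightarrow> \<bar>Y \<omega>\<bar> \<le> L" for Y :: "'a \<Rightarrow> real" and L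
    using that measurable_F_M[OF that(1) s] by (intro integrable_const_bound[of _ L]) auto
  have um: "(\<lambda>\<omega>. (norm (u \<omega>))\<^sup>2) \<in> borel_measurable (F s)"
    and vm: "(\<lambda>\<omega>. norm (v \<omega>) ^ 4) \<in> borel_measurable (F s)"
    using u(1) v(1) by measurable
  have ui: "integrable M (\<lambda>\<omega>. (norm (u \<omega>))\<^sup>2)"
    by (rule bdd[OF um, of "K\<^sup>2"]) (use u(2) in \<open>auto intro: power_mono\<close>)
  have vi: "integrable M (\<lambda>\<omega>. norm (v \<omega>) ^ 4)"
    by (rule bdd[OF vm, of "K^4"]) (use v(2) in \<open>auto intro: power_mono\<close>)
  note D2 = norm_D_square[unfolded has_bochner_integral_iff]
  have e1: "has_bochner_integral M (\<lambda>\<omega>. (norm (u \<omega>))\<^sup>2 * (norm (D \<omega>))\<^sup>2)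
     (expectation (\<lambda>\<omega>. (norm (u \<omega>))\<^sup>2) * (CARD('m) * (t - s)))"
    using expectation_mult[OF um ui, of "\<lambda>z. (norm z)\<^sup>2"] D2 by simp
  have e2: "has_bochner_integral M (\<lambda>\<omega>. norm (v \<omega>) ^ 4 * norm (D \<omega>) ^ 4)
     (expectation (\<lambda>\<omega>. norm (v \<omega>) ^ 4) * expectation (\<lambda>\<omega>. norm (D \<omega>) ^ 4))"
    using expectation_mult[OF vm vi, of "\<lambda>z. norm z ^ 4"] norm_D_fourth(1) by simp
  have T: "has_bochner_integral M ?T (2 * (expectation (\<lambda>\<omega>. (norm (u \<omega>))\<^sup>2) * (CARD('m) * (t - s)))
     + 4 * (expectation (\<lambda>\<omega>. norm (v \<omega>) ^ 4) * expectation (\<lambda>\<omega>. norm (D \<omega>) ^ 4))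
     + 4 * (t - s)\<^sup>2 * expectation (\<lambda>\<omega>. norm (v \<omega>) ^ 4))"
    by (intro has_bochner_integral_add has_bochner_integral_mult_right e1 e2)
       (use vi in \<open>simp add: has_bochner_integral_iff\<close>)
  show i: "integrable M (\<lambda>\<omega>. (m \<omega>)\<^sup>2)"
    by (rule Bochner_Integration.integrable_bound[OF _ m, of ?T])
       (use T pw in \<open>auto simp: has_bochner_integral_iff intro!: AE_I2 order.trans[OF _ abs_ge_self]\<close>)
  have "expectation (\<lambda>\<omega>. (m \<omega>)\<^sup>2) \<le> expectation ?T"
    using i T pw by (intro integral_mono) (auto simp: has_bochner_integral_iff)
  also have "\<dots> = 2 * (expectation (\<lambda>\<omega>. (norm (u \<omega>))\<^sup>2) * (CARD('m) * (t - s)))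
     + 4 * (expectation (\<lambda>\<omega>. norm (v \<omega>) ^ 4) * expectation (\<lambda>\<omega>. norm (D \<omega>) ^ 4))
     + 4 * (t - s)\<^sup>2 * expectation (\<lambda>\<omega>. norm (v \<omega>) ^ 4)"
    using T by (simp add: has_bochner_integral_iff)
  also have "\<dots> \<le> k * (expectation (\<lambda>\<omega>. (norm (u \<omega>))\<^sup>2) * (t - s))
     + 4 * (expectation (\<lambda>\<omega>. norm (v \<omega>) ^ 4) * (3 * (CARD('m))\<^sup>2 * (t - s)\<^sup>2))
     + 4 * (t - s)\<^sup>2 * expectation (\<lambda>\<omega>. norm (v \<omega>) ^ 4)"
  proof -
    have "2 * n \<le> 4 * (3 * n\<^sup>2 + 1)" if "1 \<le> n" for n :: real
    proof -
      have "0 \<le> (n - 1)\<^sup>2" by simp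
      with that show ?thesis unfolding power2_eq_square by (simp add: algebra_simps)
    qed
    from this[of "real CARD('m)"] have k: "2 * real CARD('m) \<le> k"
      unfolding k_def by (simp add: Suc_le_eq)
    have "2 * real CARD('m) * (expectation (\<lambda>\<omega>. (norm (u \<omega>))\<^sup>2) * (t - s)) \<le>
        k * (expectation (\<lambda>\<omega>. (norm (u \<omega>))\<^sup>2) * (t - s))"
      by (rule mult_right_mono[OF k]) (use st in \<open>auto intro!: mult_nonneg_nonneg\<close>)
    moreover have "expectation (\<lambda>\<omega>. norm (v \<omega>) ^ 4) * expectation (\<lambda>\<omega>. norm (D \<omega>) ^ 4)
       \<le> expectation (\<lambda>\<omega>. norm (v \<omega>) ^ 4) * (3 * (CARD('m))\<^sup>2 * (t - s)\<^sup>2)"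
      by (rule mult_left_mono[OF norm_D_fourth(2)]) simp
    ultimately show ?thesis by (simp add: ac_simps)
  qed
  also have "\<dots> = k * (expectation (\<lambda>\<omega>. (norm (u \<omega>))\<^sup>2) * (t - s) + (t - s)\<^sup>2 * expectation (\<lambda>\<omega>. norm (v \<omega>) ^ 4))"
    by (simp add: k_def algebra_simps)
  also have "\<dots> = expectation (\<lambda>\<omega>. k * ((norm (u \<omega>))\<^sup>2 * (t - s) + ((norm (v \<omega>))\<^sup>2 * (t - s))\<^sup>2))"
    using ui vi by (simp add: power_mult_distrib mult.commute)
  finally show "expectation (\<lambda>\<omega>. (m \<omega>)\<^sup>2) \<le>
      expectation (\<lambda>\<omega>. k * ((norm (u \<omega>))\<^sup>2 * (t - s) + ((norm (v \<omega>))\<^sup>2 * (t - s))\<^sup>2))" .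
qed

end
end

section \<open>Sums of martingale differences along a grid\<close>

context brownian_space
begin

text \<open>The summands are orthogonal, so second moments add up. The bounds on \<open>u j\<close>
  and \<open>v j\<close> are qualitative and may depend on \<open>j\<close>: they secure
  integrability and do not enter the estimate. The induction also carries measurability of the
  partial sum at time \<open>s l\<close>, which is what orthogonality to the next summand rests
  on.\<close>

lemma discrete_martingale:
  fixes s :: "nat \<Rightarrow> real" and u :: "nat \<Rightarrow> 'a \<Rightarrow> real^'m" and v :: "nat \<Rightarrow> 'a \<Rightarrow> real^'m^'d"
  assumes s: "0 \<le> s 0" "\<And>j. j < N \<Longrightarrow> s j < s (Suc j)"
    and u: "\<And>j. j < N \<Longrightarrow> u j \<in> borel_measurable (F (s j))"
      "\<And>j. j < N \<Longrightarrow> \<exists>K. \<forall>\<omega>\<in>space M. norm (u j \<omega>) \<le> K"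
    and v: "\<And>j. j < N \<Longrightarrow> v j \<in> borel_measurable (F (s j))"
      "\<And>j. j < N \<Longrightarrow> \<exists>K. \<forall>\<omega>\<in>space M. norm (v j \<omega>) \<le> K"
  defines "m \<equiv> \<lambda>j \<omega>. u j \<omega> \<bullet> (B (s (Suc j)) \<omega> - B (s j) \<omega>) +
    ((norm (v j \<omega> *v (B (s (Suc j)) \<omega> - B (s j) \<omega>)))\<^sup>2 - (norm (v j \<omega>))\<^sup>2 * (s (Suc j) - s j))"
    and "k \<equiv> 4 * (3 * (real CARD('m))\<^sup>2 + 1)"
  assumes l: "l \<le> N"
  shows "has_bochner_integral M (\<lambda>\<omega>. \<Sum>j<l. m j \<omega>) 0"
    and "integrable M (\<lambda>\<omega>. (\<Sum>j<l. m j \<omega>)\<^sup>2)"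
    and "expectation (\<lambda>\<omega>. (\<Sum>j<l. m j \<omega>)\<^sup>2) \<le>
      (\<Sum>j<l. expectation (\<lambda>\<omega>. k * ((norm (u j \<omega>))\<^sup>2 * (s (Suc j) - s j)
        + ((norm (v j \<omega>))\<^sup>2 * (s (Suc j) - s j))\<^sup>2)))"
proof -
  let ?E = "\<lambda>j. expectation (\<lambda>\<omega>. k * ((norm (u j \<omega>))\<^sup>2 * (s (Suc j) - s j)
        + ((norm (v j \<omega>))\<^sup>2 * (s (Suc j) - s j))\<^sup>2))"
  have s0: "0 \<le> s j" if "j \<le> N" for j
    using that
  proof (induction j)
    case (Suc j)
    then show ?case using s(2)[of j] by simp
  qed (use s(1) in simp)
  have "(\<lambda>\<omega>. \<Sum>j<l. m j \<omega>) \<in> borel_measurable (F (s l)) \<and>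
    has_bochner_integral M (\<lambda>\<omega>. \<Sum>j<l. m j \<omega>) 0 \<and> integrable M (\<lambda>\<omega>. (\<Sum>j<l. m j \<omega>)\<^sup>2) \<and>
    expectation (\<lambda>\<omega>. (\<Sum>j<l. m j \<omega>)\<^sup>2) \<le> (\<Sum>j<l. ?E j)"
    using l
  proof (induction l)
    case 0
    then show ?case by (simp add: has_bochner_integral_zero)
  next
    case (Suc l)
    let ?S = "\<lambda>\<omega>. \<Sum>j<l. m j \<omega>"
    have l: "l < N" using Suc by simp
    from Suc have S: "?S \<in> borel_measurable (F (s l))" "has_bochner_integral M ?S 0"
      "integrable M (\<lambda>\<omega>. (?S \<omega>)\<^sup>2)" "expectation (\<lambda>\<omega>. (?S \<omega>)\<^sup>2) \<le> (\<Sum>j<l. ?E j)"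
      by auto
    have sl: "0 \<le> s l" "s l < s (Suc l)" using s0[of l] s(2)[OF l] l by auto
    interpret I: brownian_increment M F B "s l" "s (Suc l)"
      by standard (use sl in auto)
    obtain K1 K2 where K1: "\<forall>\<omega>\<in>space M. norm (u l \<omega>) \<le> K1" and K2: "\<forall>\<omega>\<in>space M. norm (v l \<omega>) \<le> K2"
      using u(2)[OF l] v(2)[OF l] by blast
    define K where "K = max K1 K2"
    have uK: "norm (u l \<omega>) \<le> K" and vK: "norm (v l \<omega>) \<le> K" if "\<omega> \<in> space M" for \<omega>
      using that K1 K2 by (auto simp: K_def le_max_iff_disj)
    have m: "m l = (\<lambda>\<omega>. u l \<omega> \<bullet> I.D \<omega> + ((norm (v l \<omega> *v I.D \<omega>))\<^sup>2 - (norm (v l \<omega>))\<^sup>2 * (s (Suc l) - s l)))"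
      unfolding m_def I.D_def by simp
    have 1: "has_bochner_integral M (\<lambda>\<omega>. X \<omega> * m l \<omega>) 0"
      if "X \<in> borel_measurable (F (s l))" "integrable M X" for X
      unfolding m by (rule I.increment_mean_zero[OF u(1)[OF l] uK v(1)[OF l] vK that])
    have 2: "integrable M (\<lambda>\<omega>. (m l \<omega>)\<^sup>2)" "expectation (\<lambda>\<omega>. (m l \<omega>)\<^sup>2) \<le> ?E l"
      unfolding m k_def by (rule I.increment_second_moment[OF u(1)[OF l] uK v(1)[OF l] vK], assumption+)+
    have [measurable]: "u l \<in> borel_measurable (F (s (Suc l)))" "v l \<in> borel_measurable (F (s (Suc l)))"
      "?S \<in> borel_measurable (F (s (Suc l)))"
      "B (s l) \<in> borel_measurable (F (s (Suc l)))" "B (s (Suc l)) \<in> borel_measurable (F (s (Suc l)))"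
      using sl measurable_F_mono[OF u(1)[OF l] sl(1)] measurable_F_mono[OF v(1)[OF l] sl(1)]
        measurable_F_mono[OF S(1) sl(1)] measurable_F_mono[OF B_adapted sl(1)] B_adapted[of "s (Suc l)"]
      by auto
    note borel_measurable_matrix_vector_mult[measurable]
    have "m l \<in> borel_measurable (F (s (Suc l)))"
      unfolding m_def by measurable
    then have meas: "(\<lambda>\<omega>. \<Sum>j<Suc l. m j \<omega>) \<in> borel_measurable (F (s (Suc l)))"
      by simp
    have mean: "has_bochner_integral M (\<lambda>\<omega>. \<Sum>j<Suc l. m j \<omega>) 0"
    proof -
      have "has_bochner_integral M (\<lambda>\<omega>. 1 * m l \<omega>) 0"
        by (rule 1) simp_all
      from has_bochner_integral_add[OF S(2) this] show ?thesis by simp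
    qed
    \<comment> \<open>The cross term vanishes by fact \<open>1\<close> with the partial sum as the
      factor \<open>X\<close>.\<close>
    have "has_bochner_integral M (\<lambda>\<omega>. (?S \<omega>)\<^sup>2 + 2 * (?S \<omega> * m l \<omega>) + (m l \<omega>)\<^sup>2)
       (expectation (\<lambda>\<omega>. (?S \<omega>)\<^sup>2) + 2 * 0 + expectation (\<lambda>\<omega>. (m l \<omega>)\<^sup>2))"
      using S(2,3) 2(1)
      by (intro has_bochner_integral_add has_bochner_integral_mult_right 1 S(1)) (auto simp: has_bochner_integral_iff)
    moreover have "(?S \<omega>)\<^sup>2 + 2 * (?S \<omega> * m l \<omega>) + (m l \<omega>)\<^sup>2 = (\<Sum>j<Suc l. m j \<omega>)\<^sup>2" for \<omega>
      by (simp add: power2_eq_square algebra_simps)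
    ultimately have "has_bochner_integral M (\<lambda>\<omega>. (\<Sum>j<Suc l. m j \<omega>)\<^sup>2)
       (expectation (\<lambda>\<omega>. (?S \<omega>)\<^sup>2) + expectation (\<lambda>\<omega>. (m l \<omega>)\<^sup>2))"
      by simp
    then show ?case
      using meas mean S(4) 2(2) by (simp add: has_bochner_integral_iff)
  qed
  then show "has_bochner_integral M (\<lambda>\<omega>. \<Sum>j<l. m j \<omega>) 0"
    and "integrable M (\<lambda>\<omega>. (\<Sum>j<l. m j \<omega>)\<^sup>2)"
    and "expectation (\<lambda>\<omega>. (\<Sum>j<l. m j \<omega>)\<^sup>2) \<le> (\<Sum>j<l. ?E j)"
    by auto
qed

end

section \<open>Drift and energy along a grid\<close>

definition time_grid :: "real \<Rightarrow> nat \<Rightarrow> (nat \<Rightarrow> real) \<Rightarrow> bool" where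
  "time_grid T N s \<longleftrightarrow> s 0 = 0 \<and> s N = T \<and> (\<forall>j<N. s j < s (Suc j))"

lemma time_grid_mono:
  assumes "time_grid T N s" "i \<le> j" "j \<le> N"
  shows "s i \<le> s j"
  using assms(2,3)
proof (induction j)
  case (Suc j)
  show ?case
  proof (cases "i = Suc j")
    case False
    then have "s i \<le> s j" using Suc by simp
    also have "s j < s (Suc j)" using Suc assms(1) by (simp add: time_grid_def)
    finally show ?thesis by simp
  qed simp
qed simp

lemma time_grid_range:
  assumes "time_grid T N s" "j \<le> N"
  shows "s j \<in> {0..T}"
  using time_grid_mono[OF assms(1), of 0 j] time_grid_mono[OF assms(1), of j N] assms
  by (simp add: time_grid_def)

lemma time_grid_locate:
  assumes "time_grid T N s" "l < N" "0 \<le> r" "r \<le> s (Suc l)"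
  obtains j where "j \<le> l" "s j \<le> r" "r \<le> s (Suc j)"
proof -
  have "\<exists>j\<le>l. s j \<le> r \<and> r \<le> s (Suc j)"
    using assms(2,4)
  proof (induction l)
    case 0
    then show ?case using assms(1,3) by (simp add: time_grid_def)
  next
    case (Suc l)
    show ?case
    proof (cases "r \<le> s (Suc l)")
      case True
      with Suc obtain j where "j \<le> l" "s j \<le> r \<and> r \<le> s (Suc j)" by auto
      then show ?thesis by (intro exI[of _ j]) simp
    next
      case False
      then show ?thesis using Suc by (intro exI[of _ "Suc l"]) simp
    qed
  qed
  then show thesis using that by blast
qed

text \<open>The shift by 1 makes the weight equal to 1 at time 0, so the initial value enters
  unweighted. It also gives \<open>1 + s \<le> (1 + q * s) / q\<close>, which compares the weight at
  \<open>s\<close> with the weight at the delayed time \<open>q * s\<close>.\<close>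

definition weight :: "real \<Rightarrow> real \<Rightarrow> real" where
  "weight \<epsilon> t = (1 + t) powr \<epsilon>"

lemma weight_pos: "0 \<le> t \<Longrightarrow> 0 < weight \<epsilon> t"
  by (simp add: weight_def)

lemma weight_0 [simp]: "weight \<epsilon> 0 = 1"
  by (simp add: weight_def)

lemma weight_mono: "0 \<le> \<epsilon> \<Longrightarrow> 0 \<le> s \<Longrightarrow> s \<le> t \<Longrightarrow> weight \<epsilon> s \<le> weight \<epsilon> t"
  unfolding weight_def by (intro powr_mono2) auto

lemma weight_ge_1: "0 \<le> \<epsilon> \<Longrightarrow> 0 \<le> t \<Longrightarrow> 1 \<le> weight \<epsilon> t"
  using weight_mono[of \<epsilon> 0 t] by simp

lemma continuous_on_weight [continuous_intros]: "continuous_on {0..T} (weight \<epsilon>)"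
  unfolding weight_def by (intro continuous_intros) auto

text \<open>The derivative is \<epsilon> times a power with exponent \<open>\<epsilon> - 1\<close>,
  which is at most \<epsilon> because \<epsilon> is at most 1. Replacing the true relative growth
  rate \<open>\<epsilon> / (1 + t)\<close> by \<epsilon> is affordable: this is the summand
  \<epsilon> in the condition on \<open>l1\<close> and \<open>l2\<close>.\<close>

lemma weight_increment_le:
  assumes "0 \<le> \<epsilon>" "\<epsilon> \<le> 1" "0 \<le> s" "s \<le> t"
  shows "weight \<epsilon> t - weight \<epsilon> s \<le> \<epsilon> * (t - s) * weight \<epsilon> s"
proof (cases "s = t")
  case False
  then have "s < t" using assms by simp
  have "\<exists>z. s < z \<and> z < t \<and> weight \<epsilon> t - weight \<epsilon> s = (t - s) * (\<epsilon> * (1 + z) powr (\<epsilon> - 1))"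
    unfolding weight_def
    using assms \<open>s < t\<close> by (intro MVT2) (auto intro!: derivative_eq_intros)
  then obtain z where z: "s < z" "z < t"
    "weight \<epsilon> t - weight \<epsilon> s = (t - s) * (\<epsilon> * (1 + z) powr (\<epsilon> - 1))" by blast
  have "(1 + z) powr (\<epsilon> - 1) \<le> 1"
    using powr_mono[of "\<epsilon> - 1" 0 "1 + z"] z assms by simp
  also have "1 \<le> weight \<epsilon> s" using assms by (simp add: weight_ge_1)
  finally show ?thesis
    unfolding z(3) using assms by (simp add: mult.assoc mult.left_commute mult_left_mono)
qed simp

text \<open>The factor splits into \<open>1 / q\<close>, the Jacobian of the substitution, and
  \<open>q powr (- \<epsilon>)\<close>, the price of moving the weight from \<open>s\<close> to
  \<open>q * s\<close>. The integral obtained runs only up to \<open>q * t\<close>; the integrand is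
  nonnegative, so it may be extended to \<open>t\<close>. A polynomial weight suits a proportional
  delay because the weights at \<open>s\<close> and at \<open>q * s\<close> are comparable uniformly
  in \<open>s\<close>.\<close>

lemma weighted_delay_integral:
  fixes y :: "real \<Rightarrow> real"
  assumes y: "continuous_on {0..T} y" "\<And>s. s \<in> {0..T} \<Longrightarrow> 0 \<le> y s"
    and q: "0 < q" "q < 1" and \<epsilon>: "0 \<le> \<epsilon>" and t: "0 \<le> t" "t \<le> T"
  shows "integral {0..t} (\<lambda>s. weight \<epsilon> s * y (q * s))
    \<le> q powr (-1 - \<epsilon>) * integral {0..t} (\<lambda>s. weight \<epsilon> s * y s)"
proof -
  let ?k = "\<lambda>s. weight \<epsilon> s * y s"
  have ky: "continuous_on {0..T} ?k"
    by (intro continuous_intros y)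
  have sub: "{0..q * t} \<subseteq> {0..t}" "{0..t} \<subseteq> {0..T}"
    using q t by (auto simp: mult_left_le_one_le intro: order.trans)
  have ki: "?k integrable_on {0..t}" "?k integrable_on {0..q * t}"
    by (rule integrable_continuous_interval, rule continuous_on_subset[OF ky], use sub in blast)+
  have im: "(\<lambda>x. x / q) ` {0..q * t} = {0..t}"
    using q by (simp add: image_divide_atLeastAtMost)
  have st: "((\<lambda>s. ?k (q * s)) has_integral (1 / q) * integral {0..q * t} ?k) {0..t}"
    using has_integral_stretch_real[OF integrable_integral[OF ki(2)], of q] q im
    by simp
  have yq: "continuous_on {0..t} (\<lambda>s. y (q * s))"
    by (rule continuous_on_compose2[OF y(1)])
       (use q t in \<open>auto intro!: continuous_intros order.trans[OF mult_left_le_one_le]\<close>)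
  have "integral {0..t} (\<lambda>s. weight \<epsilon> s * y (q * s)) \<le> integral {0..t} (\<lambda>s. q powr (- \<epsilon>) * ?k (q * s))"
  proof (rule integral_le)
    show "(\<lambda>s. weight \<epsilon> s * y (q * s)) integrable_on {0..t}"
      by (intro integrable_continuous_interval continuous_intros yq)
    show "(\<lambda>s. q powr (- \<epsilon>) * ?k (q * s)) integrable_on {0..t}"
      using has_integral_mult_right[OF st, of "q powr (- \<epsilon>)"] by (simp only: has_integral_integrable)
    fix s assume s: "s \<in> {0..t}"
    have "q * s \<le> s" using q s by (simp add: mult_left_le_one_le)
    then have qs: "q * s \<in> {0..T}" using q s t by auto
    have "weight \<epsilon> s \<le> ((1 + q * s) / q) powr \<epsilon>"
      unfolding weight_def using s q \<epsilon> by (intro powr_mono2) (auto simp: field_simps)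
    also have "\<dots> = q powr (- \<epsilon>) * weight \<epsilon> (q * s)"
      using s q by (simp add: weight_def powr_divide powr_minus field_simps)
    finally show "weight \<epsilon> s * y (q * s) \<le> q powr (- \<epsilon>) * ?k (q * s)"
      using y(2)[OF qs] by (simp add: mult.assoc[symmetric] mult_right_mono)
  qed
  also have "\<dots> = q powr (- \<epsilon>) * ((1 / q) * integral {0..q * t} ?k)"
    using integral_unique[OF st] by simp
  also have "\<dots> = q powr (- 1 - \<epsilon>) * integral {0..q * t} ?k"
    using q by (simp add: powr_diff powr_minus field_simps)
  also have "integral {0..q * t} ?k \<le> integral {0..t} ?k"
  proof (rule integral_subset_le[OF sub(1) ki(2,1)], rule ballI)
    fix r assume "r \<in> {0..t}"
    then have r: "0 \<le> r" "r \<in> {0..T}" using t by auto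
    show "0 \<le> ?k r"
      using weight_pos[OF r(1), of \<epsilon>] y(2)[OF r(2)] by simp
  qed
  finally show ?thesis by (simp only: mult_left_mono powr_ge_zero)
qed

text \<open>Everything lives on one path, and \<delta> is fixed before the grid and the
  approximations, so it serves every good enough discretisation. \<open>U\<close> stands for the
  squared distance of the simple integrand from \<open>H\<close>. An increment of the weighted
  square is at most a martingale summand plus a remainder \<open>t j\<close>. The remainder is at
  most the cell integral of the weighted drift \<open>\<Phi>0\<close>, whose integral from 0 is
  nonpositive by \<open>weighted_delay_integral\<close>, plus an error \<open>\<Phi>1\<close> of
  total integral at most \<theta>.\<close>

lemma discrete_drift_bound:
  fixes x fs :: "real \<Rightarrow> 'b::euclidean_space" and H :: "real \<Rightarrow> 'c::real_normed_vector"
  assumes T: "0 < T" and q: "0 < q" "q < 1" and \<epsilon>: "0 \<le> \<epsilon>" "\<epsilon> \<le> 1"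
    and x: "continuous_on {0..T} x"
    and fs: "fs integrable_on {0..T}" "(\<lambda>s. norm (fs s)) integrable_on {0..T}"
    and dis: "\<And>s. s \<in> {0..T} \<Longrightarrow>
      2 * (x s \<bullet> fs s) + (norm (H s))\<^sup>2 \<le> l1 * (norm (x s))\<^sup>2 + l2 * (norm (x (q * s)))\<^sup>2"
    and H: "\<And>s. s \<in> {0..T} \<Longrightarrow> norm (H s) \<le> LH"
    and l: "0 \<le> l2" "\<epsilon> + l1 + l2 * q powr (-1 - \<epsilon>) \<le> 0" and \<theta>: "0 < \<theta>"
  shows "\<exists>\<delta>>0. \<forall>N s y e \<eta> U. time_grid T N s \<longrightarrow> (\<forall>j<N. s (Suc j) - s j \<le> \<delta>) \<longrightarrow>
     (\<forall>j\<le>N. norm (y j - x (s j)) \<le> \<delta>) \<longrightarrow>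
     (\<forall>j<N. y (Suc j) = y j + integral {s j..s (Suc j)} fs + e j) \<longrightarrow>
     U integrable_on {0..T} \<longrightarrow> integral {0..T} U \<le> \<delta> \<longrightarrow> (\<forall>r\<in>{0..T}. 0 \<le> U r) \<longrightarrow>
     (\<forall>j<N. \<forall>r\<in>{s j<..<s (Suc j)}. (norm (\<eta> j - H r))\<^sup>2 \<le> U r) \<longrightarrow>
     (\<forall>l\<le>N. weight \<epsilon> (s l) * (norm (y l))\<^sup>2 \<le> (norm (y 0))\<^sup>2 + \<theta> +
        (\<Sum>j<l. weight \<epsilon> (s j) * (2 * (y j \<bullet> e j) + (norm (e j))\<^sup>2 - (norm (\<eta> j))\<^sup>2 * (s (Suc j) - s j))))"
proof -
  obtain L where L: "L > 0" "\<And>s. s \<in> {0..T} \<Longrightarrow> norm (x s) \<le> L"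
    using compact_imp_bounded[OF compact_continuous_image[OF x]] unfolding bounded_pos by auto
  have LH: "0 \<le> LH" using order.trans[OF norm_ge_zero H[of 0]] T by simp
  define Lf where "Lf = integral {0..T} (\<lambda>s. norm (fs s))"
  have Lf: "0 \<le> Lf" unfolding Lf_def by (rule integral_nonneg[OF fs(2)]) simp
  define W where "W = weight \<epsilon> T"
  have W: "1 \<le> W" using \<epsilon> T by (simp add: W_def weight_ge_1)
  have wW: "0 \<le> weight \<epsilon> r" "weight \<epsilon> r \<le> W" if "r \<in> {0..T}" for r
    using that \<epsilon> weight_mono[of \<epsilon> r T] weight_pos[of r \<epsilon>] by (auto simp: W_def)
  \<comment> \<open>The net damping of the undelayed term, after the growth of the weight has been
    paid for; it must dominate the delayed term.\<close>
  define lam where "lam = - (\<epsilon> + l1)"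
  have lam: "l2 * q powr (-1 - \<epsilon>) \<le> lam" using l by (simp add: lam_def)
  then have lam0: "0 \<le> lam" using l(1) by (smt (verit) mult_nonneg_nonneg powr_ge_zero)
  \<comment> \<open>The parameter of Young's inequality in \<open>|\<eta>|\<^sup>2 \<le> (1 +
    \<kappa>) * |H|\<^sup>2 + (1 + 1 / \<kappa>) * |\<eta> - H|\<^sup>2\<close>. It is fixed before
    \<delta>, so that its own error uses half of \<theta> and \<open>1 / \<kappa>\<close> is a
    constant afterwards.\<close>
  define \<kappa> where "\<kappa> = \<theta> / (2 * (W * LH\<^sup>2 * T + 1))"
  have den: "0 < W * LH\<^sup>2 * T + 1" using W T by (intro add_nonneg_pos mult_nonneg_nonneg) auto
  have \<kappa>: "0 < \<kappa>" using \<theta> den by (simp add: \<kappa>_def)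
  have \<kappa>2: "W * (\<kappa> * LH\<^sup>2 * T) \<le> \<theta> / 2"
  proof -
    have "W * (\<kappa> * LH\<^sup>2 * T) = \<kappa> * (W * LH\<^sup>2 * T)" by simp
    also have "\<dots> \<le> \<kappa> * (W * LH\<^sup>2 * T + 1)" using \<kappa> by simp
    also have "\<dots> = \<theta> / 2" unfolding \<kappa>_def using den by (simp only: times_divide_eq_left) (simp add: divide_simps)
    finally show ?thesis .
  qed
  \<comment> \<open>Collects every error proportional to \<open>d\<close>: the total is
    \<open>d * C + W * (\<kappa> * LH\<^sup>2 * T)\<close>, and \<open>d\<close> is chosen to make
    the first part at most half of \<theta>.\<close>
  define C where "C = W * (W * lam * L\<^sup>2 * T + 2 * (2 * L + 2) * T + 4 * Lf + (1 + 1 / \<kappa>))"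
  have C: "0 \<le> C" unfolding C_def using W lam0 L(1) T Lf \<kappa> by (intro mult_nonneg_nonneg add_nonneg_nonneg) auto
  define d where "d = min 1 (\<theta> / (2 * (C + 1)))"
  have d: "0 < d" "d \<le> 1" using \<theta> C by (auto simp: d_def)
  have dC: "d * C \<le> \<theta> / 2"
  proof -
    have "d * C \<le> d * (C + 1)" using d by simp
    also have "\<dots> \<le> \<theta> / (2 * (C + 1)) * (C + 1)" using C by (intro mult_right_mono) (auto simp: d_def)
    also have "\<dots> = \<theta> / 2" using C by (simp only: times_divide_eq_left) (simp add: divide_simps)
    finally show ?thesis .
  qed
  obtain du where du: "du > 0" "\<And>s t. s \<in> {0..T} \<Longrightarrow> t \<in> {0..T} \<Longrightarrow> \<bar>t - s\<bar> < du \<Longrightarrow> norm (x t - x s) < d"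
    using compact_uniformly_continuous[OF x] d(1) unfolding uniformly_continuous_on_def
    by (auto simp: dist_norm)
  \<comment> \<open>With this mesh the path moves by less than \<open>d\<close> within a cell. As
    \<open>y\<close> is within \<open>d\<close> of the path at grid points, its right-end value is
    within \<open>2 * d\<close> of the path on the whole cell.\<close>
  define \<delta> where "\<delta> = min d (du / 2)"
  have \<delta>: "0 < \<delta>" "\<delta> \<le> d" "\<delta> < du" using d du by (auto simp: \<delta>_def)
  show ?thesis
  proof (intro exI[of _ \<delta>] conjI \<delta>(1) allI impI)
    fix N s y e U l and \<eta> :: "nat \<Rightarrow> 'c"
    assume grid: "time_grid T N s" and mesh: "\<forall>j<N. s (Suc j) - s j \<le> \<delta>"
      and yx: "\<forall>j\<le>N. norm (y j - x (s j)) \<le> \<delta>"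
      and ye: "\<forall>j<N. y (Suc j) = y j + integral {s j..s (Suc j)} fs + e j"
      and U: "U integrable_on {0..T}" "integral {0..T} U \<le> \<delta>" "\<forall>r\<in>{0..T}. 0 \<le> U r"
      and \<eta>: "\<forall>j<N. \<forall>r\<in>{s j<..<s (Suc j)}. (norm (\<eta> j - H r))\<^sup>2 \<le> U r"
      and lN: "l \<le> N"
    define \<Phi>0 where "\<Phi>0 = (\<lambda>r. weight \<epsilon> r * (- lam * (norm (x r))\<^sup>2 + l2 * (norm (x (q * r)))\<^sup>2))"
    define \<Phi>1 where "\<Phi>1 = (\<lambda>r. W * ((d * W * lam * L\<^sup>2 + 2 * d * (2 * L + 2) + \<kappa> * LH\<^sup>2)
       + 4 * d * norm (fs r) + (1 + 1 / \<kappa>) * U r))"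
    have qr: "q * r \<in> {0..T}" if "r \<in> {0..T}" for r
      using that q by (auto intro: order.trans[OF mult_left_le_one_le])
    have xq: "continuous_on {0..T} (\<lambda>r. x (q * r))"
      by (rule continuous_on_compose2[OF x]) (use qr in \<open>auto intro!: continuous_intros\<close>)
    have \<Phi>0c: "continuous_on {0..T} \<Phi>0"
      unfolding \<Phi>0_def by (intro continuous_intros x xq)
    have \<Phi>1i: "\<Phi>1 integrable_on {0..T}"
      unfolding \<Phi>1_def
      by (intro integrable_on_mult_right integrable_add integrable_const_ivl fs U)
    have \<Phi>i: "(\<lambda>r. \<Phi>0 r + \<Phi>1 r) integrable_on {a..b}" if "0 \<le> a" "b \<le> T" for a b
    proof (rule integrable_on_subinterval)
      show "(\<lambda>r. \<Phi>0 r + \<Phi>1 r) integrable_on {0..T}"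
        by (intro integrable_add \<Phi>1i integrable_continuous_interval \<Phi>0c)
    qed (use that in auto)
    \<comment> \<open>The increment of the weighted square without the martingale summand: growth of
      the weight, drift, and the compensator \<open>|\<eta>|\<^sup>2 * (s (Suc j) - s j)\<close>
      added back.\<close>
    define t where "t j = (weight \<epsilon> (s (Suc j)) - weight \<epsilon> (s j)) * (norm (y (Suc j)))\<^sup>2 +
       weight \<epsilon> (s j) * (2 * (y (Suc j) \<bullet> integral {s j..s (Suc j)} fs) + (norm (\<eta> j))\<^sup>2 * (s (Suc j) - s j))" for j
    have t_le: "t j \<le> integral {s j..s (Suc j)} (\<lambda>r. \<Phi>0 r + \<Phi>1 r)" if j: "j < N" for j
    proof -
      let ?w = "weight \<epsilon> (s j)" and ?h = "s (Suc j) - s j" and ?y = "y (Suc j)"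
      have sj: "s j \<in> {0..T}" "s (Suc j) \<in> {0..T}" "s j < s (Suc j)"
        using time_grid_range[OF grid] grid j by (auto simp: time_grid_def)
      have fsi: "fs integrable_on {s j..s (Suc j)}"
        by (rule integrable_on_subinterval[OF fs(1)]) (use sj in auto)
      have fsy: "((\<lambda>r. ?y \<bullet> fs r) has_integral ?y \<bullet> integral {s j..s (Suc j)} fs) {s j..s (Suc j)}"
        using has_integral_linear[OF integrable_integral[OF fsi] bounded_linear_inner_right[of ?y]]
        by (simp add: o_def)
      let ?\<psi> = "\<lambda>r. ?w * ((\<epsilon> * (norm ?y)\<^sup>2 + (norm (\<eta> j))\<^sup>2) + 2 * (?y \<bullet> fs r))"
      have \<psi>i: "?\<psi> integrable_on {s j..s (Suc j)}"
        by (intro integrable_on_mult_right integrable_add integrable_const_ivl has_integral_integrable[OF fsy])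
      have "t j \<le> \<epsilon> * ?h * ?w * (norm ?y)\<^sup>2 +
         ?w * (2 * (?y \<bullet> integral {s j..s (Suc j)} fs) + (norm (\<eta> j))\<^sup>2 * ?h)"
        unfolding t_def using weight_increment_le[OF \<epsilon>, of "s j" "s (Suc j)"] sj
        by (intro add_right_mono mult_right_mono) auto
      also have "\<dots> = integral {s j..s (Suc j)} ?\<psi>"
      proof -
        have c: "((\<lambda>r. k) has_integral (?h * k)) {s j..s (Suc j)}" for k :: real
          using has_integral_const_real[of k "s j" "s (Suc j)"] sj by simp
        have "(?\<psi> has_integral (?w * (?h * (\<epsilon> * (norm ?y)\<^sup>2 + (norm (\<eta> j))\<^sup>2) +
           2 * (?y \<bullet> integral {s j..s (Suc j)} fs)))) {s j..s (Suc j)}"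
          by (intro has_integral_mult_right has_integral_add c fsy)
        then show ?thesis by (simp add: integral_unique algebra_simps)
      qed
      \<comment> \<open>The value \<open>\<eta> j\<close> is compared with \<open>H\<close> only
        inside the cell, since a simple process may jump at the grid points.\<close>
      also have "\<dots> = integral {s j<..<s (Suc j)} ?\<psi>"
        by (rule integral_open_interval_real)
      also have "\<dots> \<le> integral {s j<..<s (Suc j)} (\<lambda>r. \<Phi>0 r + \<Phi>1 r)"
      proof (rule integral_le)
        show "?\<psi> integrable_on {s j<..<s (Suc j)}"
          using \<psi>i by (simp add: integrable_on_open_interval_real)
        show "(\<lambda>r. \<Phi>0 r + \<Phi>1 r) integrable_on {s j<..<s (Suc j)}"
          using \<Phi>i sj by (simp add: integrable_on_open_interval_real)
        fix r assume r: "r \<in> {s j<..<s (Suc j)}"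
        then have rT: "r \<in> {0..T}" using sj by auto
        let ?D = "norm (?y - x r)"
        have "norm (x (s (Suc j)) - x r) < d"
          using du(2)[OF rT sj(2)] mesh j \<delta>(3) r by force
        moreover have "norm (?y - x (s (Suc j))) \<le> d" using yx[rule_format, of "Suc j"] j \<delta>(2) by simp
        ultimately have D: "?D \<le> 2 * d"
          using norm_triangle_ineq[of "?y - x (s (Suc j))" "x (s (Suc j)) - x r"] by simp
        have e1: "\<epsilon> * (norm ?y)\<^sup>2 \<le> \<epsilon> * (norm (x r))\<^sup>2 + 2 * d * (2 * L + 2)"
        proof -
          have "norm ?y \<le> norm (x r) + 2 * d"
            using D norm_triangle_ineq[of "x r" "?y - x r"] by simp
          then have "(norm ?y)\<^sup>2 \<le> (norm (x r) + 2 * d)\<^sup>2" by (intro power_mono) auto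
          also have "\<dots> = (norm (x r))\<^sup>2 + 2 * d * (2 * norm (x r) + 2 * d)"
            by (simp add: power2_eq_square algebra_simps)
          also have "\<dots> \<le> (norm (x r))\<^sup>2 + 2 * d * (2 * L + 2)"
            using L(2)[OF rT] d by (intro add_left_mono mult_left_mono) auto
          finally have "\<epsilon> * (norm ?y)\<^sup>2 \<le> \<epsilon> * ((norm (x r))\<^sup>2 + 2 * d * (2 * L + 2))"
            using \<epsilon> by (intro mult_left_mono)
          moreover have "\<epsilon> * (2 * d * (2 * L + 2)) \<le> 1 * (2 * d * (2 * L + 2))"
            using \<epsilon> d L(1) by (intro mult_right_mono) auto
          ultimately show ?thesis unfolding distrib_left[of \<epsilon> "(norm (x r))\<^sup>2"] by linarith
        qed
        have e2: "2 * (?y \<bullet> fs r) \<le> 2 * (x r \<bullet> fs r) + 4 * d * norm (fs r)"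
        proof -
          have "(?y - x r) \<bullet> fs r \<le> ?D * norm (fs r)" by (rule norm_cauchy_schwarz)
          also have "\<dots> \<le> 2 * d * norm (fs r)" by (intro mult_right_mono D) simp
          finally show ?thesis by (simp add: inner_diff_left)
        qed
        have e3: "(norm (\<eta> j))\<^sup>2 \<le> (norm (H r))\<^sup>2 + \<kappa> * LH\<^sup>2 + (1 + 1 / \<kappa>) * U r"
        proof -
          let ?a = "norm (H r)" and ?b = "norm (\<eta> j - H r)"
          have "norm (\<eta> j) \<le> ?a + ?b" using norm_triangle_ineq[of "H r" "\<eta> j - H r"] by simp
          then have "(norm (\<eta> j))\<^sup>2 \<le> (?a + ?b)\<^sup>2" by (intro power_mono) auto
          also have "\<dots> = ?a\<^sup>2 + 2 * ?a * ?b + ?b\<^sup>2" by (simp add: power2_eq_square algebra_simps)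
          also have "2 * ?a * ?b \<le> \<kappa> * ?a\<^sup>2 + ?b\<^sup>2 / \<kappa>"
          proof -
            have "0 \<le> (\<kappa> * ?a - ?b)\<^sup>2 / \<kappa>" using \<kappa> by simp
            then show ?thesis using \<kappa> by (simp add: power2_eq_square field_simps)
          qed
          finally have "(norm (\<eta> j))\<^sup>2 \<le> ?a\<^sup>2 + \<kappa> * ?a\<^sup>2 + (1 + 1 / \<kappa>) * ?b\<^sup>2"
            by (simp add: algebra_simps)
          moreover have "\<kappa> * ?a\<^sup>2 \<le> \<kappa> * LH\<^sup>2"
            using H[OF rT] \<kappa> by (intro mult_left_mono power_mono) auto
          moreover have "(1 + 1 / \<kappa>) * ?b\<^sup>2 \<le> (1 + 1 / \<kappa>) * U r"
            using \<eta> j r \<kappa> by (intro mult_left_mono) auto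
          ultimately show ?thesis by linarith
        qed
        let ?X = "(norm (x r))\<^sup>2" and ?Y = "(norm (x (q * r)))\<^sup>2"
        let ?E = "2 * d * (2 * L + 2) + \<kappa> * LH\<^sup>2 + 4 * d * norm (fs r) + (1 + 1 / \<kappa>) * U r"
        have E0: "0 \<le> ?E" using d L(1) \<kappa> U(3) rT by (intro add_nonneg_nonneg mult_nonneg_nonneg) auto
        have "(\<epsilon> * (norm ?y)\<^sup>2 + (norm (\<eta> j))\<^sup>2) + 2 * (?y \<bullet> fs r) \<le> - lam * ?X + l2 * ?Y + ?E"
          using e1 e2 e3 dis[OF rT] by (simp add: lam_def algebra_simps)
        then have "?\<psi> r \<le> ?w * (- lam * ?X + l2 * ?Y + ?E)"
          using wW[OF sj(1)] by (intro mult_left_mono)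
        also have "\<dots> = - lam * (?w * ?X) + ?w * (l2 * ?Y) + ?w * ?E" by (simp add: algebra_simps)
        also have "?w * (l2 * ?Y) \<le> weight \<epsilon> r * (l2 * ?Y)"
          using weight_mono[OF \<epsilon>(1), of "s j" r] sj r l by (intro mult_right_mono mult_nonneg_nonneg) auto
        also have "?w * ?E \<le> W * ?E" using wW[OF sj(1)] E0 by (intro mult_right_mono)
        \<comment> \<open>Here the sign is unfavourable: the damping carries the smaller weight of
          the left end, and raising it to the weight at \<open>r\<close> costs a term of order
          \<open>d\<close>. For the delayed term monotonicity of the weight suffices. The additional
          factor \<open>W\<close> only matches the shape of \<open>\<Phi>1\<close>.\<close>
        also have "- lam * (?w * ?X) \<le> - lam * (weight \<epsilon> r * ?X) + W * (d * W * lam * L\<^sup>2)"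
        proof -
          have "weight \<epsilon> r - ?w \<le> \<epsilon> * (r - s j) * ?w"
            using sj r by (intro weight_increment_le \<epsilon>) auto
          also have "\<dots> \<le> 1 * d * W"
            using sj r \<epsilon> mesh[rule_format, OF j] \<delta>(2) wW[OF sj(1)] d(1)
            by (intro mult_mono mult_nonneg_nonneg) auto
          finally have "(weight \<epsilon> r - ?w) * (lam * ?X) \<le> d * W * (lam * ?X)"
            using lam0 by (intro mult_right_mono mult_nonneg_nonneg) auto
          also have "\<dots> \<le> d * W * (lam * L\<^sup>2)"
            using d W lam0 L(2)[OF rT] by (intro mult_left_mono power_mono) auto
          also have "\<dots> \<le> W * (d * W * (lam * L\<^sup>2))"
            using mult_right_mono[OF W, of "d * W * (lam * L\<^sup>2)"] d W lam0 by (simp add: mult_nonneg_nonneg)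
          finally show ?thesis by (simp add: algebra_simps)
        qed
        finally show "?\<psi> r \<le> \<Phi>0 r + \<Phi>1 r"
          by (simp add: \<Phi>0_def \<Phi>1_def algebra_simps)
      qed
      also have "\<dots> = integral {s j..s (Suc j)} (\<lambda>r. \<Phi>0 r + \<Phi>1 r)"
        by (rule integral_open_interval_real[symmetric])
      finally show ?thesis .
    qed
    have sum_t: "(\<Sum>j<l. t j) \<le> integral {0..s l} (\<lambda>r. \<Phi>0 r + \<Phi>1 r)"
      using lN
    proof (induction l)
      case 0
      then show ?case using grid by (simp add: time_grid_def)
    next
      case (Suc l)
      then have sl: "0 \<le> s l" "s l \<le> s (Suc l)" "s (Suc l) \<le> T"
        using time_grid_range[OF grid] time_grid_mono[OF grid, of l "Suc l"] by auto
      have "(\<Sum>j<Suc l. t j) \<le> integral {0..s l} (\<lambda>r. \<Phi>0 r + \<Phi>1 r) + integral {s l..s (Suc l)} (\<lambda>r. \<Phi>0 r + \<Phi>1 r)"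
        using Suc t_le[of l] by simp
      also have "\<dots> = integral {0..s (Suc l)} (\<lambda>r. \<Phi>0 r + \<Phi>1 r)"
        using sl by (intro Henstock_Kurzweil_Integration.integral_combine \<Phi>i) auto
      finally show ?case .
    qed
    have sl: "0 \<le> s l" "s l \<le> T" using time_grid_range[OF grid lN] by auto
    have \<Phi>0_le: "integral {0..s l} \<Phi>0 \<le> 0"
    proof -
      let ?I = "integral {0..s l} (\<lambda>r. weight \<epsilon> r * (norm (x r))\<^sup>2)"
      let ?J = "integral {0..s l} (\<lambda>r. weight \<epsilon> r * (norm (x (q * r)))\<^sup>2)"
      have sub: "{0..s l} \<subseteq> {0..T}" using sl by auto
      have i1: "(\<lambda>r. weight \<epsilon> r * (norm (x r))\<^sup>2) integrable_on {0..s l}"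
        by (intro integrable_continuous_interval continuous_intros continuous_on_subset[OF x sub])
      have i2: "(\<lambda>r. weight \<epsilon> r * (norm (x (q * r)))\<^sup>2) integrable_on {0..s l}"
        by (intro integrable_continuous_interval continuous_intros continuous_on_subset[OF xq sub])
      have \<Phi>0_eq: "\<Phi>0 = (\<lambda>r. - lam * (weight \<epsilon> r * (norm (x r))\<^sup>2) + l2 * (weight \<epsilon> r * (norm (x (q * r)))\<^sup>2))"
        by (simp add: \<Phi>0_def algebra_simps)
      have "(\<Phi>0 has_integral - lam * ?I + l2 * ?J) {0..s l}"
        unfolding \<Phi>0_eq by (intro has_integral_add has_integral_mult_right integrable_integral i1 i2)
      then have eq: "integral {0..s l} \<Phi>0 = - lam * ?I + l2 * ?J" by (rule integral_unique)
      have "?J \<le> q powr (-1 - \<epsilon>) * ?I"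
        by (rule weighted_delay_integral[OF _ _ q \<epsilon>(1) sl]) (auto intro!: continuous_intros x)
      then have "l2 * ?J \<le> l2 * q powr (-1 - \<epsilon>) * ?I" using l(1) by (simp add: mult.assoc mult_left_mono)
      also have "\<dots> \<le> lam * ?I"
        by (intro mult_right_mono lam integral_nonneg i1)
           (use sl in \<open>auto intro!: mult_nonneg_nonneg less_imp_le[OF weight_pos]\<close>)
      finally show ?thesis using eq by simp
    qed
    have \<Phi>1_le: "integral {0..s l} \<Phi>1 \<le> \<theta>"
    proof -
      have "integral {0..s l} \<Phi>1 \<le> integral {0..T} \<Phi>1"
      proof (rule integral_subset_le[OF _ _ \<Phi>1i])
        show "\<Phi>1 integrable_on {0..s l}" by (rule integrable_on_subinterval[OF \<Phi>1i]) (use sl in auto)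
        show "\<forall>r\<in>{0..T}. 0 \<le> \<Phi>1 r"
          unfolding \<Phi>1_def using W d L(1) \<kappa> U(3) lam0
          by (intro ballI mult_nonneg_nonneg add_nonneg_nonneg) auto
      qed (use sl in auto)
      moreover have c: "((\<lambda>r. k) has_integral (T * k)) {0..T}" for k :: real
        using has_integral_const_real[of k 0 T] T by simp
      have "(\<Phi>1 has_integral W * (T * (d * W * lam * L\<^sup>2 + 2 * d * (2 * L + 2) + \<kappa> * LH\<^sup>2)
          + 4 * d * Lf + (1 + 1 / \<kappa>) * integral {0..T} U)) {0..T}"
        unfolding \<Phi>1_def Lf_def
        by (intro has_integral_mult_right has_integral_add c integrable_integral fs U)
      then have "integral {0..T} \<Phi>1 = W * (T * (d * W * lam * L\<^sup>2 + 2 * d * (2 * L + 2) + \<kappa> * LH\<^sup>2)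
          + 4 * d * Lf + (1 + 1 / \<kappa>) * integral {0..T} U)"
        by (simp add: integral_unique)
      moreover have "W * (T * (d * W * lam * L\<^sup>2 + 2 * d * (2 * L + 2) + \<kappa> * LH\<^sup>2)
          + 4 * d * Lf + (1 + 1 / \<kappa>) * integral {0..T} U) \<le> W * (T * (d * W * lam * L\<^sup>2 + 2 * d * (2 * L + 2) + \<kappa> * LH\<^sup>2)
          + 4 * d * Lf + (1 + 1 / \<kappa>) * d)"
        using W \<kappa> U(2) \<delta>(2) by (intro mult_left_mono add_left_mono) auto
      moreover have "W * (T * (d * W * lam * L\<^sup>2 + 2 * d * (2 * L + 2) + \<kappa> * LH\<^sup>2)
          + 4 * d * Lf + (1 + 1 / \<kappa>) * d) = d * C + W * (\<kappa> * LH\<^sup>2 * T)"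
        by (simp add: C_def algebra_simps)
      ultimately show ?thesis using dC \<kappa>2 by linarith
    qed
    have "integral {0..s l} (\<lambda>r. \<Phi>0 r + \<Phi>1 r) = integral {0..s l} \<Phi>0 + integral {0..s l} \<Phi>1"
    proof (rule Henstock_Kurzweil_Integration.integral_add)
      show "\<Phi>0 integrable_on {0..s l}"
        by (rule integrable_continuous_interval, rule continuous_on_subset[OF \<Phi>0c]) (use sl in auto)
      show "\<Phi>1 integrable_on {0..s l}" by (rule integrable_on_subinterval[OF \<Phi>1i]) (use sl in auto)
    qed
    then have st: "(\<Sum>j<l. t j) \<le> \<theta>" using sum_t \<Phi>0_le \<Phi>1_le by simp
    have "weight \<epsilon> (s l) * (norm (y l))\<^sup>2 \<le> (norm (y 0))\<^sup>2 + (\<Sum>j<l. t j) +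
        (\<Sum>j<l. weight \<epsilon> (s j) * (2 * (y j \<bullet> e j) + (norm (e j))\<^sup>2 - (norm (\<eta> j))\<^sup>2 * (s (Suc j) - s j)))"
      using lN
    proof (induction l)
      case 0
      then show ?case using grid by (simp add: time_grid_def)
    next
      case (Suc l)
      let ?A = "integral {s l..s (Suc l)} fs"
      \<comment> \<open>Expanding around \<open>y (Suc l)\<close> instead of \<open>y l\<close> avoids the mixed term \<open>?A \<bullet> e l\<close>, and
        \<open>(norm ?A)\<^sup>2\<close> enters with the favourable sign.\<close>
      have "(norm (y (Suc l) - ?A))\<^sup>2 = (norm (y (Suc l)))\<^sup>2 - 2 * (y (Suc l) \<bullet> ?A) + (norm ?A)\<^sup>2"
        by (simp add: power2_norm_eq_inner inner_diff_left inner_diff_right inner_commute)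
      moreover have "y (Suc l) - ?A = y l + e l" using ye Suc by simp
      moreover have "(norm (y l + e l))\<^sup>2 = (norm (y l))\<^sup>2 + 2 * (y l \<bullet> e l) + (norm (e l))\<^sup>2"
        by (simp add: power2_norm_eq_inner inner_add_left inner_add_right inner_commute)
      ultimately have "(norm (y (Suc l)))\<^sup>2 \<le>
          (norm (y l))\<^sup>2 + 2 * (y l \<bullet> e l) + (norm (e l))\<^sup>2 + 2 * (y (Suc l) \<bullet> ?A)"
        by (smt (verit) zero_le_power2)
      then have "weight \<epsilon> (s l) * (norm (y (Suc l)))\<^sup>2 \<le> weight \<epsilon> (s l) *
          ((norm (y l))\<^sup>2 + 2 * (y l \<bullet> e l) + (norm (e l))\<^sup>2 + 2 * (y (Suc l) \<bullet> ?A))"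
        using wW[OF time_grid_range[OF grid, of l]] Suc by (intro mult_left_mono) auto
      then show ?case using Suc by (simp add: t_def algebra_simps)
    qed
    then show "weight \<epsilon> (s l) * (norm (y l))\<^sup>2 \<le> (norm (y 0))\<^sup>2 + \<theta> +
        (\<Sum>j<l. weight \<epsilon> (s j) * (2 * (y j \<bullet> e j) + (norm (e j))\<^sup>2 - (norm (\<eta> j))\<^sup>2 * (s (Suc j) - s j)))"
      using st by simp
  qed
qed

text \<open>While \<open>y\<close> stays below \<open>R\<close>, the accumulated square of the
  integrand has a bound independent of the path. Hence, on fine grids, a stopping rule with this
  second threshold is never triggered by the second threshold alone. The constant comes from
  \<open>|\<eta>|\<^sup>2 \<le> 2 * |H|\<^sup>2 + 2 * U\<close> and the linear growth of
  \<open>H\<close>.\<close>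

lemma discrete_energy_bound:
  fixes x :: "real \<Rightarrow> 'b::euclidean_space" and H :: "real \<Rightarrow> 'c::real_normed_vector"
  assumes T: "0 < T" and q: "0 < q" "q < 1" and x: "continuous_on {0..T} x"
    and cd: "0 \<le> c" "0 \<le> d"
    and H: "\<And>s. s \<in> {0..T} \<Longrightarrow> norm (H s) \<le> c * norm (x s) + d * norm (x (q * s))" and R: "0 \<le> R"
  shows "\<exists>\<delta>>0. \<forall>N s y \<eta> U l. time_grid T N s \<longrightarrow> (\<forall>j<N. s (Suc j) - s j \<le> \<delta>) \<longrightarrow>
     (\<forall>j\<le>N. norm (y j - x (s j)) \<le> \<delta>) \<longrightarrow>
     U integrable_on {0..T} \<longrightarrow> integral {0..T} U \<le> \<delta> \<longrightarrow> (\<forall>r\<in>{0..T}. 0 \<le> U r) \<longrightarrow>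
     (\<forall>j<N. \<forall>r\<in>{s j<..<s (Suc j)}. (norm (\<eta> j - H r))\<^sup>2 \<le> U r) \<longrightarrow>
     l < N \<longrightarrow> (\<forall>i\<le>l. norm (y i) \<le> R) \<longrightarrow>
     (\<Sum>i\<le>l. (norm (\<eta> i :: 'c))\<^sup>2 * (s (Suc i) - s i)) \<le> 2 * ((c + d) * (R + 1))\<^sup>2 * T + 2"
proof -
  obtain du where du: "du > 0" "\<And>s t. s \<in> {0..T} \<Longrightarrow> t \<in> {0..T} \<Longrightarrow> \<bar>t - s\<bar> < du \<Longrightarrow> norm (x t - x s) < 1/2"
    using compact_uniformly_continuous[OF x] unfolding uniformly_continuous_on_def
    by (auto simp: dist_norm dest!: spec[of _ "1/2"])
  define \<delta> where "\<delta> = min (1/2) (du / 2)"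
  have \<delta>: "0 < \<delta>" "\<delta> \<le> 1/2" "\<delta> < du" using du by (auto simp: \<delta>_def)
  let ?K = "((c + d) * (R + 1))\<^sup>2"
  show ?thesis
  proof (intro exI[of _ \<delta>] conjI \<delta>(1) allI impI)
    fix N s y U l and \<eta> :: "nat \<Rightarrow> 'c"
    assume grid: "time_grid T N s" and mesh: "\<forall>j<N. s (Suc j) - s j \<le> \<delta>"
      and yx: "\<forall>j\<le>N. norm (y j - x (s j)) \<le> \<delta>"
      and U: "U integrable_on {0..T}" "integral {0..T} U \<le> \<delta>" "\<forall>r\<in>{0..T}. 0 \<le> U r"
      and \<eta>: "\<forall>j<N. \<forall>r\<in>{s j<..<s (Suc j)}. (norm (\<eta> j - H r))\<^sup>2 \<le> U r"
      and lN: "l < N" and y: "\<forall>i\<le>l. norm (y i) \<le> R"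
    \<comment> \<open>One half of the extra 1 pays for the distance of \<open>y\<close> from the
      path at the grid point, the other for the oscillation of the path in a cell. The range
      includes the cell after index \<open>l\<close>, where \<open>\<eta> l\<close> acts; delayed
      times \<open>q * r\<close> lie in it too, because the delay looks back.\<close>
    have xR: "norm (x r) \<le> R + 1" if r: "0 \<le> r" "r \<le> s (Suc l)" for r
    proof -
      obtain j where j: "j \<le> l" "s j \<le> r" "r \<le> s (Suc j)"
        using time_grid_locate[OF grid lN r] .
      have jN: "j < N" using j lN by simp
      have "s j \<in> {0..T}" "r \<in> {0..T}"
        using time_grid_range[OF grid, of j] time_grid_range[OF grid, of "Suc l"] lN jN r by auto
      then have "norm (x r - x (s j)) < 1/2"
        using du(2)[of "s j" r] mesh[rule_format, OF jN] \<delta>(3) j by simp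
      moreover have "norm (y j - x (s j)) \<le> 1/2" using yx[rule_format, of j] jN \<delta>(2) by simp
      moreover have "norm (y j) \<le> R" using y j by simp
      moreover have "norm (x r) \<le> norm (y j) + norm (y j - x (s j)) + norm (x r - x (s j))"
        using norm_triangle_ineq[of "x (s j)" "x r - x (s j)"] norm_triangle_ineq4[of "y j" "y j - x (s j)"]
        by simp
      ultimately show ?thesis by linarith
    qed
    have HR: "(norm (H r))\<^sup>2 \<le> ?K" if r: "0 \<le> r" "r \<le> s (Suc l)" for r
    proof -
      have qr: "0 \<le> q * r" "q * r \<le> s (Suc l)" "r \<in> {0..T}"
        using q r mult_left_le_one_le[of r q] time_grid_range[OF grid, of "Suc l"] lN by auto
      have "norm (H r) \<le> c * norm (x r) + d * norm (x (q * r))" by (rule H[OF qr(3)])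
      also have "\<dots> \<le> c * (R + 1) + d * (R + 1)"
        by (intro add_mono mult_left_mono xR qr r cd)
      finally show ?thesis by (intro power_mono) (auto simp: distrib_right)
    qed
    have step: "(norm (\<eta> i))\<^sup>2 * (s (Suc i) - s i) \<le> integral {s i..s (Suc i)} (\<lambda>r. 2 * ?K + 2 * U r)"
      if i: "i \<le> l" for i
    proof -
      have si: "s i < s (Suc i)" "s (Suc i) \<le> s (Suc l)" "0 \<le> s i" "s (Suc i) \<le> T"
        using grid i lN time_grid_mono[OF grid, of "Suc i" "Suc l"] time_grid_range[OF grid]
        by (auto simp: time_grid_def)
      have "(norm (\<eta> i))\<^sup>2 * (s (Suc i) - s i) = integral {s i..s (Suc i)} (\<lambda>r. (norm (\<eta> i))\<^sup>2)"
        using si by simp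
      also have "\<dots> = integral {s i<..<s (Suc i)} (\<lambda>r. (norm (\<eta> i))\<^sup>2)"
        by (rule integral_open_interval_real)
      also have "\<dots> \<le> integral {s i<..<s (Suc i)} (\<lambda>r. 2 * ?K + 2 * U r)"
      proof (rule integral_le)
        show "(\<lambda>r. (norm (\<eta> i))\<^sup>2) integrable_on {s i<..<s (Suc i)}"
          unfolding integrable_on_open_interval_real by (rule integrable_const_ivl)
        show "(\<lambda>r. 2 * ?K + 2 * U r) integrable_on {s i<..<s (Suc i)}"
          unfolding integrable_on_open_interval_real
          by (intro integrable_add integrable_const_ivl integrable_on_mult_right
              integrable_on_subinterval[OF U(1)]) (use si in auto)
        fix r assume r: "r \<in> {s i<..<s (Suc i)}"
        have "norm (\<eta> i) \<le> norm (H r) + norm (\<eta> i - H r)"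
          using norm_triangle_ineq[of "H r" "\<eta> i - H r"] by simp
        then have "(norm (\<eta> i))\<^sup>2 \<le> (norm (H r) + norm (\<eta> i - H r))\<^sup>2" by (intro power_mono) auto
        also have "\<dots> \<le> 2 * (norm (H r))\<^sup>2 + 2 * (norm (\<eta> i - H r))\<^sup>2"
          using zero_le_power2[of "norm (H r) - norm (\<eta> i - H r)"]
          unfolding power2_eq_square by (simp add: algebra_simps)
        also have "\<dots> \<le> 2 * ?K + 2 * U r"
          using HR[of r] \<eta> i lN r si by (intro add_mono mult_left_mono) auto
        finally show "(norm (\<eta> i))\<^sup>2 \<le> 2 * ?K + 2 * U r" .
      qed
      also have "\<dots> = integral {s i..s (Suc i)} (\<lambda>r. 2 * ?K + 2 * U r)"
        by (rule integral_open_interval_real[symmetric])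
      finally show ?thesis .
    qed
    have int: "(\<lambda>r. 2 * ?K + 2 * U r) integrable_on {a..b}" if "0 \<le> a" "b \<le> T" for a b
      by (intro integrable_add integrable_const_ivl integrable_on_mult_right
          integrable_on_subinterval[OF U(1)]) (use that in auto)
    have "(\<Sum>i<k. (norm (\<eta> i))\<^sup>2 * (s (Suc i) - s i)) \<le> integral {0..s k} (\<lambda>r. 2 * ?K + 2 * U r)"
      if "k \<le> Suc l" for k
      using that
    proof (induction k)
      case 0
      then show ?case using grid by (simp add: time_grid_def)
    next
      case (Suc k)
      have sk: "0 \<le> s k" "s k \<le> s (Suc k)" "s (Suc k) \<le> T"
        using Suc lN time_grid_range[OF grid] time_grid_mono[OF grid, of k "Suc k"] by auto
      have "(\<Sum>i<Suc k. (norm (\<eta> i))\<^sup>2 * (s (Suc i) - s i)) \<le>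
          integral {0..s k} (\<lambda>r. 2 * ?K + 2 * U r) + integral {s k..s (Suc k)} (\<lambda>r. 2 * ?K + 2 * U r)"
        using Suc step[of k] by simp
      also have "\<dots> = integral {0..s (Suc k)} (\<lambda>r. 2 * ?K + 2 * U r)"
        using sk by (intro Henstock_Kurzweil_Integration.integral_combine int) auto
      finally show ?case .
    qed
    from this[of "Suc l"] have "(\<Sum>i\<le>l. (norm (\<eta> i))\<^sup>2 * (s (Suc i) - s i)) \<le>
        integral {0..s (Suc l)} (\<lambda>r. 2 * ?K + 2 * U r)"
      by (simp only: lessThan_Suc_atMost)
    also have "\<dots> \<le> integral {0..T} (\<lambda>r. 2 * ?K + 2 * U r)"
    proof (rule integral_subset_le[OF _ int int])
      show "\<forall>r\<in>{0..T}. 0 \<le> 2 * ?K + 2 * U r" using U(3) by (auto intro: add_nonneg_nonneg)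
    qed (use time_grid_range[OF grid, of "Suc l"] lN in auto)
    also have "\<dots> = 2 * ?K * T + 2 * integral {0..T} U"
    proof (rule integral_unique)
      have c: "((\<lambda>r. k) has_integral (k * T)) {0..T}" for k :: real
        using has_integral_const_real[of k 0 T] T by (simp add: mult.commute)
      show "((\<lambda>r. 2 * ?K + 2 * U r) has_integral 2 * ?K * T + 2 * integral {0..T} U) {0..T}"
        by (intro has_integral_add has_integral_mult_right c integrable_integral U)
    qed
    also have "\<dots> \<le> 2 * ?K * T + 2" using U(2) \<delta>(2) by simp
    finally show "(\<Sum>i\<le>l. (norm (\<eta> i))\<^sup>2 * (s (Suc i) - s i)) \<le> 2 * ?K * T + 2" .
  qed
qed

text \<open>The stopped sum is the plain sum up to the first index \<open>l\<close> where
  \<open>G\<close> fails, so \<open>discrete_drift_bound\<close> at \<open>l\<close> bounds it below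
  by the weighted square there, up to \<theta> and the initial term. That square is always
  nonnegative, and it exceeds \<open>R\<^sup>2\<close> if stopping happened. A path above the level
  at some \<open>t\<close> forces stopping on all fine grids.\<close>

lemma discrete_lower_bound:
  fixes x fs :: "real \<Rightarrow> 'b::euclidean_space" and H :: "real \<Rightarrow> 'c::real_normed_vector"
    and y e :: "nat \<Rightarrow> nat \<Rightarrow> 'b" and \<eta> :: "nat \<Rightarrow> nat \<Rightarrow> 'c"
  assumes T: "0 < T" and q: "0 < q" "q < 1" and \<epsilon>: "0 \<le> \<epsilon>" "\<epsilon> \<le> 1"
    and x: "continuous_on {0..T} x"
    and fs: "fs integrable_on {0..T}" "(\<lambda>s. norm (fs s)) integrable_on {0..T}"
    and dis: "\<And>s. s \<in> {0..T} \<Longrightarrow>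
      2 * (x s \<bullet> fs s) + (norm (H s))\<^sup>2 \<le> l1 * (norm (x s))\<^sup>2 + l2 * (norm (x (q * s)))\<^sup>2"
    and cd: "0 \<le> c" "0 \<le> d"
    and H: "\<And>s. s \<in> {0..T} \<Longrightarrow> norm (H s) \<le> c * norm (x s) + d * norm (x (q * s))"
    and l: "0 \<le> l2" "\<epsilon> + l1 + l2 * q powr (-1 - \<epsilon>) \<le> 0" and R: "0 \<le> R"
    and grid: "\<And>k. time_grid T (N k) (s k)" "\<And>k j. j < N k \<Longrightarrow> s k (Suc j) - s k j \<le> (1/2) ^ k"
    and ye: "\<And>k j. j < N k \<Longrightarrow> y k (Suc j) = y k j + integral {s k j..s k (Suc j)} fs + e k j"
    and yx: "eventually (\<lambda>k. \<forall>j\<le>N k. norm (y k j - x (s k j)) \<le> (1/2) ^ k) sequentially"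
    and U: "eventually (\<lambda>k. U k integrable_on {0..T} \<and> integral {0..T} (U k) \<le> (1/2) ^ k) sequentially"
      "\<And>k r. r \<in> {0..T} \<Longrightarrow> 0 \<le> U k r"
      "\<And>k j r. j < N k \<Longrightarrow> r \<in> {s k j<..<s k (Suc j)} \<Longrightarrow> (norm (\<eta> k j - H r))\<^sup>2 \<le> U k r"
    and \<theta>: "0 < \<theta>"
  defines "G \<equiv> \<lambda>k j. (\<forall>i\<le>j. weight \<epsilon> (s k i) * (norm (y k i))\<^sup>2 \<le> R\<^sup>2) \<and>
      (\<Sum>i\<le>j. (norm (\<eta> k i))\<^sup>2 * (s k (Suc i) - s k i)) \<le> 2 * ((c + d) * (R + 1))\<^sup>2 * T + 2"
    and "m \<equiv> \<lambda>k j. weight \<epsilon> (s k j) *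
      (2 * (y k j \<bullet> e k j) + (norm (e k j))\<^sup>2 - (norm (\<eta> k j))\<^sup>2 * (s k (Suc j) - s k j))"
  shows "eventually (\<lambda>k. - \<theta> \<le> (norm (y k 0))\<^sup>2 + (\<Sum>j<N k. if G k j then m k j else 0)) sequentially"
    and "t \<in> {0..T} \<Longrightarrow> R\<^sup>2 < weight \<epsilon> t * (norm (x t))\<^sup>2 \<Longrightarrow>
      eventually (\<lambda>k. R\<^sup>2 - \<theta> \<le> (norm (y k 0))\<^sup>2 + (\<Sum>j<N k. if G k j then m k j else 0)) sequentially"
proof -
  obtain L where L: "L > 0" "\<And>s. s \<in> {0..T} \<Longrightarrow> norm (x s) \<le> L"
    using compact_imp_bounded[OF compact_continuous_image[OF x]] unfolding bounded_pos by auto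
  have HL: "norm (H r) \<le> c * L + d * L" if "r \<in> {0..T}" for r
  proof -
    have "q * r \<in> {0..T}" using that q mult_left_le_one_le[of r q] by auto
    then show ?thesis
      using H[OF that] L(2)[OF that] L(2)[of "q * r"] cd
      by (meson add_mono mult_left_mono order.trans)
  qed
  obtain \<delta>1 where \<delta>1: "\<delta>1 > 0" and drift: "\<forall>N s y e \<eta> U. time_grid T N s \<longrightarrow> (\<forall>j<N. s (Suc j) - s j \<le> \<delta>1) \<longrightarrow>
     (\<forall>j\<le>N. norm (y j - x (s j)) \<le> \<delta>1) \<longrightarrow>
     (\<forall>j<N. y (Suc j) = y j + integral {s j..s (Suc j)} fs + e j) \<longrightarrow>
     U integrable_on {0..T} \<longrightarrow> integral {0..T} U \<le> \<delta>1 \<longrightarrow> (\<forall>r\<in>{0..T}. 0 \<le> U r) \<longrightarrow>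
     (\<forall>j<N. \<forall>r\<in>{s j<..<s (Suc j)}. (norm (\<eta> j - H r))\<^sup>2 \<le> U r) \<longrightarrow>
     (\<forall>l\<le>N. weight \<epsilon> (s l) * (norm (y l))\<^sup>2 \<le> (norm (y 0))\<^sup>2 + \<theta> +
        (\<Sum>j<l. weight \<epsilon> (s j) * (2 * (y j \<bullet> e j) + (norm (e j))\<^sup>2 - (norm (\<eta> j))\<^sup>2 * (s (Suc j) - s j))))"
    using discrete_drift_bound[OF T q \<epsilon> x fs dis HL l \<theta>] by blast
  obtain \<delta>2 where \<delta>2: "\<delta>2 > 0" and energy: "\<forall>N s y \<eta> U l. time_grid T N s \<longrightarrow> (\<forall>j<N. s (Suc j) - s j \<le> \<delta>2) \<longrightarrow>
     (\<forall>j\<le>N. norm (y j - x (s j)) \<le> \<delta>2) \<longrightarrow>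
     U integrable_on {0..T} \<longrightarrow> integral {0..T} U \<le> \<delta>2 \<longrightarrow> (\<forall>r\<in>{0..T}. 0 \<le> U r) \<longrightarrow>
     (\<forall>j<N. \<forall>r\<in>{s j<..<s (Suc j)}. (norm (\<eta> j - H r))\<^sup>2 \<le> U r) \<longrightarrow>
     l < N \<longrightarrow> (\<forall>i\<le>l. norm (y i) \<le> R) \<longrightarrow>
     (\<Sum>i\<le>l. (norm (\<eta> i :: 'c))\<^sup>2 * (s (Suc i) - s i)) \<le> 2 * ((c + d) * (R + 1))\<^sup>2 * T + 2"
    using discrete_energy_bound[OF T q x cd H R] by blast
  let ?S = "\<lambda>k. (norm (y k 0))\<^sup>2 + (\<Sum>j<N k. if G k j then m k j else 0)"
  have half: "((\<lambda>k. (1/2) ^ k) \<longlonglongrightarrow> (0::real))" by (intro LIMSEQ_power_zero) simp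
  have small: "eventually (\<lambda>k. (1/2) ^ k < \<delta>1 \<and> (1/2) ^ k < \<delta>2) sequentially"
    using order_tendstoD(2)[OF half \<delta>1] order_tendstoD(2)[OF half \<delta>2] by eventually_elim simp
  \<comment> \<open>Once \<open>G\<close> fails it fails for good; only then does the conditional
    sum agree with a sum up to one index.\<close>
  have Gmono: "G k i" if "G k j" "i \<le> j" "j < N k" for k i j
  proof -
    have "(\<Sum>r\<le>i. (norm (\<eta> k r))\<^sup>2 * (s k (Suc r) - s k r)) \<le> (\<Sum>r\<le>j. (norm (\<eta> k r))\<^sup>2 * (s k (Suc r) - s k r))"
    proof (rule sum_mono2)
      fix r assume "r \<in> {..j} - {..i}"
      then have "s k r < s k (Suc r)" using grid(1)[of k] that by (simp add: time_grid_def)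
      then show "0 \<le> (norm (\<eta> k r))\<^sup>2 * (s k (Suc r) - s k r)" by simp
    qed (use that in auto)
    then show ?thesis using that unfolding G_def by auto
  qed
  have main: "eventually (\<lambda>k. \<exists>l\<le>N k. weight \<epsilon> (s k l) * (norm (y k l))\<^sup>2 \<le> ?S k + \<theta> \<and>
      (l < N k \<longrightarrow> R\<^sup>2 < weight \<epsilon> (s k l) * (norm (y k l))\<^sup>2) \<and> (l = N k \<longrightarrow> (\<forall>j<N k. G k j))) sequentially"
    using small yx U(1)
  proof eventually_elim
    case (elim k)
    have dr: "weight \<epsilon> (s k l) * (norm (y k l))\<^sup>2 \<le> (norm (y k 0))\<^sup>2 + \<theta> + (\<Sum>j<l. m k j)" if "l \<le> N k" for l
      unfolding m_def
    proof (rule drift[rule_format, where U = "U k"])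
      fix j assume j: "j < N k"
      show "s k (Suc j) - s k j \<le> \<delta>1" using grid(2)[OF j] elim(1) by simp
    next
      fix j assume "j \<le> N k"
      then show "norm (y k j - x (s k j)) \<le> \<delta>1" using elim(1,2) by force
    qed (use grid(1) ye U(2,3) elim(1,3) that in auto)
    have en: "(\<Sum>i\<le>l. (norm (\<eta> k i))\<^sup>2 * (s k (Suc i) - s k i)) \<le> 2 * ((c + d) * (R + 1))\<^sup>2 * T + 2"
      if "l < N k" "\<And>i. i \<le> l \<Longrightarrow> norm (y k i) \<le> R" for l
    proof (rule energy[rule_format, where U = "U k"])
      fix j assume j: "j < N k"
      show "s k (Suc j) - s k j \<le> \<delta>2" using grid(2)[OF j] elim(1) by simp
    next
      fix j assume "j \<le> N k"
      then show "norm (y k j - x (s k j)) \<le> \<delta>2" using elim(1,2) by force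
    qed (use grid(1) U(2,3) elim(1,3) that in auto)
    \<comment> \<open>The alternative \<open>j = N k\<close> makes the minimum exist and encodes
      that no stopping occurs.\<close>
    define l where "l = (LEAST j. j = N k \<or> \<not> G k j)"
    have l: "l = N k \<or> \<not> G k l" unfolding l_def by (rule LeastI[of _ "N k"]) simp
    have lN: "l \<le> N k" unfolding l_def by (rule Least_le) simp
    have Gl: "G k j" if "j < l" for j using not_less_Least[of j] that unfolding l_def by blast
    have Gl': "\<not> G k j" if "l \<le> j" "j < N k" for j
      using l Gmono[of k j l] that by auto
    have "(\<Sum>j<N k. if G k j then m k j else 0) = (\<Sum>j<l. m k j)"
    proof -
      have "(\<Sum>j<N k. if G k j then m k j else 0) = (\<Sum>j<l. if G k j then m k j else 0)"
        by (rule sum.mono_neutral_right) (use lN Gl' in auto)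
      also have "\<dots> = (\<Sum>j<l. m k j)" using Gl by simp
      finally show ?thesis .
    qed
    then have 1: "weight \<epsilon> (s k l) * (norm (y k l))\<^sup>2 \<le> ?S k + \<theta>" using dr[OF lN] by simp
    \<comment> \<open>If the weighted square were still at most \<open>R\<^sup>2\<close> at
      \<open>l\<close>, then \<open>y\<close> would be at most \<open>R\<close> up to
      \<open>l\<close>, since the weight is at least 1. The energy bound would then make
      \<open>G\<close> true at \<open>l\<close>.\<close>
    have 2: "R\<^sup>2 < weight \<epsilon> (s k l) * (norm (y k l))\<^sup>2" if "l < N k"
    proof (rule ccontr)
      assume "\<not> ?thesis"
      then have le: "weight \<epsilon> (s k i) * (norm (y k i))\<^sup>2 \<le> R\<^sup>2" if "i \<le> l" for i
        using Gl[of i] that by (cases "i = l") (auto simp: G_def)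
      have "norm (y k i) \<le> R" if "i \<le> l" for i
      proof -
        have "0 \<le> s k i" using time_grid_range[OF grid(1), of i k] that lN by auto
        then have "1 * (norm (y k i))\<^sup>2 \<le> weight \<epsilon> (s k i) * (norm (y k i))\<^sup>2"
          using weight_ge_1[OF \<epsilon>(1)] by (intro mult_right_mono) auto
        then have "(norm (y k i))\<^sup>2 \<le> R\<^sup>2" using le[OF that] by simp
        then show ?thesis using R by (rule power2_le_imp_le)
      qed
      then have "G k l" unfolding G_def using en[OF \<open>l < N k\<close>] le by blast
      then show False using l \<open>l < N k\<close> by simp
    qed
    show ?case
      by (intro exI[of _ l]) (use lN 1 2 Gl in auto)
  qed
  have w0: "0 \<le> weight \<epsilon> (s k l)" if "l \<le> N k" for k l
    using time_grid_range[OF grid(1), of l k] that by (intro less_imp_le[OF weight_pos]) auto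
  show "eventually (\<lambda>k. - \<theta> \<le> ?S k) sequentially"
    using main
  proof eventually_elim
    case (elim k)
    then obtain l where "l \<le> N k" "weight \<epsilon> (s k l) * (norm (y k l))\<^sup>2 \<le> ?S k + \<theta>" by blast
    moreover have "0 \<le> weight \<epsilon> (s k l) * (norm (y k l))\<^sup>2" using w0[OF \<open>l \<le> N k\<close>] by simp
    ultimately show ?case by linarith
  qed
  show "eventually (\<lambda>k. R\<^sup>2 - \<theta> \<le> ?S k) sequentially"
    if t: "t \<in> {0..T}" "R\<^sup>2 < weight \<epsilon> t * (norm (x t))\<^sup>2"
  proof -
    \<comment> \<open>The left end of the cell containing \<open>t\<close> is taken, so that the
      index stays below \<open>N k\<close> even for \<open>t = T\<close>. These left ends tend to
      \<open>t\<close>, so the weighted square of \<open>y\<close> exceeds the level there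
      eventually.\<close>
    have "\<exists>j<N k. s k j \<le> t \<and> t \<le> s k (Suc j)" for k
    proof -
      have N: "0 < N k" using grid(1)[of k] T by (cases "N k") (auto simp: time_grid_def)
      then have "t \<le> s k (Suc (N k - 1))" "N k - 1 < N k"
        using grid(1)[of k] t(1) by (auto simp: time_grid_def)
      then obtain j where "j \<le> N k - 1" "s k j \<le> t" "t \<le> s k (Suc j)"
        using time_grid_locate[OF grid(1), of "N k - 1" k t] t(1) by auto
      then show ?thesis using N by (intro exI[of _ j]) auto
    qed
    then obtain J where J: "\<And>k. J k < N k" "\<And>k. s k (J k) \<le> t" "\<And>k. t \<le> s k (Suc (J k))" by metis
    have "(\<lambda>k. s k (J k) - t) \<longlonglongrightarrow> 0"
    proof (rule Lim_null_comparison[OF _ half], rule always_eventually, rule allI)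
      fix k show "norm (s k (J k) - t) \<le> (1/2) ^ k"
        using grid(2)[OF J(1), of k] J(2,3)[of k] by simp
    qed
    then have st: "(\<lambda>k. s k (J k)) \<longlonglongrightarrow> t" by (rule LIM_zero_cancel)
    have sT: "s k (J k) \<in> {0..T}" for k
      using time_grid_range[OF grid(1), of "J k" k] J(1)[of k] by simp
    have xs: "(\<lambda>k. x (s k (J k))) \<longlonglongrightarrow> x t"
      using continuous_on_tendsto_compose[OF x st t(1)] sT by simp
    have ws: "(\<lambda>k. weight \<epsilon> (s k (J k))) \<longlonglongrightarrow> weight \<epsilon> t"
      using continuous_on_tendsto_compose[OF continuous_on_weight[of T \<epsilon>] st t(1)] sT by simp
    have "(\<lambda>k. y k (J k) - x (s k (J k))) \<longlonglongrightarrow> 0"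
      by (rule Lim_null_comparison[OF _ half], rule eventually_mono[OF yx]) (use J(1) in \<open>auto intro: less_imp_le\<close>)
    then have "(\<lambda>k. (y k (J k) - x (s k (J k))) + x (s k (J k))) \<longlonglongrightarrow> 0 + x t"
      by (intro tendsto_add xs)
    then have "(\<lambda>k. y k (J k)) \<longlonglongrightarrow> x t" by simp
    then have "(\<lambda>k. weight \<epsilon> (s k (J k)) * (norm (y k (J k)))\<^sup>2) \<longlonglongrightarrow> weight \<epsilon> t * (norm (x t))\<^sup>2"
      by (intro tendsto_intros ws)
    from order_tendstoD(1)[OF this t(2)] main
    show ?thesis
    proof eventually_elim
      case (elim k)
      then obtain l where l: "l \<le> N k" "weight \<epsilon> (s k l) * (norm (y k l))\<^sup>2 \<le> ?S k + \<theta>"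
        "l < N k \<longrightarrow> R\<^sup>2 < weight \<epsilon> (s k l) * (norm (y k l))\<^sup>2" "l = N k \<longrightarrow> (\<forall>j<N k. G k j)" by blast
      have "\<not> G k (J k)" using elim(1) unfolding G_def by force
      then have "l < N k" using l(1,4) J(1)[of k] by (cases "l = N k") auto
      then show ?case using l(2,3) by auto
    qed
  qed
qed

section \<open>Simple integrands on a refining grid\<close>

text \<open>The points of \<open>P\<close> in the interval are merged with a uniform grid and
  sorted. A simple integrand with partition points in \<open>P\<close> is then constant inside each
  cell.\<close>

lemma refined_time_grid:
  assumes T: "0 < T" and \<delta>: "0 < \<delta>" and P: "finite P"
  obtains N s where "time_grid T N s" "\<And>j. j < N \<Longrightarrow> s (Suc j) - s j \<le> \<delta>"
    "\<And>j p. j < N \<Longrightarrow> p \<in> P \<Longrightarrow> \<not> (s j < p \<and> p < s (Suc j))"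
proof -
  obtain m :: nat where m: "T / \<delta> < real m" using reals_Archimedean2 by blast
  have "0 < T / \<delta>" using T \<delta> by simp
  then have m0: "0 < m" using m by (cases m) auto
  have mT: "T / real m \<le> \<delta>" using m m0 \<delta> by (simp add: field_simps)
  define S where "S = P \<inter> {0..T} \<union> {0, T} \<union> (\<lambda>i. T * real i / real m) ` {..m}"
  have fin: "finite S" using P by (simp add: S_def)
  have S01: "0 \<in> S" "T \<in> S" by (simp_all add: S_def)
  have "T * real i / real m \<in> {0..T}" if "i \<le> m" for i
    using T that m0 by (auto simp: field_simps)
  then have Ssub: "S \<subseteq> {0..T}" using T by (auto simp: S_def)
  define xs where "xs = sorted_list_of_set S"
  have xs: "set xs = S" "sorted xs" "distinct xs"
    using fin by (simp_all add: xs_def)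
  have len: "0 < length xs" using xs(1) S01 by auto
  define N where "N = length xs - 1"
  define s where "s = (!) xs"
  have strict: "s i < s j" if "i < j" "j \<le> N" for i j
  proof -
    have ij: "i < length xs" "j < length xs" using that len by (auto simp: N_def)
    have "xs ! i \<le> xs ! j" using sorted_nth_mono[OF xs(2), of i j] that ij by simp
    moreover have "xs ! i \<noteq> xs ! j" using nth_eq_iff_index_eq[OF xs(3) ij] that by simp
    ultimately show ?thesis by (simp add: s_def)
  qed
  have weak: "s i \<le> s j" if "i \<le> j" "j \<le> N" for i j
    using strict[of i j] that by (cases "i = j") auto
  have sS: "s i \<in> S" if "i \<le> N" for i
  proof -
    have "i < length xs" using that len unfolding N_def by linarith
    then show ?thesis using nth_mem[of i xs] xs(1) by (simp add: s_def)
  qed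
  have srange: "0 \<le> s i" "s i \<le> T" if "i \<le> N" for i
    using sS[OF that] Ssub by auto
  have idx: "\<exists>i\<le>N. s i = p" if "p \<in> S" for p
  proof -
    have "p \<in> set xs" using that by (simp only: xs(1))
    then obtain i where i: "i < length xs" "xs ! i = p"
      unfolding in_set_conv_nth by blast
    then have "i \<le> N" unfolding N_def by linarith
    with i show ?thesis by (auto simp: s_def)
  qed
  have no: "\<not> (s j < p \<and> p < s (Suc j))" if "j < N" "p \<in> S" for j p
  proof -
    obtain i where i: "i \<le> N" "s i = p" using idx[OF \<open>p \<in> S\<close>] by blast
    show ?thesis
      using weak[of i j] weak[of "Suc j" i] i that by (cases "i \<le> j") auto
  qed
  show thesis
  proof
    obtain i where "i \<le> N" "s i = 0" using idx[OF S01(1)] by blast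
    then have "s 0 = 0" using weak[of 0 i] srange(1)[of 0] by simp
    obtain k where "k \<le> N" "s k = T" using idx[OF S01(2)] by blast
    then have "s N = T" using weak[of k N] srange(2)[of N] by simp
    with \<open>s 0 = 0\<close> show "time_grid T N s" using strict by (simp add: time_grid_def)
  next
    fix j p assume "j < N" "p \<in> P"
    moreover have "p \<in> S" if "s j < p" "p < s (Suc j)"
      using that \<open>p \<in> P\<close> srange(1)[of j] srange(2)[of "Suc j"] \<open>j < N\<close> by (simp add: S_def)
    ultimately show "\<not> (s j < p \<and> p < s (Suc j))" using no by blast
  next
    fix j assume j: "j < N"
    show "s (Suc j) - s j \<le> \<delta>"
    proof (rule ccontr)
      assume "\<not> ?thesis"
      then have gap: "s j + T / real m < s (Suc j)" using mT by simp
      have r: "0 \<le> s j" "s (Suc j) \<le> T" using srange(1)[of j] srange(2)[of "Suc j"] j by simp_all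
      \<comment> \<open>The number of the first uniform node strictly to the right of
        \<open>s j\<close>. In a gap longer than \<open>T / m\<close> this node would lie strictly
        inside the cell.\<close>
      define i where "i = nat \<lfloor>s j * real m / T\<rfloor> + 1"
      have nn: "0 \<le> s j * real m / T" using r T by simp
      have i1: "s j * real m / T < real i" and i2: "real i \<le> s j * real m / T + 1"
        using nn unfolding i_def by linarith+
      have a: "s j < T * real i / real m" using i1 T m0 by (simp add: field_simps)
      have b: "T * real i / real m \<le> s j + T / real m"
        using i2 T m0 by (simp add: field_simps)
      then have "T * real i / real m < s (Suc j)" using gap by simp
      moreover from this have "T * real i / real m \<le> T" using r by simp
      then have "i \<le> m" using T m0 by (simp add: field_simps)
      then have "T * real i / real m \<in> S" unfolding S_def by blast
      ultimately show False using no[OF j] a by blast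
    qed
  qed
qed

text \<open>The right limit at \<open>t\<close> of the (left-continuous) simple process.\<close>

definition grid_value :: "nat \<Rightarrow> (nat \<Rightarrow> real) \<Rightarrow> (nat \<Rightarrow> 'a \<Rightarrow> real^'m^'d) \<Rightarrow> real \<Rightarrow> 'a \<Rightarrow> real^'m^'d" where
  "grid_value n p \<xi> t \<omega> = (\<Sum>i<n. if p i \<le> t \<and> t < p (Suc i) then \<xi> i \<omega> else 0)"

lemma simple_process_eq_grid_value:
  assumes no: "\<And>i. i \<le> n \<Longrightarrow> \<not> (s < p i \<and> p i < t)" and r: "s < r" "r \<le> t"
  shows "simple_process n p \<xi> r \<omega> = grid_value n p \<xi> s \<omega>"
  unfolding simple_process_def grid_value_def
proof (rule sum.cong)
  fix i assume "i \<in> {..<n}"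
  then have "r \<in> {p i<..p (Suc i)} \<longleftrightarrow> p i \<le> s \<and> s < p (Suc i)"
    using no[of i] no[of "Suc i"] r by auto
  then show "indicator {p i<..p (Suc i)} r *\<^sub>R \<xi> i \<omega> =
      (if p i \<le> s \<and> s < p (Suc i) then \<xi> i \<omega> else 0)"
    by (simp add: indicator_def)
qed simp

lemma matrix_vector_mult_sum_left:
  fixes A :: "'i \<Rightarrow> real^'m^'d"
  shows "(\<Sum>i\<in>I. A i) *v z = (\<Sum>i\<in>I. A i *v z)"
  by (induction I rule: infinite_finite_induct) (simp_all add: matrix_vector_mult_add_rdistrib)

text \<open>No partition point lies inside a cell, so when the time crosses a cell each summand of
  the elementary integral gains either the full increment of \<open>B\<close> or nothing.\<close>

lemma simple_ito_integral_eq_grid_sum: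
  assumes grid: "time_grid T N s" and no: "\<And>j i. j < N \<Longrightarrow> i \<le> n \<Longrightarrow> \<not> (s j < p i \<and> p i < s (Suc j))"
    and p: "\<And>i. i \<le> n \<Longrightarrow> 0 \<le> p i" "\<And>i. i < n \<Longrightarrow> p i < p (Suc i)" and l: "l \<le> N"
  shows "simple_ito_integral B n p \<xi> (s l) \<omega> =
    (\<Sum>j<l. grid_value n p \<xi> (s j) \<omega> *v (B (s (Suc j)) \<omega> - B (s j) \<omega>))"
  using l
proof (induction l)
  case 0
  have "simple_ito_integral B n p \<xi> 0 \<omega> = 0"
    using p(1) unfolding simple_ito_integral_def
    by (intro sum.neutral ballI) (simp add: min_absorb2)
  then show ?case using grid by (simp add: time_grid_def)
next
  case (Suc l)
  have ss: "s l < s (Suc l)" using grid Suc by (simp add: time_grid_def)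
  let ?D = "B (s (Suc l)) \<omega> - B (s l) \<omega>"
  have "simple_ito_integral B n p \<xi> (s (Suc l)) \<omega> = (\<Sum>i<n. \<xi> i \<omega> *v (B (min (p (Suc i)) (s l)) \<omega>
     - B (min (p i) (s l)) \<omega>) + (if p i \<le> s l \<and> s l < p (Suc i) then \<xi> i \<omega> else 0) *v ?D)"
    unfolding simple_ito_integral_def
  proof (rule sum.cong)
    fix i assume i: "i \<in> {..<n}"
    have "\<not> (s l < p i \<and> p i < s (Suc l))" "\<not> (s l < p (Suc i) \<and> p (Suc i) < s (Suc l))" "p i < p (Suc i)"
      using no[of l i] no[of l "Suc i"] p(2)[of i] i Suc by auto
    \<comment> \<open>The cell lies before, inside or after the \<open>i\<close>-th partition
      interval; the fourth combination contradicts \<open>p i < p (Suc i)\<close>.\<close>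
    then consider "s (Suc l) \<le> p i" "s (Suc l) \<le> p (Suc i)" | "p i \<le> s l" "s (Suc l) \<le> p (Suc i)"
      | "p i \<le> s l" "p (Suc i) \<le> s l"
      by linarith
    then show "\<xi> i \<omega> *v (B (min (p (Suc i)) (s (Suc l))) \<omega> - B (min (p i) (s (Suc l))) \<omega>) =
       \<xi> i \<omega> *v (B (min (p (Suc i)) (s l)) \<omega> - B (min (p i) (s l)) \<omega>)
       + (if p i \<le> s l \<and> s l < p (Suc i) then \<xi> i \<omega> else 0) *v ?D"
      using ss \<open>p i < p (Suc i)\<close>
      by cases (auto simp: min_def matrix_vector_right_distrib[symmetric])
  qed simp
  also have "\<dots> = simple_ito_integral B n p \<xi> (s l) \<omega> + grid_value n p \<xi> (s l) \<omega> *v ?D"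
    by (simp add: simple_ito_integral_def grid_value_def sum.distrib matrix_vector_mult_sum_left)
  finally show ?case using Suc by simp
qed

lemma simple_integrand_times:
  assumes "simple_integrand M F n p \<xi>" "i \<le> n"
  shows "0 \<le> p i"
  using assms(2)
proof (induction i)
  case (Suc i)
  then have "0 \<le> p i" "p i < p (Suc i)"
    using assms(1) by (simp_all add: simple_integrand_def)
  then show ?case by simp
qed (use assms(1) in \<open>simp add: simple_integrand_def\<close>)

lemma grid_value_bounded:
  assumes "simple_integrand M F n p \<xi>"
  shows "\<exists>K. \<forall>\<omega>\<in>space M. norm (grid_value n p \<xi> t \<omega>) \<le> K"
proof -
  have "\<forall>i. \<exists>K. i < n \<longrightarrow> (\<forall>\<omega>\<in>space M. norm (\<xi> i \<omega>) \<le> K)"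
    using assms by (auto simp: simple_integrand_def)
  then obtain K where K: "\<And>i \<omega>. i < n \<Longrightarrow> \<omega> \<in> space M \<Longrightarrow> norm (\<xi> i \<omega>) \<le> K i"
    by metis
  have "norm (grid_value n p \<xi> t \<omega>) \<le> (\<Sum>i<n. K i)" if "\<omega> \<in> space M" for \<omega>
    unfolding grid_value_def
  proof (rule sum_norm_le)
    fix i assume "i \<in> {..<n}"
    then have "norm (\<xi> i \<omega>) \<le> K i" using K that by simp
    then show "norm (if p i \<le> t \<and> t < p (Suc i) then \<xi> i \<omega> else 0) \<le> K i"
      using order.trans[OF norm_ge_zero] by auto
  qed
  then show ?thesis by blast
qed

context brownian_space
begin

text \<open>The value \<open>\<xi> i\<close> is used at \<open>t\<close> only if
  \<open>p i \<le> t\<close>, and is then already known: taking right limits does not look into the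
  future.\<close>

lemma grid_value_measurable:
  assumes "simple_integrand M F n p \<xi>"
  shows "grid_value n p \<xi> t \<in> borel_measurable (F t)"
  unfolding grid_value_def[abs_def]
proof (rule borel_measurable_sum)
  fix i assume i: "i \<in> {..<n}"
  show "(\<lambda>\<omega>. if p i \<le> t \<and> t < p (Suc i) then \<xi> i \<omega> else 0) \<in> borel_measurable (F t)"
  proof (cases "p i \<le> t \<and> t < p (Suc i)")
    case True
    have "\<xi> i \<in> borel_measurable (F (p i))"
      using assms i unfolding simple_integrand_def by blast
    then have "\<xi> i \<in> borel_measurable (F t)"
      by (rule measurable_F_mono) (use True simple_integrand_times[OF assms, of i] i in auto)
    then show ?thesis unfolding if_P[OF True] .
  next
    case False
    show ?thesis unfolding if_not_P[OF False] by simp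
  qed
qed

end

section \<open>Pathwise approximation of the Ito integral\<close>

text \<open>A strict exceedance by a continuous path persists on a neighbourhood and is seen at a
  rational time. This turns suprema over an interval into countable unions of events.\<close>

lemma continuous_rational_witness:
  fixes h :: "real \<Rightarrow> real"
  assumes "0 < T" "continuous_on {0..T} h" "t \<in> {0..T}" "c < h t"
  shows "\<exists>r\<in>\<rat> \<inter> {0..T}. c < h r"
proof -
  obtain d where d: "d > 0" "\<And>r. r \<in> {0..T} \<Longrightarrow> dist r t < d \<Longrightarrow> dist (h r) (h t) < h t - c"
    using assms unfolding continuous_on_iff by (metis diff_gt_0_iff_gt)
  have "max 0 (t - d) < min T (t + d)" using assms d(1) by auto
  then obtain r where r: "r \<in> \<rat>" "max 0 (t - d) < r" "r < min T (t + d)"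
    using Rats_dense_in_real by blast
  then have "r \<in> {0..T}" "dist r t < d" by (auto simp: dist_real_def)
  with d(2) have "dist (h r) (h t) < h t - c" by blast
  then have "c < h r" by (auto simp: dist_real_def)
  with r(1) \<open>r \<in> {0..T}\<close> show ?thesis by blast
qed

text \<open>Connects the nonnegative Lebesgue integrals in \<open>has_ito_integral\<close> with the
  gauge integrals of the pathwise lemmas.\<close>

lemma set_nn_integral_bound_imp_integral_bound:
  fixes U :: "real \<Rightarrow> real"
  assumes m: "(\<lambda>s. indicator {0..T} s *\<^sub>R U s) \<in> borel_measurable borel"
    and U: "\<And>s. s \<in> {0..T} \<Longrightarrow> 0 \<le> U s" and e: "0 \<le> e"
    and le: "(\<integral>\<^sup>+s\<in>{0..T}. ennreal (U s) \<partial>lborel) \<le> ennreal e"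
  shows "U integrable_on {0..T}" "integral {0..T} U \<le> e"
proof -
  have eq: "(\<integral>\<^sup>+s. ennreal (indicator {0..T} s *\<^sub>R U s) \<partial>lborel) = (\<integral>\<^sup>+s\<in>{0..T}. ennreal (U s) \<partial>lborel)"
    by (intro nn_integral_cong) (simp split: split_indicator)
  have nn: "0 \<le> indicator {0..T} s *\<^sub>R U s" for s using U by (simp split: split_indicator)
  have si: "set_integrable lborel {0..T} U"
    unfolding set_integrable_def
  proof (rule integrableI_nonneg)
    show "(\<lambda>s. indicator {0..T} s *\<^sub>R U s) \<in> borel_measurable lborel" using m by simp
    show "(\<integral>\<^sup>+s. ennreal (indicator {0..T} s *\<^sub>R U s) \<partial>lborel) < \<infinity>"
      unfolding eq using le by (simp add: le_less_trans)
  qed (use nn in simp)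
  show "U integrable_on {0..T}"
    by (rule set_borel_integral_eq_integral(1)[OF si])
  have "ennreal (LINT s:{0..T}|lborel. U s) = (\<integral>\<^sup>+s. ennreal (indicator {0..T} s *\<^sub>R U s) \<partial>lborel)"
    unfolding set_lebesgue_integral_def
    by (rule nn_integral_eq_integral[symmetric]) (use si nn in \<open>auto simp: set_integrable_def\<close>)
  then have "ennreal (LINT s:{0..T}|lborel. U s) \<le> ennreal e" using eq le by simp
  then have "(LINT s:{0..T}|lborel. U s) \<le> e" using e by (simp add: ennreal_le_iff)
  then show "integral {0..T} U \<le> e"
    using set_borel_integral_eq_integral(2)[OF si] by simp
qed

text \<open>Clamping the time at 0 extends a process jointly measurable on the half-line to the
  whole line without changing it at nonnegative times.\<close>

lemma measurable_process_max:
  assumes "measurable_process M X"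
  shows "(\<lambda>(s, \<omega>). X (max s 0) \<omega>) \<in> borel_measurable (borel \<Otimes>\<^sub>M M)"
proof -
  have "(\<lambda>z. (max (fst z) 0, snd z)) \<in> borel \<Otimes>\<^sub>M M \<rightarrow>\<^sub>M restrict_space borel {0::real..} \<Otimes>\<^sub>M M"
    by (intro measurable_Pair measurable_restrict_space2) auto
  from measurable_compose[OF this assms[unfolded measurable_process_def]]
  show ?thesis by (simp add: case_prod_unfold)
qed

context brownian_space
begin

lemma simple_integrand_measurable:
  assumes "simple_integrand M F n p \<xi>" "i < n"
  shows "\<xi> i \<in> borel_measurable M"
proof (rule measurable_F_M)
  show "\<xi> i \<in> borel_measurable (F (p i))"
    using assms unfolding simple_integrand_def by blast
  show "0 \<le> p i"
    by (rule simple_integrand_times[OF assms(1)]) (use assms in simp)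
qed

lemma simple_deviation_measurable:
  assumes \<xi>: "simple_integrand M F n p \<xi>" and H: "measurable_process M H"
  shows "(\<lambda>(s, \<omega>). indicator {0..T} s *\<^sub>R (norm (simple_process n p \<xi> s \<omega> - H s \<omega>))\<^sup>2)
    \<in> borel_measurable (borel \<Otimes>\<^sub>M M)"
proof -
  note measurable_process_max[OF H, measurable]
  have [measurable]: "(\<lambda>(s, \<omega>). simple_process n p \<xi> s \<omega>) \<in> borel_measurable (borel \<Otimes>\<^sub>M M)"
    unfolding simple_process_def case_prod_unfold
  proof (rule borel_measurable_sum)
    fix i assume "i \<in> {..<n}"
    then have [measurable]: "\<xi> i \<in> borel_measurable M"
      using simple_integrand_measurable[OF \<xi>] by simp
    show "(\<lambda>x. indicator {p i<..p (Suc i)} (fst x) *\<^sub>R \<xi> i (snd x)) \<in> borel_measurable (borel \<Otimes>\<^sub>M M)"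
      by measurable
  qed
  have "(\<lambda>(s, \<omega>). indicator {0..T} s *\<^sub>R (norm (simple_process n p \<xi> s \<omega> - H (max s 0) \<omega>))\<^sup>2)
    \<in> borel_measurable (borel \<Otimes>\<^sub>M M)"
    by measurable
  moreover have "(\<lambda>(s, \<omega>). indicator {0..T} s *\<^sub>R (norm (simple_process n p \<xi> s \<omega> - H (max s 0) \<omega>))\<^sup>2)
     = (\<lambda>(s, \<omega>). indicator {0..T} s *\<^sub>R (norm (simple_process n p \<xi> s \<omega> - H s \<omega>))\<^sup>2)"
    by (auto simp: fun_eq_iff split: split_indicator)
  ultimately show ?thesis by (simp only:)
qed

lemma B_continuous: "AE \<omega> in M. continuous_on {0..} (\<lambda>t. B t \<omega>)"
  using brownian unfolding brownian_motion_def continuous_process_def by blast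

lemma simple_ito_integral_measurable:
  assumes "simple_integrand M F n p \<xi>" "0 \<le> t"
  shows "simple_ito_integral B n p \<xi> t \<in> borel_measurable M"
  unfolding simple_ito_integral_def[abs_def]
proof (rule borel_measurable_sum)
  fix i assume i: "i \<in> {..<n}"
  have [measurable]: "\<xi> i \<in> borel_measurable M"
    "B (min (p (Suc i)) t) \<in> borel_measurable M" "B (min (p i) t) \<in> borel_measurable M"
    using simple_integrand_measurable[OF assms(1), of i] simple_integrand_times[OF assms(1)] i assms(2)
    by (auto intro!: B_measurable)
  note borel_measurable_matrix_vector_mult[measurable]
  show "(\<lambda>\<omega>. \<xi> i \<omega> *v (B (min (p (Suc i)) t) \<omega> - B (min (p i) t) \<omega>)) \<in> borel_measurable M"
    by measurable
qed

lemma simple_ito_integral_continuous: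
  assumes \<xi>: "simple_integrand M F n p \<xi>" and B: "continuous_on {0..} (\<lambda>t. B t \<omega>)"
  shows "continuous_on {0..} (\<lambda>t. simple_ito_integral B n p \<xi> t \<omega>)"
  unfolding simple_ito_integral_def
proof (rule continuous_on_sum)
  fix i assume i: "i \<in> {..<n}"
  have p: "0 \<le> p i" "0 \<le> p (Suc i)" using simple_integrand_times[OF \<xi>] i by auto
  have 1: "continuous_on {0..} (\<lambda>t. B (min c t) \<omega>)" if "0 \<le> c" for c
    by (rule continuous_on_compose2[OF B]) (use that in \<open>auto intro!: continuous_intros\<close>)
  show "continuous_on {0..} (\<lambda>t. \<xi> i \<omega> *v (B (min (p (Suc i)) t) \<omega> - B (min (p i) t) \<omega>))"
    using 1[OF p(1)] 1[OF p(2)]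
    by (intro linear_continuous_on_compose[OF continuous_on_diff]) (auto simp: matrix_vector_mul_linear)
qed

text \<open>Without this the convergence required by \<open>has_ito_integral\<close> could hold vacuously, as
  \<open>measure\<close> is \<open>0\<close> on sets that are not measurable.\<close>

lemma ito_deviation_measurable:
  assumes M: "complete_measure M" and \<xi>: "simple_integrand M F n p \<xi>" and T: "0 < T"
    and I: "adapted F I" "continuous_process M I"
  shows "{\<omega> \<in> space M. \<exists>t\<in>{0..T}. e < norm (simple_ito_integral B n p \<xi> t \<omega> - I t \<omega>)} \<in> sets M"
    (is "{\<omega> \<in> space M. \<exists>t\<in>{0..T}. e < ?h t \<omega>} \<in> sets M")
proof -
  let ?Q = "{\<omega> \<in> space M. \<exists>t\<in>\<rat> \<inter> {0..T}. e < ?h t \<omega>}"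
  have "(\<lambda>\<omega>. ?h t \<omega>) \<in> borel_measurable M" if "t \<in> {0..T}" for t
  proof -
    have [measurable]: "I t \<in> borel_measurable M"
      using I(1) that measurable_F_M[of "I t" t] by (simp add: adapted_def)
    have [measurable]: "simple_ito_integral B n p \<xi> t \<in> borel_measurable M"
      using simple_ito_integral_measurable[OF \<xi>] that by simp
    show ?thesis by measurable
  qed
  then have "{\<omega> \<in> space M. e < ?h t \<omega>} \<in> sets M" if "t \<in> {0..T}" for t
    using that by (intro borel_measurable_less) auto
  moreover have "countable (\<rat> \<inter> {0..T})"
    using countable_rat by (rule countable_subset[rotated]) auto
  ultimately have "(\<Union>t\<in>\<rat> \<inter> {0..T}. {\<omega> \<in> space M. e < ?h t \<omega>}) \<in> sets M"
    by (intro sets.countable_UN') auto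
  also have "(\<Union>t\<in>\<rat> \<inter> {0..T}. {\<omega> \<in> space M. e < ?h t \<omega>}) = ?Q"
    by auto
  finally have Q: "?Q \<in> sets M" .
  \<comment> \<open>On continuous paths the event over all times equals the one over rational times;
    completeness transfers measurability across the null set.\<close>
  have ae: "AE \<omega> in M. \<omega> \<in> ?Q \<longleftrightarrow> \<omega> \<in> {\<omega> \<in> space M. \<exists>t\<in>{0..T}. e < ?h t \<omega>}"
    using B_continuous I(2)[unfolded continuous_process_def]
  proof eventually_elim
    case (elim \<omega>)
    have "continuous_on {0..} (\<lambda>t. ?h t \<omega>)"
      by (intro continuous_intros simple_ito_integral_continuous[OF \<xi>] elim)
    then have c: "continuous_on {0..T} (\<lambda>t. ?h t \<omega>)"
      by (rule continuous_on_subset) auto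
    show ?case
      using continuous_rational_witness[OF T c, of _ e] by blast
  qed
  show ?thesis
    by (rule complete_measure.in_sets_AE[OF M ae Q]) auto
qed

text \<open>Convergence in probability is upgraded to almost sure rates by selecting terms whose
  deviation probabilities are summable and applying the Borel-Cantelli lemma.\<close>

lemma ito_integral_approximation:
  assumes M: "complete_measure M" and I: "has_ito_integral M F B H I" and T: "0 < T"
  obtains n p \<xi> where "\<forall>k. simple_integrand M F (n k) (p k) (\<xi> k)"
    and "AE \<omega> in M. eventually (\<lambda>k.
      (\<lambda>s. (norm (simple_process (n k) (p k) (\<xi> k) s \<omega> - H s \<omega>))\<^sup>2) integrable_on {0..T} \<and>
      integral {0..T} (\<lambda>s. (norm (simple_process (n k) (p k) (\<xi> k) s \<omega> - H s \<omega>))\<^sup>2) \<le> (1/2) ^ k \<and>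
      (\<forall>t\<in>{0..T}. norm (simple_ito_integral B (n k) (p k) (\<xi> k) t \<omega> - I t \<omega>) \<le> (1/2) ^ k)) sequentially"
proof -
  have H: "measurable_process M H" and Ia: "adapted F I" "continuous_process M I"
    using I unfolding has_ito_integral_def by blast+
  obtain n p \<xi> where \<xi>: "\<And>k. simple_integrand M F (n k) (p k) (\<xi> k)"
    and lim1: "\<And>T e. 0 \<le> T \<Longrightarrow> 0 < e \<Longrightarrow> (\<lambda>k. measure M {\<omega> \<in> space M. ennreal e < (\<integral>\<^sup>+s\<in>{0..T}.
      ennreal ((norm (simple_process (n k) (p k) (\<xi> k) s \<omega> - H s \<omega>))\<^sup>2) \<partial>lborel)}) \<longlonglongrightarrow> 0"
    and lim2: "\<And>T e. 0 \<le> T \<Longrightarrow> 0 < e \<Longrightarrow> (\<lambda>k. measure M {\<omega> \<in> space M. \<exists>t\<in>{0..T}.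
      e < norm (simple_ito_integral B (n k) (p k) (\<xi> k) t \<omega> - I t \<omega>)}) \<longlonglongrightarrow> 0"
    using I unfolding has_ito_integral_def by blast
  let ?U = "\<lambda>k s \<omega>. (norm (simple_process (n k) (p k) (\<xi> k) s \<omega> - H s \<omega>))\<^sup>2"
  let ?A = "\<lambda>k e. {\<omega> \<in> space M. ennreal e < (\<integral>\<^sup>+s\<in>{0..T}. ennreal (?U k s \<omega>) \<partial>lborel)}"
  let ?B = "\<lambda>k e. {\<omega> \<in> space M. \<exists>t\<in>{0..T}. e < norm (simple_ito_integral B (n k) (p k) (\<xi> k) t \<omega> - I t \<omega>)}"
  have Am: "?A k e \<in> sets M" for k e
  proof -
    have [measurable]: "(\<lambda>(s, \<omega>). indicator {0..T} s *\<^sub>R ?U k s \<omega>) \<in> borel_measurable (borel \<Otimes>\<^sub>M M)"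
      by (rule simple_deviation_measurable[OF \<xi> H])
    have "(\<lambda>\<omega>. \<integral>\<^sup>+s. ennreal (indicator {0..T} s *\<^sub>R ?U k s \<omega>) \<partial>lborel) \<in> borel_measurable M"
      by measurable
    moreover have "(\<integral>\<^sup>+s. ennreal (indicator {0..T} s *\<^sub>R ?U k s \<omega>) \<partial>lborel) =
        (\<integral>\<^sup>+s\<in>{0..T}. ennreal (?U k s \<omega>) \<partial>lborel)" for \<omega>
      by (intro nn_integral_cong) (simp split: split_indicator)
    ultimately show ?thesis by simp
  qed
  have Bm: "?B k e \<in> sets M" for k e
    by (rule ito_deviation_measurable[OF M \<xi> T Ia])
  have ex: "\<forall>i. \<exists>k. measure M (?A k ((1/2) ^ i)) < (1/2) ^ i \<and> measure M (?B k ((1/2) ^ i)) < (1/2) ^ i"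
  proof
    fix i :: nat
    have "eventually (\<lambda>k. measure M (?A k ((1/2) ^ i)) < (1/2) ^ i) sequentially"
      by (rule order_tendstoD(2)[OF lim1]) (use T in auto)
    moreover have "eventually (\<lambda>k. measure M (?B k ((1/2) ^ i)) < (1/2) ^ i) sequentially"
      by (rule order_tendstoD(2)[OF lim2]) (use T in auto)
    ultimately have "eventually (\<lambda>k. measure M (?A k ((1/2) ^ i)) < (1/2) ^ i \<and>
        measure M (?B k ((1/2) ^ i)) < (1/2) ^ i) sequentially"
      by eventually_elim simp
    then show "\<exists>k. measure M (?A k ((1/2) ^ i)) < (1/2) ^ i \<and> measure M (?B k ((1/2) ^ i)) < (1/2) ^ i"
      by (rule eventually_happens'[OF sequentially_bot])
  qed
  from choice[OF ex] obtain \<kappa> where \<kappa>: "\<forall>i. measure M (?A (\<kappa> i) ((1/2) ^ i)) < (1/2) ^ i \<and>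
      measure M (?B (\<kappa> i) ((1/2) ^ i)) < (1/2) ^ i"
    by (rule exE)
  let ?C = "\<lambda>i. ?A (\<kappa> i) ((1/2) ^ i) \<union> ?B (\<kappa> i) ((1/2) ^ i)"
  have Cm: "?C i \<in> sets M" for i using Am Bm by blast
  have "AE \<omega> in M. eventually (\<lambda>i. \<omega> \<in> space M - ?C i) sequentially"
  proof (rule borel_cantelli_AE1[OF Cm])
    show "emeasure M (?C i) < \<infinity>" for i by (simp add: emeasure_eq_measure)
    show "summable (\<lambda>i. measure M (?C i))"
    proof (rule summable_comparison_test')
      show "summable (\<lambda>i. 2 * (1/2) ^ i :: real)" by (intro summable_mult summable_geometric) simp
      show "norm (measure M (?C i)) \<le> 2 * (1/2) ^ i" for i
        using measure_Un_le[OF Am[of "(1/2) ^ i" "\<kappa> i"] Bm[of "(1/2) ^ i" "\<kappa> i"]] \<kappa>[rule_format, of i]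
        by (simp only: real_norm_def abs_of_nonneg measure_nonneg) linarith
    qed
  qed
  then have "AE \<omega> in M. eventually (\<lambda>k. (\<lambda>s. ?U (\<kappa> k) s \<omega>) integrable_on {0..T} \<and>
      integral {0..T} (\<lambda>s. ?U (\<kappa> k) s \<omega>) \<le> (1/2) ^ k \<and>
      (\<forall>t\<in>{0..T}. norm (simple_ito_integral B (n (\<kappa> k)) (p (\<kappa> k)) (\<xi> (\<kappa> k)) t \<omega> - I t \<omega>) \<le> (1/2) ^ k)) sequentially"
    using AE_space
  proof eventually_elim
    case (elim \<omega>)
    from elim(1) show ?case
    proof eventually_elim
      case (elim k)
      have "(\<lambda>s. (s, \<omega>)) \<in> borel \<rightarrow>\<^sub>M borel \<Otimes>\<^sub>M M"
        using \<open>\<omega> \<in> space M\<close> by measurable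
      from measurable_compose[OF this simple_deviation_measurable[OF \<xi> H]]
      have m: "(\<lambda>s. indicator {0..T} s *\<^sub>R ?U (\<kappa> k) s \<omega>) \<in> borel_measurable borel" by simp
      have "(\<integral>\<^sup>+s\<in>{0..T}. ennreal (?U (\<kappa> k) s \<omega>) \<partial>lborel) \<le> ennreal ((1/2) ^ k)"
        using elim by (auto simp: not_less)
      from set_nn_integral_bound_imp_integral_bound[OF m _ _ this]
      show ?case using elim by (auto simp: not_less)
    qed
  qed
  then show thesis
    by (intro that[of "\<lambda>k. n (\<kappa> k)" "\<lambda>k. p (\<kappa> k)" "\<lambda>k. \<xi> (\<kappa> k)"]) (simp_all add: \<xi>)
qed

end

section \<open>The maximal inequality\<close>

text \<open>The row product arises from \<open>y \<bullet> (A *v D) = (y v* A) \<bullet> D\<close>,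
  which exhibits the linear martingale term as a coefficient paired with the increment. The bound
  follows from that for \<open>*v\<close> by duality.\<close>

lemma norm_vector_matrix_mult_le:
  fixes A :: "real^'m^'d" and y :: "real^'d"
  shows "norm (y v* A) \<le> norm y * norm A"
proof (cases "y v* A = 0")
  case False
  have "norm (y v* A) * norm (y v* A) = (y v* A) \<bullet> (y v* A)"
    by (simp add: dot_square_norm power2_eq_square)
  also have "\<dots> = y \<bullet> (A *v (y v* A))" by (rule dot_lmul_matrix)
  also have "\<dots> \<le> norm y * norm (A *v (y v* A))" by (rule norm_cauchy_schwarz)
  also have "\<dots> \<le> norm y * (norm A * norm (y v* A))"
    by (intro mult_left_mono norm_matrix_vector_mult_le) simp
  finally show ?thesis using False by (simp add: mult.assoc[symmetric])
qed simp

lemma borel_measurable_vector_matrix_mult: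
  fixes A :: "'a \<Rightarrow> real^'m^'d" and y :: "'a \<Rightarrow> real^'d"
  assumes [measurable]: "y \<in> borel_measurable M" "A \<in> borel_measurable M"
  shows "(\<lambda>\<omega>. y \<omega> v* A \<omega>) \<in> borel_measurable M"
  by (rule borel_measurable_vec_lambda) (simp add: vector_matrix_mult_def)

text \<open>At the last index where \<open>P\<close> holds, all terms so far, selected or not, sum
  to at most \<open>C\<close>; later ones contribute nothing.\<close>

lemma sum_while_bounded:
  fixes a :: "nat \<Rightarrow> real"
  assumes "0 \<le> C" "\<And>j. j < N \<Longrightarrow> 0 \<le> a j" "\<And>j. j < N \<Longrightarrow> P j \<Longrightarrow> (\<Sum>i\<le>j. a i) \<le> C"
  shows "(\<Sum>j<N. if P j then a j else 0) \<le> C"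
  using assms(2,3)
proof (induction N)
  case (Suc N)
  show ?case
  proof (cases "P N")
    case True
    have "(\<Sum>j<N. if P j then a j else 0) \<le> (\<Sum>j<N. a j)"
      using Suc.prems(1) by (intro sum_mono) simp
    then have "(\<Sum>j<Suc N. if P j then a j else 0) \<le> (\<Sum>j\<le>N. a j)"
      using True by (simp add: lessThan_Suc_atMost[symmetric])
    also have "\<dots> \<le> C" using Suc.prems(2)[of N] True by simp
    finally show ?thesis .
  next
    case False
    then show ?thesis using Suc by simp
  qed
qed (use assms(1) in simp)

context brownian_space
begin

text \<open>\<open>G j\<close> is decided at time \<open>s j\<close>, as \<open>y j\<close> and
  \<open>\<eta> j\<close> are, so stopping only multiplies the coefficients by an indicator. With
  \<open>a j\<close> the energy \<open>|\<eta> j|\<^sup>2 * (s (Suc j) - s j)\<close>, the stopped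
  one-step bounds are linear in \<open>a j\<close>, and the selected \<open>a j\<close> sum to at
  most \<open>C\<close>. The resulting second moment bound is independent of the grid.\<close>

lemma stopped_square_martingale:
  fixes s :: "nat \<Rightarrow> real" and y :: "nat \<Rightarrow> 'a \<Rightarrow> real^'d" and \<eta> :: "nat \<Rightarrow> 'a \<Rightarrow> real^'m^'d"
  assumes grid: "time_grid T N s" and \<epsilon>: "0 \<le> \<epsilon>" and R: "0 \<le> R" and C: "0 \<le> C"
    and y: "\<And>j. j \<le> N \<Longrightarrow> y j \<in> borel_measurable (F (s j))"
    and \<eta>: "\<And>j. j < N \<Longrightarrow> \<eta> j \<in> borel_measurable (F (s j))"
      "\<And>j. j < N \<Longrightarrow> \<exists>K. \<forall>\<omega>\<in>space M. norm (\<eta> j \<omega>) \<le> K"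
  defines "e \<equiv> \<lambda>j \<omega>. \<eta> j \<omega> *v (B (s (Suc j)) \<omega> - B (s j) \<omega>)"
  defines "G \<equiv> \<lambda>j \<omega>. (\<forall>i\<le>j. weight \<epsilon> (s i) * (norm (y i \<omega>))\<^sup>2 \<le> R\<^sup>2) \<and>
      (\<Sum>i\<le>j. (norm (\<eta> i \<omega>))\<^sup>2 * (s (Suc i) - s i)) \<le> C"
    and "m \<equiv> \<lambda>j \<omega>. weight \<epsilon> (s j) *
      (2 * (y j \<omega> \<bullet> e j \<omega>) + (norm (e j \<omega>))\<^sup>2 - (norm (\<eta> j \<omega>))\<^sup>2 * (s (Suc j) - s j))"
    and "k0 \<equiv> 4 * (3 * (real CARD('m))\<^sup>2 + 1)"
  shows "has_bochner_integral M (\<lambda>\<omega>. \<Sum>j<N. if G j \<omega> then m j \<omega> else 0) 0"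
    and "integrable M (\<lambda>\<omega>. (\<Sum>j<N. if G j \<omega> then m j \<omega> else 0)\<^sup>2)"
    and "expectation (\<lambda>\<omega>. (\<Sum>j<N. if G j \<omega> then m j \<omega> else 0)\<^sup>2) \<le>
      k0 * (4 * weight \<epsilon> T * R\<^sup>2 + (weight \<epsilon> T)\<^sup>2 * C) * C"
proof -
  let ?W = "weight \<epsilon> T" and ?\<Delta> = "\<lambda>j. s (Suc j) - s j"
  define D where "D j \<omega> = B (s (Suc j)) \<omega> - B (s j) \<omega>" for j \<omega>
  define g where "g j \<omega> = (if G j \<omega> then 1 else 0 :: real)" for j \<omega>
  \<comment> \<open>The weight enters \<open>u\<close> linearly but \<open>v\<close> through its
    square root, because \<open>v\<close> appears squared in
    \<open>discrete_martingale\<close>.\<close>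
  define u where "u j \<omega> = (2 * weight \<epsilon> (s j) * g j \<omega>) *\<^sub>R (y j \<omega> v* \<eta> j \<omega>)" for j \<omega>
  define v where "v j \<omega> = (sqrt (weight \<epsilon> (s j)) * g j \<omega>) *\<^sub>R \<eta> j \<omega>" for j \<omega>
  have s0: "0 \<le> s j" and sT: "s j \<le> T" if "j \<le> N" for j
    using time_grid_range[OF grid that] by auto
  have ss: "s j < s (Suc j)" if "j < N" for j
    using grid that by (simp add: time_grid_def)
  have w1: "1 \<le> weight \<epsilon> (s j)" and wW: "weight \<epsilon> (s j) \<le> ?W" if "j \<le> N" for j
    using weight_ge_1[OF \<epsilon> s0[OF that]] weight_mono[OF \<epsilon> s0[OF that] sT[OF that]] by auto
  have W: "0 \<le> ?W" using w1[of N] wW[of N] by simp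
  have k0: "0 \<le> k0" by (simp add: k0_def)
  have gm: "g j \<in> borel_measurable (F (s j))" if j: "j < N" for j
  proof -
    have mono: "X \<in> borel_measurable (F (s j))" if "X \<in> borel_measurable (F (s i))" "i \<le> j" for X :: "'a \<Rightarrow> 'b::topological_space" and i
      by (rule measurable_F_mono[OF that(1)]) (use that(2) j s0[of i] time_grid_mono[OF grid that(2)] in auto)
    have [measurable]: "y i \<in> borel_measurable (F (s j))" if "i \<le> j" for i
      using mono[OF y[of i] that] that j by simp
    have [measurable]: "\<eta> i \<in> borel_measurable (F (s j))" if "i \<le> j" for i
      using mono[OF \<eta>(1)[of i] that] that j by simp
    have "Measurable.pred (F (s j)) (\<lambda>\<omega>. \<forall>i\<in>{..j}. weight \<epsilon> (s i) * (norm (y i \<omega>))\<^sup>2 \<le> R\<^sup>2)"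
      by (rule pred_intros_finite) measurable
    moreover have "(\<lambda>\<omega>. \<Sum>i\<le>j. (norm (\<eta> i \<omega>))\<^sup>2 * ?\<Delta> i) \<in> borel_measurable (F (s j))"
      by (rule borel_measurable_sum) measurable
    then have "Measurable.pred (F (s j)) (\<lambda>\<omega>. (\<Sum>i\<le>j. (norm (\<eta> i \<omega>))\<^sup>2 * ?\<Delta> i) \<le> C)"
      by measurable
    ultimately have "Measurable.pred (F (s j)) (\<lambda>\<omega>. (\<forall>i\<in>{..j}. weight \<epsilon> (s i) * (norm (y i \<omega>))\<^sup>2 \<le> R\<^sup>2) \<and>
        (\<Sum>i\<le>j. (norm (\<eta> i \<omega>))\<^sup>2 * ?\<Delta> i) \<le> C)"
      by (rule pred_intros_logic)
    then have [measurable]: "Measurable.pred (F (s j)) (G j)"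
      unfolding G_def Ball_def atMost_iff .
    show ?thesis unfolding g_def[abs_def] by measurable
  qed
  note borel_measurable_vector_matrix_mult[measurable] borel_measurable_matrix_vector_mult[measurable]
  have um: "u j \<in> borel_measurable (F (s j))" and vm: "v j \<in> borel_measurable (F (s j))" if j: "j < N" for j
  proof -
    have [measurable]: "g j \<in> borel_measurable (F (s j))" "y j \<in> borel_measurable (F (s j))"
      "\<eta> j \<in> borel_measurable (F (s j))"
      using gm y \<eta>(1) j by auto
    show "u j \<in> borel_measurable (F (s j))" unfolding u_def[abs_def] by measurable
    show "v j \<in> borel_measurable (F (s j))" unfolding v_def[abs_def] by measurable
  qed
  have yR: "norm (y j \<omega>) \<le> R" and wyR: "weight \<epsilon> (s j) * (norm (y j \<omega>))\<^sup>2 \<le> R\<^sup>2" if "G j \<omega>" "j < N" for j \<omega>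
  proof -
    show wy: "weight \<epsilon> (s j) * (norm (y j \<omega>))\<^sup>2 \<le> R\<^sup>2" using that by (simp add: G_def)
    have "1 * (norm (y j \<omega>))\<^sup>2 \<le> weight \<epsilon> (s j) * (norm (y j \<omega>))\<^sup>2"
      using w1[of j] that by (intro mult_right_mono) auto
    with wy have "(norm (y j \<omega>))\<^sup>2 \<le> R\<^sup>2" by simp
    then show "norm (y j \<omega>) \<le> R" using R by (rule power2_le_imp_le)
  qed
  have ub: "\<exists>K. \<forall>\<omega>\<in>space M. norm (u j \<omega>) \<le> K" if j: "j < N" for j
  proof -
    obtain K where K: "\<forall>\<omega>\<in>space M. norm (\<eta> j \<omega>) \<le> K" using \<eta>(2)[OF j] by blast
    have "norm (u j \<omega>) \<le> 2 * weight \<epsilon> (s j) * (R * \<bar>K\<bar>)" if "\<omega> \<in> space M" for \<omega>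
    proof (cases "G j \<omega>")
      case True
      have "norm (u j \<omega>) = 2 * weight \<epsilon> (s j) * norm (y j \<omega> v* \<eta> j \<omega>)"
        using True w1[of j] j by (simp add: u_def g_def)
      also have "norm (y j \<omega> v* \<eta> j \<omega>) \<le> norm (y j \<omega>) * norm (\<eta> j \<omega>)"
        by (rule norm_vector_matrix_mult_le)
      also have "\<dots> \<le> R * \<bar>K\<bar>"
        using yR[OF True j] K that R by (intro mult_mono) force+
      finally show ?thesis using w1[of j] j by (simp add: mult_left_mono)
    next
      case False
      then show ?thesis using w1[of j] j R by (simp add: u_def g_def)
    qed
    then show ?thesis by blast
  qed
  have vb: "\<exists>K. \<forall>\<omega>\<in>space M. norm (v j \<omega>) \<le> K" if j: "j < N" for j
  proof -
    obtain K where K: "\<forall>\<omega>\<in>space M. norm (\<eta> j \<omega>) \<le> K" using \<eta>(2)[OF j] by blast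
    have "norm (v j \<omega>) \<le> sqrt (weight \<epsilon> (s j)) * \<bar>K\<bar>" if "\<omega> \<in> space M" for \<omega>
    proof -
      have "norm (v j \<omega>) \<le> sqrt (weight \<epsilon> (s j)) * norm (\<eta> j \<omega>)"
        using w1[of j] j by (simp add: v_def g_def)
      also have "\<dots> \<le> sqrt (weight \<epsilon> (s j)) * \<bar>K\<bar>"
        using K that w1[of j] j by (intro mult_left_mono) force+
      finally show ?thesis .
    qed
    then show ?thesis by blast
  qed
  have m_eq: "u j \<omega> \<bullet> D j \<omega> + ((norm (v j \<omega> *v D j \<omega>))\<^sup>2 - (norm (v j \<omega>))\<^sup>2 * ?\<Delta> j) =
      (if G j \<omega> then m j \<omega> else 0)" if j: "j < N" for j \<omega>
  proof (cases "G j \<omega>")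
    case True
    have "(norm (v j \<omega> *v D j \<omega>))\<^sup>2 = weight \<epsilon> (s j) * (norm (e j \<omega>))\<^sup>2"
      using True w1[of j] j
      by (simp add: v_def g_def e_def D_def scaleR_matrix_vector_assoc[symmetric] power_mult_distrib)
    moreover have "(norm (v j \<omega>))\<^sup>2 = weight \<epsilon> (s j) * (norm (\<eta> j \<omega>))\<^sup>2"
      using True w1[of j] j by (simp add: v_def g_def power_mult_distrib)
    moreover have "u j \<omega> \<bullet> D j \<omega> = 2 * weight \<epsilon> (s j) * (y j \<omega> \<bullet> e j \<omega>)"
      using True by (simp add: u_def g_def e_def D_def dot_lmul_matrix)
    ultimately show ?thesis using True by (simp add: m_def algebra_simps)
  next
    case False
    then show ?thesis by (simp add: u_def v_def g_def)
  qed
  have sum_eq: "(\<Sum>j<N. if G j \<omega> then m j \<omega> else 0) =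
      (\<Sum>j<N. u j \<omega> \<bullet> D j \<omega> + ((norm (v j \<omega> *v D j \<omega>))\<^sup>2 - (norm (v j \<omega>))\<^sup>2 * ?\<Delta> j))" for \<omega>
    by (rule sum.cong) (simp_all add: m_eq)
  note mart = discrete_martingale[where N = N and l = N and s = s and u = u and v = v, OF s0[of 0] ss um ub vm vb order.refl,
      folded D_def k0_def]
  show "has_bochner_integral M (\<lambda>\<omega>. \<Sum>j<N. if G j \<omega> then m j \<omega> else 0) 0"
    and "integrable M (\<lambda>\<omega>. (\<Sum>j<N. if G j \<omega> then m j \<omega> else 0)\<^sup>2)"
    unfolding sum_eq using mart(1,2) by simp_all
  let ?t = "\<lambda>j \<omega>. k0 * ((norm (u j \<omega>))\<^sup>2 * ?\<Delta> j + ((norm (v j \<omega>))\<^sup>2 * ?\<Delta> j)\<^sup>2)"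
  let ?a = "\<lambda>j \<omega>. (norm (\<eta> j \<omega>))\<^sup>2 * ?\<Delta> j"
  let ?c = "k0 * (4 * ?W * R\<^sup>2 + ?W\<^sup>2 * C)"
  have c0: "0 \<le> ?c" using k0 W C by simp
  have a0: "0 \<le> ?a j \<omega>" if "j < N" for j \<omega> using ss[OF that] by simp
  have t0: "0 \<le> ?t j \<omega>" if "j < N" for j \<omega> using ss[OF that] k0 by (intro mult_nonneg_nonneg add_nonneg_nonneg) auto
  \<comment> \<open>In \<open>|u|\<^sup>2\<close> one factor of the weight joins
    \<open>|y|\<^sup>2\<close> and is at most \<open>R\<^sup>2\<close>; the other is at most
    \<open>weight \<epsilon> T\<close>. In the quartic term one factor \<open>a j\<close> is at most
    \<open>C\<close>, since the energy in \<open>G j\<close> includes the current cell.\<close>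
  have tle: "?t j \<omega> \<le> ?c * (if G j \<omega> then ?a j \<omega> else 0)" if j: "j < N" for j \<omega>
  proof (cases "G j \<omega>")
    case True
    let ?w = "weight \<epsilon> (s j)"
    have wj: "0 \<le> ?w" "?w \<le> ?W" using w1[of j] wW[of j] j by auto
    have "norm (u j \<omega>) \<le> 2 * ?w * (norm (y j \<omega>) * norm (\<eta> j \<omega>))"
      using True wj norm_vector_matrix_mult_le[of "y j \<omega>" "\<eta> j \<omega>"]
      by (simp add: u_def g_def mult_left_mono)
    then have "(norm (u j \<omega>))\<^sup>2 \<le> (2 * ?w * (norm (y j \<omega>) * norm (\<eta> j \<omega>)))\<^sup>2"
      by (intro power_mono) auto
    also have "\<dots> = 4 * ?w * (?w * (norm (y j \<omega>))\<^sup>2) * (norm (\<eta> j \<omega>))\<^sup>2"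
      by (simp add: power2_eq_square)
    also have "\<dots> \<le> 4 * ?W * R\<^sup>2 * (norm (\<eta> j \<omega>))\<^sup>2"
      using wj wyR[OF True j] W by (intro mult_right_mono mult_mono) auto
    finally have 1: "(norm (u j \<omega>))\<^sup>2 * ?\<Delta> j \<le> 4 * ?W * R\<^sup>2 * ?a j \<omega>"
      using ss[OF j] mult_right_mono[of "(norm (u j \<omega>))\<^sup>2" _ "?\<Delta> j"] by (simp add: mult.assoc)
    have "?a j \<omega> \<le> (\<Sum>i\<le>j. ?a i \<omega>)"
      by (rule member_le_sum) (use a0 j in auto)
    then have aC: "?a j \<omega> \<le> C" using True by (simp add: G_def)
    have "(norm (v j \<omega>))\<^sup>2 * ?\<Delta> j = ?w * ?a j \<omega>"
      using True wj by (simp add: v_def g_def power_mult_distrib)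
    also have "\<dots> \<le> ?W * ?a j \<omega>" using wj a0[OF j] by (intro mult_right_mono)
    finally have "((norm (v j \<omega>))\<^sup>2 * ?\<Delta> j)\<^sup>2 \<le> (?W * ?a j \<omega>)\<^sup>2"
      using ss[OF j] by (intro power_mono) auto
    also have "\<dots> = ?W\<^sup>2 * (?a j \<omega> * ?a j \<omega>)" by (simp add: power2_eq_square)
    also have "\<dots> \<le> ?W\<^sup>2 * (C * ?a j \<omega>)"
      by (intro mult_left_mono mult_right_mono aC a0 j) simp
    finally have 2: "((norm (v j \<omega>))\<^sup>2 * ?\<Delta> j)\<^sup>2 \<le> ?W\<^sup>2 * C * ?a j \<omega>" by (simp add: mult.assoc)
    have "?t j \<omega> \<le> k0 * (4 * ?W * R\<^sup>2 * ?a j \<omega> + ?W\<^sup>2 * C * ?a j \<omega>)"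
      by (intro mult_left_mono add_mono 1 2 k0)
    then show ?thesis using True by (simp add: algebra_simps)
  next
    case False
    then show ?thesis by (simp add: u_def v_def g_def)
  qed
  have tsum: "(\<Sum>j<N. ?t j \<omega>) \<le> ?c * C" for \<omega>
  proof -
    have "(\<Sum>j<N. ?t j \<omega>) \<le> (\<Sum>j<N. ?c * (if G j \<omega> then ?a j \<omega> else 0))"
      by (intro sum_mono tle) simp
    also have "\<dots> = ?c * (\<Sum>j<N. if G j \<omega> then ?a j \<omega> else 0)"
      by (simp only: sum_distrib_left)
    also have "\<dots> \<le> ?c * C"
      by (intro mult_left_mono c0 sum_while_bounded C a0) (simp_all add: G_def)
    finally show ?thesis .
  qed
  have tint: "integrable M (?t j)" if j: "j < N" for j
  proof (rule integrable_const_bound[of _ "?c * C"])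
    have [measurable]: "u j \<in> borel_measurable M" "v j \<in> borel_measurable M"
      using measurable_F_M[OF um[OF j]] measurable_F_M[OF vm[OF j]] s0[of j] j by auto
    show "?t j \<in> borel_measurable M" by measurable
    have "?t j \<omega> \<le> ?c * C" for \<omega>
      using member_le_sum[of j "{..<N}" "\<lambda>j. ?t j \<omega>"] t0 tsum[of \<omega>] j by fastforce
    then show "AE \<omega> in M. norm (?t j \<omega>) \<le> ?c * C"
      using t0[OF j] by (intro AE_I2) (simp only: real_norm_def abs_of_nonneg)
  qed
  have "expectation (\<lambda>\<omega>. (\<Sum>j<N. if G j \<omega> then m j \<omega> else 0)\<^sup>2) \<le> (\<Sum>j<N. expectation (?t j))"
    unfolding sum_eq using mart(3) by simp
  also have "\<dots> = expectation (\<lambda>\<omega>. \<Sum>j<N. ?t j \<omega>)"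
    by (rule Bochner_Integration.integral_sum[symmetric]) (use tint in auto)
  also have "\<dots> \<le> expectation (\<lambda>\<omega>. ?c * C)"
    by (rule integral_mono) (use tint tsum in \<open>auto intro!: Bochner_Integration.integrable_sum\<close>)
  also have "\<dots> = ?c * C" by (simp add: prob_space)
  finally show "expectation (\<lambda>\<omega>. (\<Sum>j<N. if G j \<omega> then m j \<omega> else 0)\<^sup>2) \<le> ?c * C" .
qed

end

text \<open>The \<open>Z k\<close> are not assumed to converge, so Fatou's lemma is used with lower
  bounds only. It requires nonnegative functions: a shift by a large \<open>K\<close> and truncation
  provide them, and the bound in second mean makes the truncation cost at most \<open>V / K\<close>.
  The shift cancels in the end.\<close>

lemma (in prob_space) prob_le_of_asymptotic_lower_bound:
  fixes X :: "'a \<Rightarrow> real" and Z :: "nat \<Rightarrow> 'a \<Rightarrow> real"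
  assumes X: "integrable M X" "\<And>\<omega>. 0 \<le> X \<omega>"
    and Z: "\<And>k. has_bochner_integral M (Z k) 0" "\<And>k. integrable M (\<lambda>\<omega>. (Z k \<omega>)\<^sup>2)"
      "\<And>k. expectation (\<lambda>\<omega>. (Z k \<omega>)\<^sup>2) \<le> V"
    and E: "E \<in> events" and r: "0 \<le> r"
    and low: "AE \<omega> in M. \<forall>\<theta>>0. (eventually (\<lambda>k. - \<theta> \<le> X \<omega> + Z k \<omega>) sequentially) \<and>
      (\<omega> \<in> E \<longrightarrow> eventually (\<lambda>k. r - \<theta> \<le> X \<omega> + Z k \<omega>) sequentially)"
  shows "r * prob E \<le> expectation X"
proof (rule field_le_epsilon)
  fix \<theta>0 :: real assume "0 < \<theta>0"
  define \<theta> where "\<theta> = min (1/2) (\<theta>0 / 2)"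
  have \<theta>: "0 < \<theta>" "\<theta> < 1" "2 * \<theta> \<le> \<theta>0" using \<open>0 < \<theta>0\<close> by (auto simp: \<theta>_def)
  have V: "0 \<le> V" using order.trans[OF _ Z(3)[of 0]] by simp
  \<comment> \<open>Large enough for \<open>V / K \<le> \<theta>\<close>, and at least 1 so that
    \<open>K - \<theta>\<close> is positive; the total loss is \<open>2 * \<theta>\<close>.\<close>
  define K where "K = max 1 (V / \<theta>)"
  have K: "1 \<le> K" by (simp add: K_def)
  have "V / \<theta> \<le> K" by (simp add: K_def)
  then have VK: "V / K \<le> \<theta>" using \<theta> K by (simp add: field_simps)
  \<comment> \<open>\<open>max (X + Z k + K) 0 \<le> X + Z k + K + (Z k)\<^sup>2 / K\<close> controls the negative part uniformly in \<open>k\<close>;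
    \<open>ennreal\<close> truncates at \<open>0\<close>.\<close>
  let ?f = "\<lambda>k \<omega>. ennreal (X \<omega> + Z k \<omega> + K)"
  let ?h = "\<lambda>\<omega>. K - \<theta> + r * indicator E \<omega>"
  have [measurable]: "X \<in> borel_measurable M" "\<And>k. Z k \<in> borel_measurable M"
    using X Z(1) by (auto simp: has_bochner_integral_iff)
  have "(\<integral>\<^sup>+\<omega>. ennreal (?h \<omega>) \<partial>M) \<le> (\<integral>\<^sup>+\<omega>. liminf (\<lambda>k. ?f k \<omega>) \<partial>M)"
  proof (rule nn_integral_mono_AE)
    show "AE \<omega> in M. ennreal (?h \<omega>) \<le> liminf (\<lambda>k. ?f k \<omega>)"
      using low
    proof eventually_elim
      case (elim \<omega>)
      have "eventually (\<lambda>k. r * indicator E \<omega> - \<theta> \<le> X \<omega> + Z k \<omega>) sequentially"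
        using elim \<theta>(1) by (cases "\<omega> \<in> E") auto
      then have "eventually (\<lambda>k. ennreal (?h \<omega>) \<le> ?f k \<omega>) sequentially"
        by eventually_elim (intro ennreal_leI, simp)
      then show ?case by (rule Liminf_bounded)
    qed
  qed
  also have "\<dots> \<le> liminf (\<lambda>k. \<integral>\<^sup>+\<omega>. ?f k \<omega> \<partial>M)"
    by (rule nn_integral_liminf) measurable
  also have "\<dots> \<le> ennreal (expectation X + K + V / K)"
  proof (rule Liminf_le[OF sequentially_bot], rule always_eventually, rule allI)
    fix k
    let ?g = "\<lambda>\<omega>. X \<omega> + Z k \<omega> + K + (Z k \<omega>)\<^sup>2 / K"
    have pos: "0 \<le> ?g \<omega>" for \<omega>
    proof -
      \<comment> \<open>Completing the square shows \<open>Z k + K + (Z k)\<^sup>2 / K\<close> to be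
        nonnegative, so this integrable majorant dominates the truncated function too.\<close>
      have "(Z k \<omega>)\<^sup>2 + Z k \<omega> * K + K * K = (Z k \<omega> + K / 2)\<^sup>2 + 3 / 4 * (K * K)"
        by (simp add: power2_eq_square algebra_simps)
      also have "0 \<le> \<dots>" by (intro add_nonneg_nonneg) simp_all
      finally have "0 \<le> (Z k \<omega>)\<^sup>2 + Z k \<omega> * K + K * K" .
      then have "0 \<le> ((Z k \<omega>)\<^sup>2 + Z k \<omega> * K + K * K) / K" using K by simp
      also have "\<dots> = Z k \<omega> + K + (Z k \<omega>)\<^sup>2 / K" using K by (simp add: field_simps)
      finally show ?thesis using X(2)[of \<omega>] by simp
    qed
    have gi: "integrable M ?g"
      using X Z(1)[of k] Z(2)[of k] by (simp add: has_bochner_integral_iff)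
    have "(\<integral>\<^sup>+\<omega>. ?f k \<omega> \<partial>M) \<le> (\<integral>\<^sup>+\<omega>. ennreal (?g \<omega>) \<partial>M)"
      by (intro nn_integral_mono ennreal_leI) (use K in simp)
    also have "\<dots> = ennreal (expectation ?g)"
      by (rule nn_integral_eq_integral[OF gi]) (use pos in simp)
    also have "expectation ?g = expectation X + 0 + K + expectation (\<lambda>\<omega>. (Z k \<omega>)\<^sup>2) / K"
      using X Z(1)[of k] Z(2)[of k] by (simp add: has_bochner_integral_iff prob_space)
    also have "\<dots> \<le> expectation X + K + V / K"
      using Z(3)[of k] K by (simp add: divide_right_mono)
    finally show "(\<integral>\<^sup>+\<omega>. ?f k \<omega> \<partial>M) \<le> ennreal (expectation X + K + V / K)"
      by (simp add: ennreal_leI)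
  qed
  also have "(\<integral>\<^sup>+\<omega>. ennreal (?h \<omega>) \<partial>M) = ennreal (K - \<theta> + r * prob E)"
  proof -
    have "has_bochner_integral M ?h ((K - \<theta>) + r * prob E)"
    proof (intro has_bochner_integral_add has_bochner_integral_mult_right)
      show "has_bochner_integral M (\<lambda>\<omega>. K - \<theta>) (K - \<theta>)"
        by (simp add: has_bochner_integral_iff prob_space)
      show "has_bochner_integral M (indicator E) (prob E)"
        by (rule has_bochner_integral_real_indicator[OF E]) (simp add: emeasure_eq_measure)
    qed
    then have hi: "integrable M ?h" "expectation ?h = K - \<theta> + r * prob E"
      by (simp_all add: has_bochner_integral_iff)
    show ?thesis
      unfolding hi(2)[symmetric]
      by (rule nn_integral_eq_integral[OF hi(1)]) (use K \<theta> r in auto)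
  qed
  finally have "K - \<theta> + r * prob E \<le> expectation X + K + V / K"
    using X(2) K V by (subst (asm) ennreal_le_iff) (auto intro!: add_nonneg_nonneg integral_nonneg)
  then show "r * prob E \<le> expectation X + \<theta>0" using VK \<theta>(3) by linarith
qed

section \<open>The maximal inequality for the solution\<close>

context brownian_space
begin

text \<open>The moment bounds for the stopped sums and the pathwise lower bounds are both fed to
  \<open>prob_le_of_asymptotic_lower_bound\<close>, with the initial square as \<open>X\<close>. The
  bound is independent of \<open>T\<close>, which later allows \<open>T\<close> to tend to
  infinity.\<close>

lemma weighted_maximal_inequality:
  fixes x I fs :: "real \<Rightarrow> 'a \<Rightarrow> real^'d" and H :: "real \<Rightarrow> 'a \<Rightarrow> real^'m^'d"
  assumes M: "complete_measure M" and T: "0 < T" and R: "0 \<le> R"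
    and q: "0 < q" "q < 1" and \<epsilon>: "0 \<le> \<epsilon>" "\<epsilon> \<le> 1"
    and cd: "0 \<le> c" "0 \<le> d" and l: "0 \<le> l2" "\<epsilon> + l1 + l2 * q powr (-1 - \<epsilon>) \<le> 0"
    and x: "adapted F x" "continuous_process M x" "AE \<omega> in M. x 0 \<omega> = x0 \<omega>"
    and x0: "integrable M (\<lambda>\<omega>. (norm (x0 \<omega>))\<^sup>2)"
    and fs: "AE \<omega> in M. \<forall>t\<ge>0. set_integrable lborel {0..t} (\<lambda>s. fs s \<omega>)"
    and I: "has_ito_integral M F B H I"
    and eq: "AE \<omega> in M. \<forall>t\<ge>0. x t \<omega> = x0 \<omega> + (LINT s:{0..t}|lborel. fs s \<omega>) + I t \<omega>"
    and dis: "\<And>s \<omega>. 0 \<le> s \<Longrightarrow> 2 * (x s \<omega> \<bullet> fs s \<omega>) + (norm (H s \<omega>))\<^sup>2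
        \<le> l1 * (norm (x s \<omega>))\<^sup>2 + l2 * (norm (x (q * s) \<omega>))\<^sup>2"
    and H: "\<And>s \<omega>. 0 \<le> s \<Longrightarrow> norm (H s \<omega>) \<le> c * norm (x s \<omega>) + d * norm (x (q * s) \<omega>)"
  shows "{\<omega> \<in> space M. \<exists>t\<in>\<rat> \<inter> {0..T}. R\<^sup>2 < weight \<epsilon> t * (norm (x t \<omega>))\<^sup>2} \<in> events"
    and "R\<^sup>2 * prob {\<omega> \<in> space M. \<exists>t\<in>\<rat> \<inter> {0..T}. R\<^sup>2 < weight \<epsilon> t * (norm (x t \<omega>))\<^sup>2}
      \<le> expectation (\<lambda>\<omega>. (norm (x0 \<omega>))\<^sup>2)"
proof -
  let ?E = "{\<omega> \<in> space M. \<exists>t\<in>\<rat> \<inter> {0..T}. R\<^sup>2 < weight \<epsilon> t * (norm (x t \<omega>))\<^sup>2}"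
  have xF: "x t \<in> borel_measurable (F t)" if "0 \<le> t" for t
    using x(1) that by (simp add: adapted_def)
  have IF: "I t \<in> borel_measurable (F t)" if "0 \<le> t" for t
    using I that unfolding has_ito_integral_def adapted_def by blast
  have "{\<omega> \<in> space M. R\<^sup>2 < weight \<epsilon> t * (norm (x t \<omega>))\<^sup>2} \<in> events" if "t \<in> {0..T}" for t
  proof -
    have [measurable]: "x t \<in> borel_measurable M"
      using measurable_F_M[OF xF] that by simp
    show ?thesis by measurable
  qed
  moreover have "countable (\<rat> \<inter> {0..T})"
    using countable_rat by (rule countable_subset[rotated]) auto
  ultimately have "(\<Union>t\<in>\<rat> \<inter> {0..T}. {\<omega> \<in> space M. R\<^sup>2 < weight \<epsilon> t * (norm (x t \<omega>))\<^sup>2}) \<in> events"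
    by (intro sets.countable_UN') auto
  also have "(\<Union>t\<in>\<rat> \<inter> {0..T}. {\<omega> \<in> space M. R\<^sup>2 < weight \<epsilon> t * (norm (x t \<omega>))\<^sup>2}) = ?E"
    by auto
  finally show E: "?E \<in> events" .
  obtain n p \<xi> where \<xi>': "\<forall>k. simple_integrand M F (n k) (p k) (\<xi> k)"
    and approx: "AE \<omega> in M. eventually (\<lambda>k.
      (\<lambda>s. (norm (simple_process (n k) (p k) (\<xi> k) s \<omega> - H s \<omega>))\<^sup>2) integrable_on {0..T} \<and>
      integral {0..T} (\<lambda>s. (norm (simple_process (n k) (p k) (\<xi> k) s \<omega> - H s \<omega>))\<^sup>2) \<le> (1/2) ^ k \<and>
      (\<forall>t\<in>{0..T}. norm (simple_ito_integral B (n k) (p k) (\<xi> k) t \<omega> - I t \<omega>) \<le> (1/2) ^ k)) sequentially"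
    using ito_integral_approximation[OF M I T] .
  have \<xi>: "simple_integrand M F (n k) (p k) (\<xi> k)" for k
    using \<xi>' by blast
  \<comment> \<open>The \<open>k\<close>-th grid respects the partition of the \<open>k\<close>-th
    simple integrand, and its mesh has the same rate as the approximation.\<close>
  let ?grid = "\<lambda>k Ns. time_grid T (fst Ns) (snd Ns) \<and>
    (\<forall>j<fst Ns. snd Ns (Suc j) - snd Ns j \<le> (1/2) ^ k) \<and>
    (\<forall>j<fst Ns. \<forall>i\<le>n k. \<not> (snd Ns j < p k i \<and> p k i < snd Ns (Suc j)))"
  have "\<forall>k. \<exists>Ns. ?grid k Ns"
  proof
    fix k
    have "(0::real) < (1/2) ^ k" "finite (p k ` {..n k})" by simp_all
    from refined_time_grid[OF T this] obtain N s where "time_grid T N s"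
      "\<And>j. j < N \<Longrightarrow> s (Suc j) - s j \<le> (1/2) ^ k"
      "\<And>j r. j < N \<Longrightarrow> r \<in> p k ` {..n k} \<Longrightarrow> \<not> (s j < r \<and> r < s (Suc j))" by blast
    then show "\<exists>Ns. ?grid k Ns" by (intro exI[where x = "(N, s)"]) simp
  qed
  from choice[OF this] obtain Ns where Ns: "\<forall>k. ?grid k (Ns k)" by (rule exE)
  define N where "N k = fst (Ns k)" for k
  define s where "s k = snd (Ns k)" for k
  have grid: "time_grid T (N k) (s k)" and mesh: "\<And>j. j < N k \<Longrightarrow> s k (Suc j) - s k j \<le> (1/2) ^ k"
    and no: "\<And>j i. j < N k \<Longrightarrow> i \<le> n k \<Longrightarrow> \<not> (s k j < p k i \<and> p k i < s k (Suc j))" for k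
    using Ns[rule_format, of k] by (simp_all add: N_def s_def)
  have s0: "0 \<le> s k j" "s k j \<le> T" if "j \<le> N k" for k j
    using time_grid_range[OF grid that] by auto
  define \<eta> where "\<eta> k j = grid_value (n k) (p k) (\<xi> k) (s k j)" for k j
  define e where "e k j \<omega> = \<eta> k j \<omega> *v (B (s k (Suc j)) \<omega> - B (s k j) \<omega>)" for k j \<omega>
  \<comment> \<open>\<open>x - I\<close> is the drift part; written in this way it is adapted by construction.\<close>
  define y where "y k j \<omega> = x (s k j) \<omega> - I (s k j) \<omega> + (\<Sum>i<j. e k i \<omega>)" for k j \<omega>
  \<comment> \<open>Exactly the constant of \<open>discrete_energy_bound\<close>, so that the energy
    threshold does not cause stopping on its own.\<close>
  define C where "C = 2 * ((c + d) * (R + 1))\<^sup>2 * T + 2"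
  have C: "0 \<le> C" using T by (simp add: C_def)
  define G where "G k j \<omega> \<longleftrightarrow> (\<forall>i\<le>j. weight \<epsilon> (s k i) * (norm (y k i \<omega>))\<^sup>2 \<le> R\<^sup>2) \<and>
      (\<Sum>i\<le>j. (norm (\<eta> k i \<omega>))\<^sup>2 * (s k (Suc i) - s k i)) \<le> C" for k j \<omega>
  define m where "m k j \<omega> = weight \<epsilon> (s k j) *
      (2 * (y k j \<omega> \<bullet> e k j \<omega>) + (norm (e k j \<omega>))\<^sup>2 - (norm (\<eta> k j \<omega>))\<^sup>2 * (s k (Suc j) - s k j))" for k j \<omega>
  define Z where "Z k \<omega> = (\<Sum>j<N k. if G k j \<omega> then m k j \<omega> else 0)" for k \<omega>
  have \<eta>F: "\<eta> k j \<in> borel_measurable (F (s k j))" for k j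
    unfolding \<eta>_def by (rule grid_value_measurable[OF \<xi>])
  have \<eta>b: "\<exists>K. \<forall>\<omega>\<in>space M. norm (\<eta> k j \<omega>) \<le> K" for k j
    unfolding \<eta>_def by (rule grid_value_bounded[OF \<xi>])
  have yF: "y k j \<in> borel_measurable (F (s k j))" if j: "j \<le> N k" for k j
  proof -
    have "e k i \<in> borel_measurable (F (s k j))" if i: "i < j" for i
    proof -
      have si: "s k (Suc i) \<le> s k j" "s k i \<le> s k j"
        using time_grid_mono[OF grid, of "Suc i" j k] time_grid_mono[OF grid, of i j k] i j by auto
      have i0: "0 \<le> s k i" "0 \<le> s k (Suc i)" using s0[of i k] s0[of "Suc i" k] i j by auto
      have [measurable]: "\<eta> k i \<in> borel_measurable (F (s k j))"
        "B (s k i) \<in> borel_measurable (F (s k j))" "B (s k (Suc i)) \<in> borel_measurable (F (s k j))"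
        using measurable_F_mono[OF \<eta>F i0(1) si(2)] measurable_F_mono[OF B_adapted[OF i0(1)] i0(1) si(2)]
          measurable_F_mono[OF B_adapted[OF i0(2)] i0(2) si(1)] by auto
      note borel_measurable_matrix_vector_mult[measurable]
      show ?thesis unfolding e_def[abs_def] by measurable
    qed
    then have [measurable]: "(\<lambda>\<omega>. \<Sum>i<j. e k i \<omega>) \<in> borel_measurable (F (s k j))"
      by (intro borel_measurable_sum) simp
    have [measurable]: "x (s k j) \<in> borel_measurable (F (s k j))" "I (s k j) \<in> borel_measurable (F (s k j))"
      using xF IF s0(1)[OF j] by auto
    show ?thesis unfolding y_def[abs_def] by measurable
  qed
  note mart = stopped_square_martingale[OF grid \<epsilon>(1) R C yF \<eta>F \<eta>b, folded e_def, folded G_def m_def, folded Z_def]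
  show "R\<^sup>2 * prob ?E \<le> expectation (\<lambda>\<omega>. (norm (x0 \<omega>))\<^sup>2)"
  proof (rule prob_le_of_asymptotic_lower_bound[OF x0 _ mart(1) mart(2) mart(3) E])
    show "AE \<omega> in M. \<forall>\<theta>>0. (\<forall>\<^sub>F k in sequentially. - \<theta> \<le> (norm (x0 \<omega>))\<^sup>2 + Z k \<omega>) \<and>
      (\<omega> \<in> ?E \<longrightarrow> (\<forall>\<^sub>F k in sequentially. R\<^sup>2 - \<theta> \<le> (norm (x0 \<omega>))\<^sup>2 + Z k \<omega>))"
      using x(2)[unfolded continuous_process_def] x(3) fs eq approx
    proof eventually_elim
      case (elim \<omega>)
      have xc: "continuous_on {0..T} (\<lambda>t. x t \<omega>)"
        by (rule continuous_on_subset[OF elim(1)]) auto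
      have fi: "(\<lambda>s. fs s \<omega>) integrable_on {0..t}"
        and fint: "(LINT s:{0..t}|lborel. fs s \<omega>) = integral {0..t} (\<lambda>s. fs s \<omega>)" if "0 \<le> t" for t
        using set_borel_integral_eq_integral[OF elim(3)[rule_format, OF that]] by auto
      have fn: "(\<lambda>s. norm (fs s \<omega>)) integrable_on {0..T}"
        using T by (intro set_borel_integral_eq_integral(1) set_integrable_norm elim(3)[rule_format]) simp
      have A: "x t \<omega> - I t \<omega> = x0 \<omega> + integral {0..t} (\<lambda>s. fs s \<omega>)" if "0 \<le> t" for t
        using elim(4)[rule_format, OF that] fint[OF that] by simp
      have y0: "y k 0 \<omega> = x0 \<omega>" for k
        using A[of 0] grid[of k] by (simp add: y_def time_grid_def)
      have ye: "y k (Suc j) \<omega> = y k j \<omega> + integral {s k j..s k (Suc j)} (\<lambda>s. fs s \<omega>) + e k j \<omega>"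
        if j: "j < N k" for k j
      proof -
        have sj: "0 \<le> s k j" "s k j \<le> s k (Suc j)" "0 \<le> s k (Suc j)"
          using s0[of j k] s0[of "Suc j" k] time_grid_mono[OF grid, of j "Suc j" k] j by auto
        have "integral {0..s k j} (\<lambda>s. fs s \<omega>) + integral {s k j..s k (Suc j)} (\<lambda>s. fs s \<omega>)
            = integral {0..s k (Suc j)} (\<lambda>s. fs s \<omega>)"
          by (rule Henstock_Kurzweil_Integration.integral_combine[OF sj(1,2) fi[OF sj(3)]])
        then show ?thesis using A[OF sj(1)] A[OF sj(3)] by (simp add: y_def)
      qed
      have J: "(\<Sum>i<j. e k i \<omega>) = simple_ito_integral B (n k) (p k) (\<xi> k) (s k j) \<omega>" if "j \<le> N k" for k j
        unfolding e_def \<eta>_def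
        by (rule simple_ito_integral_eq_grid_sum[OF grid no _ _ that, symmetric])
           (use simple_integrand_times[OF \<xi>] \<xi>[unfolded simple_integrand_def] in auto)
      let ?U = "\<lambda>k r. (norm (simple_process (n k) (p k) (\<xi> k) r \<omega> - H r \<omega>))\<^sup>2"
      \<comment> \<open>At grid points \<open>y - x\<close> is the elementary integral minus
        \<open>I\<close>.\<close>
      have yx: "eventually (\<lambda>k. \<forall>j\<le>N k. norm (y k j \<omega> - x (s k j) \<omega>) \<le> (1/2) ^ k) sequentially"
        using elim(5)
      proof eventually_elim
        case (elim k)
        show ?case
        proof (intro allI impI)
          fix j assume j: "j \<le> N k"
          then have "norm (simple_ito_integral B (n k) (p k) (\<xi> k) (s k j) \<omega> - I (s k j) \<omega>) \<le> (1/2) ^ k"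
            using elim s0[OF j] by auto
          then show "norm (y k j \<omega> - x (s k j) \<omega>) \<le> (1/2) ^ k"
            by (simp add: y_def J[OF j])
        qed
      qed
      have U: "eventually (\<lambda>k. ?U k integrable_on {0..T} \<and> integral {0..T} (?U k) \<le> (1/2) ^ k) sequentially"
        using elim(5) by eventually_elim blast
      have \<eta>U: "(norm (\<eta> k j \<omega> - H r \<omega>))\<^sup>2 \<le> ?U k r"
        if "j < N k" "r \<in> {s k j<..<s k (Suc j)}" for k j r
        using simple_process_eq_grid_value[OF no[OF that(1)], where r = r and \<xi> = "\<xi> k" and \<omega> = \<omega>] that(2)
        by (simp add: \<eta>_def)
      have fiT: "(\<lambda>s. fs s \<omega>) integrable_on {0..T}" using fi[of T] T by simp
      have low1: "eventually (\<lambda>k. - \<theta> \<le> (norm (y k 0 \<omega>))\<^sup>2 + Z k \<omega>) sequentially" if "0 < \<theta>" for \<theta>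
        unfolding Z_def G_def m_def C_def
      proof (rule discrete_lower_bound(1)[where s = s and N = N and y = "\<lambda>k j. y k j \<omega>" and e = "\<lambda>k j. e k j \<omega>"
          and \<eta> = "\<lambda>k j. \<eta> k j \<omega>" and U = ?U and H = "\<lambda>r. H r \<omega>" and ?l1.0 = l1 and ?l2.0 = l2, OF T q \<epsilon> xc fiT fn])
        fix r assume "r \<in> {0..T}"
        then have r: "0 \<le> r" by simp
        show "2 * (x r \<omega> \<bullet> fs r \<omega>) + (norm (H r \<omega>))\<^sup>2
            \<le> l1 * (norm (x r \<omega>))\<^sup>2 + l2 * (norm (x (q * r) \<omega>))\<^sup>2"
          by (rule dis[OF r])
        show "norm (H r \<omega>) \<le> c * norm (x r \<omega>) + d * norm (x (q * r) \<omega>)"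
          by (rule H[OF r])
      qed ((rule cd l R grid mesh ye yx U \<eta>U that zero_le_power2 | assumption)+)
      have low2: "eventually (\<lambda>k. R\<^sup>2 - \<theta> \<le> (norm (y k 0 \<omega>))\<^sup>2 + Z k \<omega>) sequentially"
        if "0 < \<theta>" "t \<in> {0..T}" "R\<^sup>2 < weight \<epsilon> t * (norm (x t \<omega>))\<^sup>2" for \<theta> t
        unfolding Z_def G_def m_def C_def
      proof (rule discrete_lower_bound(2)[where s = s and N = N and y = "\<lambda>k j. y k j \<omega>" and e = "\<lambda>k j. e k j \<omega>"
          and \<eta> = "\<lambda>k j. \<eta> k j \<omega>" and U = ?U and H = "\<lambda>r. H r \<omega>" and ?l1.0 = l1 and ?l2.0 = l2, OF T q \<epsilon> xc fiT fn])
        fix r assume "r \<in> {0..T}"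
        then have r: "0 \<le> r" by simp
        show "2 * (x r \<omega> \<bullet> fs r \<omega>) + (norm (H r \<omega>))\<^sup>2
            \<le> l1 * (norm (x r \<omega>))\<^sup>2 + l2 * (norm (x (q * r) \<omega>))\<^sup>2"
          by (rule dis[OF r])
        show "norm (H r \<omega>) \<le> c * norm (x r \<omega>) + d * norm (x (q * r) \<omega>)"
          by (rule H[OF r])
      qed ((rule cd l R grid mesh ye yx U \<eta>U that zero_le_power2 | assumption)+)
      show ?case using low1[unfolded y0] low2[unfolded y0] by blast
    qed
  qed simp_all
qed

end

section \<open>Polynomial stability\<close>

text \<open>At \<epsilon> = 0 the expression equals \<open>l1 + l2 / q\<close>, which is negative;
  continuity leaves room for a positive \<epsilon>.\<close>

lemma exists_decay_exponent:
  fixes l1 l2 q :: real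
  assumes q: "0 < q" and l: "l1 + l2 / q < 0"
  obtains \<epsilon> where "0 < \<epsilon>" "\<epsilon> \<le> 1" "\<epsilon> + l1 + l2 * q powr (-1 - \<epsilon>) \<le> 0"
proof -
  have "((\<lambda>e. e + l1 + l2 * q powr (-1 - e)) \<longlongrightarrow> 0 + l1 + l2 * q powr (-1 - 0)) (at_right 0)"
    using q by (intro tendsto_intros) auto
  moreover have "0 + l1 + l2 * q powr (-1 - 0) < 0"
    using l q by (simp add: powr_minus divide_inverse)
  ultimately have "eventually (\<lambda>e. e + l1 + l2 * q powr (-1 - e) < 0) (at_right 0)"
    by (rule order_tendstoD(2))
  then obtain b where b: "b > 0" "\<And>e. 0 < e \<Longrightarrow> e < b \<Longrightarrow> e + l1 + l2 * q powr (-1 - e) < 0"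
    unfolding eventually_at_right_field by auto
  let ?e = "min 1 (b / 2)"
  have e: "0 < ?e" "?e \<le> 1" "?e < b" using b(1) by (auto simp: min_def)
  show thesis
    by (rule that[OF e(1,2) less_imp_le[OF b(2)[OF e(1,3)]]])
qed

text \<open>Taking logarithms, \<open>K\<close> contributes a term of order \<open>1 / ln t\<close>,
  which vanishes, and the weight contributes \<epsilon>, halved because the norm is squared.\<close>

lemma Limsup_log_le_of_weight_bounded:
  fixes z :: "real \<Rightarrow> 'b::real_normed_vector"
  assumes K: "0 < K" and \<epsilon>: "0 < \<epsilon>" and z: "\<And>t. 0 \<le> t \<Longrightarrow> weight \<epsilon> t * (norm (z t))\<^sup>2 \<le> K"
  shows "Limsup at_top (\<lambda>t. log_ext (norm (z t)) / ereal (ln t)) \<le> ereal (- \<epsilon> / 2)"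
proof -
  let ?r = "\<lambda>t. ln K / 2 / ln t - \<epsilon> / 2"
  have "eventually (\<lambda>t. log_ext (norm (z t)) / ereal (ln t) \<le> ereal (?r t)) at_top"
    using eventually_gt_at_top[of 1]
  proof eventually_elim
    case (elim t)
    have lt: "0 < ln t" using elim by simp
    show ?case
    proof (cases "norm (z t) = 0")
      \<comment> \<open>Here the logarithm is minus infinity and stays so after division by the
        positive \<open>ln t\<close>.\<close>
      case True
      then show ?thesis using lt by (simp add: log_ext_def divide_ereal_def)
    next
      case False
      then have nz: "0 < norm (z t)" by simp
      have "ln (weight \<epsilon> t * (norm (z t))\<^sup>2) \<le> ln K"
        using z[of t] weight_pos[of t \<epsilon>] nz elim K by (intro ln_mono) auto
      moreover have "ln (weight \<epsilon> t * (norm (z t))\<^sup>2) = \<epsilon> * ln (1 + t) + 2 * ln (norm (z t))"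
        using nz elim by (simp add: weight_def ln_mult ln_powr ln_realpow)
      moreover have "\<epsilon> * ln t \<le> \<epsilon> * ln (1 + t)" using \<epsilon> elim by simp
      ultimately have "ln (norm (z t)) \<le> ln K / 2 - \<epsilon> / 2 * ln t" by simp
      then have "ln (norm (z t)) / ln t \<le> (ln K / 2 - \<epsilon> / 2 * ln t) / ln t"
        using lt by (intro divide_right_mono) auto
      also have "\<dots> = ?r t" using lt by (simp add: diff_divide_distrib)
      finally show ?thesis using False lt by (simp add: log_ext_def)
    qed
  qed
  then have "Limsup at_top (\<lambda>t. log_ext (norm (z t)) / ereal (ln t)) \<le> Limsup at_top (\<lambda>t. ereal (?r t))"
    by (rule Limsup_mono)
  also have "\<dots> = ereal (- \<epsilon> / 2)"
  proof (rule lim_imp_Limsup)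
    have "((\<lambda>t::real. ln K / 2 / ln t) \<longlongrightarrow> 0) at_top"
      by (rule real_tendsto_divide_at_top[OF tendsto_const ln_at_top])
    from tendsto_diff[OF this tendsto_const[of "\<epsilon> / 2"]]
    show "((\<lambda>t. ereal (?r t)) \<longlongrightarrow> ereal (- \<epsilon> / 2)) at_top" by simp
  qed simp
  finally show ?thesis .
qed

context brownian_space
begin

text \<open>The probability of exceeding a level \<open>R\<close> before \<open>T\<close> is at most
  \<open>V / R\<^sup>2\<close>, uniformly in \<open>T\<close>. First \<open>T\<close> tends to
  infinity along increasing events, then \<open>R\<close>: exceeding every level has probability
  zero.\<close>

lemma AE_weight_bounded:
  fixes x :: "real \<Rightarrow> 'a \<Rightarrow> real^'d"
  assumes x: "continuous_process M x"
    and ev: "\<And>T R. 0 < T \<Longrightarrow> 0 \<le> R \<Longrightarrow>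
        {\<omega> \<in> space M. \<exists>t\<in>\<rat> \<inter> {0..T}. R\<^sup>2 < weight \<epsilon> t * (norm (x t \<omega>))\<^sup>2} \<in> events"
    and bound: "\<And>T R. 0 < T \<Longrightarrow> 0 \<le> R \<Longrightarrow>
        R\<^sup>2 * prob {\<omega> \<in> space M. \<exists>t\<in>\<rat> \<inter> {0..T}. R\<^sup>2 < weight \<epsilon> t * (norm (x t \<omega>))\<^sup>2} \<le> V"
  shows "AE \<omega> in M. \<exists>K>0. \<forall>t\<ge>0. weight \<epsilon> t * (norm (x t \<omega>))\<^sup>2 \<le> K"
proof -
  define E where "E r T = {\<omega> \<in> space M. \<exists>t\<in>\<rat> \<inter> {0..real (Suc T)}.
      (real (Suc r))\<^sup>2 < weight \<epsilon> t * (norm (x t \<omega>))\<^sup>2}" for r T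
  define U where "U r = (\<Union>T. E r T)" for r
  have Em: "E r T \<in> events" for r T unfolding E_def by (rule ev) auto
  have Um: "U r \<in> events" for r using Em by (auto simp: U_def)
  have inc: "incseq (E r)" for r
  proof (rule incseq_SucI)
    fix T
    have "\<rat> \<inter> {0..real (Suc T)} \<subseteq> \<rat> \<inter> {0..real (Suc (Suc T))}" by auto
    then show "E r T \<subseteq> E r (Suc T)" unfolding E_def by blast
  qed
  have Up: "prob (U r) \<le> V / (real (Suc r))\<^sup>2" for r
  proof (rule LIMSEQ_le_const2)
    show "(\<lambda>T. prob (E r T)) \<longlonglongrightarrow> prob (U r)"
      unfolding U_def by (rule finite_Lim_measure_incseq[OF _ inc]) (use Em in auto)
    have "prob (E r T) \<le> V / (real (Suc r))\<^sup>2" for T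
      using bound[of "real (Suc T)" "real (Suc r)"] unfolding E_def
      by (simp add: field_simps del: of_nat_Suc)
    then show "\<exists>N. \<forall>T\<ge>N. prob (E r T) \<le> V / (real (Suc r))\<^sup>2" by blast
  qed
  have Im: "(\<Inter>r. U r) \<in> events" using Um by auto
  have "prob (\<Inter>r. U r) \<le> 0"
  proof (rule LIMSEQ_le_const)
    have "(\<lambda>r. V * (inverse (real (Suc r)))\<^sup>2) \<longlonglongrightarrow> V * 0\<^sup>2"
      by (intro tendsto_intros LIMSEQ_inverse_real_of_nat)
    then show "(\<lambda>r. V / (real (Suc r))\<^sup>2) \<longlonglongrightarrow> 0"
      by (simp add: divide_inverse power_inverse)
    have "prob (\<Inter>r. U r) \<le> V / (real (Suc r))\<^sup>2" for r
    proof -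
      have "(\<Inter>r. U r) \<subseteq> U r" by auto
      from order.trans[OF finite_measure_mono[OF this Um] Up] show ?thesis .
    qed
    then show "\<exists>N. \<forall>r\<ge>N. prob (\<Inter>r. U r) \<le> V / (real (Suc r))\<^sup>2" by blast
  qed
  then have "prob (\<Inter>r. U r) = 0" using measure_nonneg[of M "\<Inter>r. U r"] by linarith
  then have "(\<Inter>r. U r) \<in> null_sets M" using Im by (simp add: null_sets_def emeasure_eq_measure)
  then have "AE \<omega> in M. \<omega> \<notin> (\<Inter>r. U r)" by (rule AE_not_in)
  then show ?thesis
    using x[unfolded continuous_process_def] AE_space
  proof eventually_elim
    case (elim \<omega>)
    then obtain r where r: "\<And>T. \<omega> \<notin> E r T" by (auto simp: U_def)
    have "weight \<epsilon> t * (norm (x t \<omega>))\<^sup>2 \<le> (real (Suc r))\<^sup>2" if t: "0 \<le> t" for t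
    proof (rule ccontr)
      assume "\<not> ?thesis"
      moreover obtain T :: nat where T: "t \<le> real T" using real_arch_simple by blast
      have "continuous_on {0..real (Suc T)} (\<lambda>t. x t \<omega>)"
        by (rule continuous_on_subset[OF elim(2)]) auto
      then have "continuous_on {0..real (Suc T)} (\<lambda>t. weight \<epsilon> t * (norm (x t \<omega>))\<^sup>2)"
        by (intro continuous_intros)
      ultimately have "\<exists>s\<in>\<rat> \<inter> {0..real (Suc T)}. (real (Suc r))\<^sup>2 < weight \<epsilon> s * (norm (x s \<omega>))\<^sup>2"
        using t T by (intro continuous_rational_witness[of _ _ t]) auto
      then show False using r[of T] elim(3) unfolding E_def by blast
    qed
    then show ?case by (intro exI[of _ "(real (Suc r))\<^sup>2"]) simp
  qed
qed

end

theorem theorem3p2: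
  fixes M :: "'a measure" and F :: "real \<Rightarrow> 'a measure"
    and B :: "real \<Rightarrow> 'a \<Rightarrow> real^'m"
    and f :: "real \<Rightarrow> real^'d \<Rightarrow> real^'d \<Rightarrow> real^'d"
    and g :: "real \<Rightarrow> real^'d \<Rightarrow> real^'d \<Rightarrow> real^'m^'d"
    and q a b c d0 :: real
  assumes "prob_space M" and "complete_measure M"
    and "usual_filtration M F"
    and "brownian_motion M F B"
    and "0 < q" and "q < 1"
    and "\<And>t. 0 \<le> t \<Longrightarrow> f t 0 0 = 0"
    and "\<And>t. 0 \<le> t \<Longrightarrow> g t 0 0 = 0"
    and "b > 0" and "c > 0" and "d0 > 0"
    and "\<And>t x1 x2 y. 0 \<le> t \<Longrightarrow> (x1 - x2) \<bullet> (f t x1 y - f t x2 y) \<le> a * (norm (x1 - x2))\<^sup>2"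
    and "\<And>t x y1 y2. 0 \<le> t \<Longrightarrow> norm (f t x y1 - f t x y2) \<le> b * norm (y1 - y2)"
    and "\<And>t x1 x2 y. 0 \<le> t \<Longrightarrow> trace_norm (g t x1 y - g t x2 y) \<le> c * norm (x1 - x2)"
    and "\<And>t x y1 y2. 0 \<le> t \<Longrightarrow> trace_norm (g t x y1 - g t x y2) \<le> d0 * norm (y1 - y2)"
    and "2 * a + b + 2 * c\<^sup>2 + (b + 2 * d0\<^sup>2) / q < 0"
  shows "\<exists>\<alpha><0::real. \<forall>x0 x.
           x0 \<in> borel_measurable (F 0) \<and> integrable M (\<lambda>\<omega>. (norm (x0 \<omega>))\<^sup>2) \<and>
           pantograph_solution M F B q f g x0 x \<longrightarrow>
           (AE \<omega> in M. Limsup at_top (\<lambda>t. log_ext (norm (x t \<omega>)) / ereal (ln t)) \<le> ereal \<alpha>)"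
proof -
  interpret prob_space M by fact
  interpret brownian_space M F B
    by standard fact+
  note q = \<open>0 < q\<close> \<open>q < 1\<close>
  note f0 = assms(7) and g0 = assms(8) and b = assms(9) and c = assms(10) and d0 = assms(11)
    and f1 = assms(12) and f2 = assms(13) and g1 = assms(14)[unfolded trace_norm_eq_norm]
    and g2 = assms(15)[unfolded trace_norm_eq_norm]
  define l1 where "l1 = 2 * a + b + 2 * c\<^sup>2"
  define l2 where "l2 = b + 2 * d0\<^sup>2"
  have l2: "0 \<le> l2" using b by (simp add: l2_def)
  obtain \<epsilon> where \<epsilon>: "0 < \<epsilon>" "\<epsilon> \<le> 1" "\<epsilon> + l1 + l2 * q powr (-1 - \<epsilon>) \<le> 0"
    using exists_decay_exponent[OF q(1), of l1 l2] assms(16) by (auto simp: l1_def l2_def)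
  have gb: "norm (g t u v) \<le> c * norm u + d0 * norm v" if "0 \<le> t" for t u v
  proof -
    have "norm (g t u v - g t 0 v) \<le> c * norm u" using g1[OF that, of u v 0] by simp
    moreover have "norm (g t 0 v) \<le> d0 * norm v" using g2[OF that, of 0 v 0] g0[OF that] by simp
    ultimately show ?thesis using norm_triangle_ineq[of "g t u v - g t 0 v" "g t 0 v"] by simp
  qed
  \<comment> \<open>The terms \<open>f t 0 v\<close> and \<open>g t 0 v\<close> separate the two
    arguments. Young's inequality splits the mixed term \<open>2 * b * |u| * |v|\<close> evenly,
    giving a \<open>b\<close> to both \<open>l1\<close> and \<open>l2\<close>; squaring the linear
    growth of \<open>g\<close> gives \<open>2 * c\<^sup>2\<close> and
    \<open>2 * d0\<^sup>2\<close>.\<close>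
  have dis: "2 * (u \<bullet> f t u v) + (norm (g t u v))\<^sup>2 \<le> l1 * (norm u)\<^sup>2 + l2 * (norm v)\<^sup>2"
    if t: "0 \<le> t" for t u v
  proof -
    have "u \<bullet> f t u v = u \<bullet> (f t u v - f t 0 v) + u \<bullet> f t 0 v" by (simp add: inner_diff_right)
    also have "\<dots> \<le> a * (norm u)\<^sup>2 + norm u * (b * norm v)"
    proof (rule add_mono)
      show "u \<bullet> (f t u v - f t 0 v) \<le> a * (norm u)\<^sup>2" using f1[OF t, of u 0 v] by simp
      have "norm (f t 0 v) \<le> b * norm v" using f2[OF t, of 0 v 0] f0[OF t] by simp
      then show "u \<bullet> f t 0 v \<le> norm u * (b * norm v)"
        by (intro order.trans[OF norm_cauchy_schwarz] mult_left_mono) auto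
    qed
    finally have 1: "2 * (u \<bullet> f t u v) \<le> 2 * a * (norm u)\<^sup>2 + b * (2 * norm u * norm v)"
      by (simp add: mult.assoc mult.left_commute)
    have "b * (2 * norm u * norm v) \<le> b * ((norm u)\<^sup>2 + (norm v)\<^sup>2)"
      using b sum_squares_bound[of "norm u" "norm v"] by (intro mult_left_mono) auto
    with 1 have 2: "2 * (u \<bullet> f t u v) \<le> 2 * a * (norm u)\<^sup>2 + b * ((norm u)\<^sup>2 + (norm v)\<^sup>2)" by simp
    have "(norm (g t u v))\<^sup>2 \<le> (c * norm u + d0 * norm v)\<^sup>2"
      by (intro power_mono gb t) simp
    also have "\<dots> \<le> 2 * (c * norm u)\<^sup>2 + 2 * (d0 * norm v)\<^sup>2"
      using sum_squares_bound[of "c * norm u" "d0 * norm v"] by (simp add: power2_sum)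
    finally show ?thesis using 2 by (simp add: l1_def l2_def power_mult_distrib algebra_simps)
  qed
  show ?thesis
  \<comment> \<open>The exponent depends only on \<open>q\<close> and the coefficient constants, so
    it is fixed before the initial value and the solution.\<close>
  proof (intro exI[of _ "- \<epsilon> / 2"] conjI allI impI)
    show "- \<epsilon> / 2 < 0" using \<epsilon>(1) by simp
    fix x0 x
    assume "x0 \<in> borel_measurable (F 0) \<and> integrable M (\<lambda>\<omega>. (norm (x0 \<omega>))\<^sup>2) \<and>
      pantograph_solution M F B q f g x0 x"
    then have x0: "integrable M (\<lambda>\<omega>. (norm (x0 \<omega>))\<^sup>2)" and sol: "pantograph_solution M F B q f g x0 x" by auto
    from sol have x: "adapted F x" "continuous_process M x" "AE \<omega> in M. x 0 \<omega> = x0 \<omega>"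
      and fs: "AE \<omega> in M. \<forall>t\<ge>0. set_integrable lborel {0..t} (\<lambda>s. f s (x s \<omega>) (x (q * s) \<omega>))"
      unfolding pantograph_solution_def by blast+
    from sol obtain I where I: "has_ito_integral M F B (\<lambda>s \<omega>. g s (x s \<omega>) (x (q * s) \<omega>)) I"
      and eq: "AE \<omega> in M. \<forall>t\<ge>0.
           x t \<omega> = x0 \<omega> + (LINT s:{0..t}|lborel. f s (x s \<omega>) (x (q * s) \<omega>)) + I t \<omega>"
      unfolding pantograph_solution_def by blast
    have \<epsilon>0: "0 \<le> \<epsilon>" and c0: "0 \<le> c" and d0': "0 \<le> d0" using \<epsilon>(1) c d0 by simp_all
    have "AE \<omega> in M. \<exists>K>0. \<forall>t\<ge>0. weight \<epsilon> t * (norm (x t \<omega>))\<^sup>2 \<le> K"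
    proof (rule AE_weight_bounded[OF x(2)])
      fix T R :: real assume "0 < T" "0 \<le> R"
      note maximal = weighted_maximal_inequality[where fs = "\<lambda>s \<omega>. f s (x s \<omega>) (x (q * s) \<omega>)"
          and H = "\<lambda>s \<omega>. g s (x s \<omega>) (x (q * s) \<omega>)" and x = x and I = I,
          OF \<open>complete_measure M\<close> this q \<epsilon>0 \<epsilon>(2) c0 d0' l2 \<epsilon>(3) x x0 fs I eq]
      show "{\<omega> \<in> space M. \<exists>t\<in>\<rat> \<inter> {0..T}. R\<^sup>2 < weight \<epsilon> t * (norm (x t \<omega>))\<^sup>2} \<in> events"
        by (rule maximal(1)) (rule dis gb, assumption)+
      show "R\<^sup>2 * prob {\<omega> \<in> space M. \<exists>t\<in>\<rat> \<inter> {0..T}. R\<^sup>2 < weight \<epsilon> t * (norm (x t \<omega>))\<^sup>2}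
          \<le> expectation (\<lambda>\<omega>. (norm (x0 \<omega>))\<^sup>2)"
        by (rule maximal(2)) (rule dis gb, assumption)+
    qed
    then show "AE \<omega> in M. Limsup at_top (\<lambda>t. log_ext (norm (x t \<omega>)) / ereal (ln t)) \<le> ereal (- \<epsilon> / 2)"
    proof eventually_elim
      case (elim \<omega>)
      then obtain K where "0 < K" "\<forall>t\<ge>0. weight \<epsilon> t * (norm (x t \<omega>))\<^sup>2 \<le> K" by blast
      then show ?case by (intro Limsup_log_le_of_weight_bounded[OF _ \<epsilon>(1)]) auto
    qed
  qed
qed

end
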